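(* Let $\alpha\in(0,1)$, $\beta\in(0,1/2)$, $\lambda\ge 0$ and $k>0$. The solution of the tempered fractional equation $$D_t^{2\beta}u+2k\,D_t^{\beta}u=\Big[\lambda^\alpha-\Big(\lambda-\frac{\partial^2}{\partial x^2}\Big)^{\alpha}\Big]u,\qquad -\infty<x<+\infty,$$ under the conditions $u(x,0)=\delta(x)$ (the Dirac delta at $0$) and $u(0,t)=0$, coincides with the probability law of the process $$W(t):=B\big(\mathcal T_{\lambda,\alpha}(\mathcal L^\beta(t))\big),\qquad t>0.$$ Moreover, the fundamental solution of this equation has the following Fourier transform with respect to $x$: $$\widehat u(\xi,t)=\frac12\left[\left(1+\frac{k}{\sqrt{k^2-\theta(\xi)}}\right)E_{\beta,1}(r_1t^\beta)+\left(1-\frac{k}{\sqrt{k^2-\theta(\xi)}}\right)E_{\beta,1}(r_2t^\beta)\right],$$ with $$\theta(\xi)=(\lambda+\|\xi\|^2)^\alpha-\lambda^\alpha,\qquad r_1=-k+\sqrt{k^2-\theta(\xi)},\qquad r_2=-k-\sqrt{k^2-\theta(\xi)},$$ and where $E_{\beta,\gamma}$ is the Mittag-Leffler function.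
   Context: For $\gamma\in(0,1)$, $D_t^\gamma$ is the Caputo fractional derivative in time, $D_t^\gamma f(t)=\frac{1}{\Gamma(1-\gamma)}\int_0^t (t-\tau)^{-\gamma}f'(\tau)\,d\tau$. The operator $(\lambda-\partial_x^2)^\alpha$ on the real line is the fractional power with Fourier symbol $(\lambda+\|\xi\|^2)^\alpha$. The hat denotes the Fourier transform with respect to $x$ (for a probability law, its characteristic function). The Mittag-Leffler function is $E_{\beta,\gamma}(t)=\sum_{j=0}^\infty \frac{t^j}{\Gamma(\beta j+\gamma)}$ for $\beta>0$, $\gamma\in\mathbb C$. Processes (taken independent of one another): - $B$ is a Brownian motion on the real line. - $\mathcal T_{\lambda,\alpha}$ is the tempered stable subordinator, with transition density $f_{\lambda,\alpha}(x,t)=e^{-\lambda x+\lambda^\alpha t}h_\alpha(x,t)$, where $h_\alpha(x,t)$ is the transition density of the $\alpha$-stable subordinator, $\int_0^\infty e^{-sx}h_\alpha(x,t)\,dx=e^{-ts^\alpha}$. - $\mathcal L^\beta(t):=\inf\{s\ge0:\ H_1^{2\beta}(s)+(2k)^{1/\beta}H_2^{\beta}(s)\ge t\}$ is the inverse process of the sum of two independent positively skewed stable processes (stable subordinators) $H_1^{2\beta}$ and $H_2^{\beta}$, of index $2\beta$ and $\beta$; the sum $H_1^{2\beta}+(2k)^{1/\beta}H_2^{\beta}$ has Laplace exponent $s^{2\beta}+2ks^\beta$.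
   Formalization: Brownian motion is taken with variance 2t (with variance t the claim fails); u(0,t)=0 is imposed only on the chosen version of the density, since a genuine boundary condition contradicts the law of W(t); where θ(ξ)=k² the formula, undefined as printed, is read as a limit. *)

theory Defs
  imports "HOL-Probability.Probability"
begin

section \<open>The equation\<close>

definition mittag_leffler :: "real \<Rightarrow> complex \<Rightarrow> complex \<Rightarrow> complex" where
  "mittag_leffler \<beta> \<gamma> z = (\<Sum>j. z ^ j / Gamma (of_real \<beta> * of_nat j + \<gamma>))"

definition caputo :: "real \<Rightarrow> (real \<Rightarrow> complex) \<Rightarrow> real \<Rightarrow> complex" where
  "caputo \<gamma> f t = (1 / Gamma (1 - \<gamma>)) *\<^sub>R
     (LBINT \<tau>:{0<..<t}. (t - \<tau>) powr (-\<gamma>) *\<^sub>R vector_derivative f (at \<tau>))"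

text \<open>Existence of the Caputo derivative: integrability of the kernel against the derivative
  forces the derivative itself to be integrable near 0, so f is absolutely continuous.\<close>

definition caputo_differentiable :: "real \<Rightarrow> (real \<Rightarrow> complex) \<Rightarrow> real \<Rightarrow> bool" where
  "caputo_differentiable \<gamma> f t \<longleftrightarrow>
     (\<forall>\<tau>\<in>{0<..<t}. f differentiable (at \<tau>)) \<and>
     set_integrable lborel {0<..<t} (\<lambda>\<tau>. (t - \<tau>) powr (-\<gamma>) *\<^sub>R vector_derivative f (at \<tau>))"

definition schwartz :: "(real \<Rightarrow> complex) \<Rightarrow> bool" where
  "schwartz \<phi> \<longleftrightarrow> (\<exists>D :: nat \<Rightarrow> real \<Rightarrow> complex. D 0 = \<phi> \<and>
     (\<forall>n x. (D n has_vector_derivative D (Suc n) x) (at x)) \<and>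
     (\<forall>m n. bounded (range (\<lambda>x. x ^ m *\<^sub>R D n x))))"

text \<open>Sign convention of the characteristic function.\<close>

definition fourier :: "(real \<Rightarrow> complex) \<Rightarrow> real \<Rightarrow> complex" where
  "fourier \<phi> \<xi> = (LBINT x. iexp (\<xi> * x) * \<phi> x)"

text \<open>The operator with Fourier symbol \<open>(\<lambda> + \<xi>\<^sup>2)\<^sup>\<alpha>\<close>, that is, the fractional power of
  \<open>\<lambda> - \<partial>\<^sub>x\<^sup>2\<close>, acting on a Schwartz function.\<close>

definition frac_power_op :: "real \<Rightarrow> real \<Rightarrow> (real \<Rightarrow> complex) \<Rightarrow> real \<Rightarrow> complex" where
  "frac_power_op lam \<alpha> \<phi> x =
     1 / (2 * of_real pi) *
     (LBINT \<xi>. iexp (- (\<xi> * x)) * (of_real ((lam + \<xi>\<^sup>2) powr \<alpha>) * fourier \<phi> \<xi>))"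

definition pairing :: "(real \<Rightarrow> real \<Rightarrow> real) \<Rightarrow> (real \<Rightarrow> complex) \<Rightarrow> real \<Rightarrow> complex" where
  "pairing u \<phi> t = (LBINT x. of_real (u x t) * \<phi> x)"

text \<open>Because of the Dirac initial datum the equation is understood in the sense of distributions
  in \<open>x\<close>: it is tested against Schwartz functions \<open>\<phi>\<close>. The symbol of the operator is real and
  even, so the operator is moved to \<open>\<phi>\<close> without change. Solutions are families of (signed)
  integrable functions whose \<open>L\<^sup>1\<close>-norm is locally bounded in time. Only the class of
  \<open>u(\<cdot>,t)\<close> modulo null sets is determined by the equation and the initial datum;
  the condition \<open>u(0,t) = 0\<close> concerns the representative.\<close>

definition tempered_solution ::
    "real \<Rightarrow> real \<Rightarrow> real \<Rightarrow> real \<Rightarrow> (real \<Rightarrow> real \<Rightarrow> real) \<Rightarrow> bool" where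
  "tempered_solution \<alpha> \<beta> lam k u \<longleftrightarrow>
     (\<forall>t>0. integrable lborel (\<lambda>x. u x t)) \<and>
     (\<forall>b>0. \<exists>C. \<forall>t\<in>{0<..b}. (LBINT x. \<bar>u x t\<bar>) \<le> C) \<and>
     (\<forall>\<phi> t. schwartz \<phi> \<and> t > 0 \<longrightarrow>
        caputo_differentiable (2 * \<beta>) (pairing u \<phi>) t \<and>
        caputo_differentiable \<beta> (pairing u \<phi>) t \<and>
        caputo (2 * \<beta>) (pairing u \<phi>) t + 2 * of_real k * caputo \<beta> (pairing u \<phi>) t =
          pairing u (\<lambda>x. of_real (lam powr \<alpha>) * \<phi> x - frac_power_op lam \<alpha> \<phi> x) t) \<and>
     (\<forall>\<phi>. schwartz \<phi> \<longrightarrow> (pairing u \<phi> \<longlongrightarrow> \<phi> 0) (at_right 0)) \<and>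
     (\<forall>t>0. u 0 t = 0)"

definition theta :: "real \<Rightarrow> real \<Rightarrow> real \<Rightarrow> real" where
  "theta \<alpha> lam \<xi> = (lam + \<xi>\<^sup>2) powr \<alpha> - lam powr \<alpha>"

text \<open>Only meaningful where \<open>theta \<alpha> lam \<xi> \<noteq> k\<^sup>2\<close>. The square root is complex; the expression
  is symmetric under a change of its sign, so the choice of branch is immaterial.\<close>

definition fund_sol_fourier :: "real \<Rightarrow> real \<Rightarrow> real \<Rightarrow> real \<Rightarrow> real \<Rightarrow> real \<Rightarrow> complex" where
  "fund_sol_fourier \<alpha> \<beta> lam k \<xi> t =
     (let q = csqrt (of_real (k\<^sup>2 - theta \<alpha> lam \<xi>));
          r1 = - of_real k + q;
          r2 = - of_real k - q
      in 1 / 2 * ((1 + of_real k / q) * mittag_leffler \<beta> 1 (r1 * of_real (t powr \<beta>)) +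
                  (1 - of_real k / q) * mittag_leffler \<beta> 1 (r2 * of_real (t powr \<beta>))))"


section \<open>The processes\<close>

text \<open>Processes are maps \<open>X :: real \<Rightarrow> 'w \<Rightarrow> real\<close>; only times \<open>t \<ge> 0\<close> are constrained.\<close>

definition independent_increments :: "'w measure \<Rightarrow> (real \<Rightarrow> 'w \<Rightarrow> real) \<Rightarrow> bool" where
  "independent_increments M X \<longleftrightarrow>
     (\<forall>(n::nat) ts :: nat \<Rightarrow> real. 0 \<le> ts 0 \<and> mono ts \<longrightarrow>
        prob_space.indep_vars M (\<lambda>_. borel) (\<lambda>i \<omega>. X (ts (Suc i)) \<omega> - X (ts i) \<omega>) {..<n})"

text \<open>Brownian motion is normalised to have generator \<open>\<partial>\<^sub>x\<^sup>2\<close> (variance \<open>2t\<close>),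
  as required by the symbol \<open>\<lambda> + \<xi>\<^sup>2\<close> of \<open>\<lambda> - \<partial>\<^sub>x\<^sup>2\<close>.\<close>

definition brownian_motion :: "'w measure \<Rightarrow> (real \<Rightarrow> 'w \<Rightarrow> real) \<Rightarrow> bool" where
  "brownian_motion M B \<longleftrightarrow>
     (\<forall>t\<ge>0. B t \<in> borel_measurable M) \<and>
     (\<forall>\<omega>\<in>space M. B 0 \<omega> = 0 \<and> continuous_on {0..} (\<lambda>t. B t \<omega>)) \<and>
     independent_increments M B \<and>
     (\<forall>s t. 0 \<le> s \<and> s < t \<longrightarrow>
        distributed M lborel (\<lambda>\<omega>. B t \<omega> - B s \<omega>) (normal_density 0 (sqrt (2 * (t - s)))))"

definition subordinator :: "'w measure \<Rightarrow> (real \<Rightarrow> 'w \<Rightarrow> real) \<Rightarrow> bool" where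
  "subordinator M X \<longleftrightarrow>
     (\<forall>t\<ge>0. X t \<in> borel_measurable M) \<and>
     (\<forall>\<omega>\<in>space M. X 0 \<omega> = 0 \<and> mono_on {0..} (\<lambda>t. X t \<omega>) \<and>
        (\<forall>t\<ge>0. continuous (at_right t) (\<lambda>s. X s \<omega>))) \<and>
     independent_increments M X \<and>
     (\<forall>s t. 0 \<le> s \<and> s \<le> t \<longrightarrow>
        distr M borel (\<lambda>\<omega>. X t \<omega> - X s \<omega>) = distr M borel (X (t - s)))"

definition stable_subordinator :: "real \<Rightarrow> 'w measure \<Rightarrow> (real \<Rightarrow> 'w \<Rightarrow> real) \<Rightarrow> bool" where
  "stable_subordinator \<gamma> M H \<longleftrightarrow> subordinator M H \<and>
     (\<forall>t\<ge>0. \<forall>s>0. (LINT \<omega>|M. exp (- (s * H t \<omega>))) = exp (- (t * s powr \<gamma>)))"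

definition stable_transition_density :: "real \<Rightarrow> (real \<Rightarrow> real \<Rightarrow> real) \<Rightarrow> bool" where
  "stable_transition_density \<alpha> h \<longleftrightarrow>
     (\<forall>t>0. (\<forall>x>0. 0 \<le> h x t) \<and>
        (\<forall>s>0. (LBINT x:{0<..}. exp (- (s * x)) * h x t) = exp (- (t * s powr \<alpha>))))"

definition tempered_density ::
    "real \<Rightarrow> real \<Rightarrow> (real \<Rightarrow> real \<Rightarrow> real) \<Rightarrow> real \<Rightarrow> real \<Rightarrow> real" where
  "tempered_density lam \<alpha> h x t =
     (if x > 0 then exp (- lam * x + lam powr \<alpha> * t) * h x t else 0)"

definition tempered_stable_subordinator ::
    "real \<Rightarrow> real \<Rightarrow> 'w measure \<Rightarrow> (real \<Rightarrow> 'w \<Rightarrow> real) \<Rightarrow> bool" where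
  "tempered_stable_subordinator lam \<alpha> M T \<longleftrightarrow> subordinator M T \<and>
     (\<exists>h. stable_transition_density \<alpha> h \<and>
        (\<forall>s t. 0 \<le> s \<and> s < t \<longrightarrow>
           distributed M lborel (\<lambda>\<omega>. T t \<omega> - T s \<omega>)
             (\<lambda>x. ennreal (tempered_density lam \<alpha> h x (t - s)))))"

text \<open>Joint independence of finitely many processes, as random elements of path space.\<close>

definition independent_processes :: "'w measure \<Rightarrow> (real \<Rightarrow> 'w \<Rightarrow> real) list \<Rightarrow> bool" where
  "independent_processes M Xs \<longleftrightarrow>
     prob_space.indep_vars M (\<lambda>_. PiM {0..} (\<lambda>_. borel))
       (\<lambda>i \<omega>. \<lambda>t\<in>{0..}. (Xs ! i) t \<omega>) {..<length Xs}"

text \<open>The set below is almost surely nonempty; the value 0 on the exceptional null event only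
  avoids the unspecified real infimum of the empty set.\<close>

definition inverse_process ::
    "real \<Rightarrow> real \<Rightarrow> (real \<Rightarrow> 'w \<Rightarrow> real) \<Rightarrow> (real \<Rightarrow> 'w \<Rightarrow> real) \<Rightarrow> real \<Rightarrow> 'w \<Rightarrow> real" where
  "inverse_process \<beta> k H1 H2 t \<omega> =
     (let S = {s. 0 \<le> s \<and> H1 s \<omega> + (2 * k) powr (1 / \<beta>) * H2 s \<omega> \<ge> t}
      in if S = {} then 0 else Inf S)"

end

theory Submission
  imports Defs "HOL-Real_Asymp.Real_Asymp"
begin

text \<open>
  The Fourier transform in \<open>x\<close> turns the equation into a scalar fractional relaxation equation for
  every frequency \<open>\<xi>\<close>: with \<open>\<theta> = theta \<alpha> lam \<xi>\<close> the transform \<open>g\<close> of a solution should satisfy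
  \<open>D\<^sup>2\<^sup>\<beta> g + 2k D\<^sup>\<beta> g = - \<theta> g\<close> and \<open>g(0) = 1\<close>. This problem is solved by a power series in \<open>t\<^sup>\<beta>\<close>, the
  function \<open>relaxation\<close>, whose coefficients obey a two-term recurrence with characteristic roots
  \<open>r\<^sub>1, r\<^sub>2\<close>. As long as the roots are distinct, the series is the asserted combination of two
  Mittag-Leffler functions (\<open>fund_sol_fourier_eq_relaxation\<close>).

  On the probabilistic side, conditioning on the random times, first on \<open>T(L(t))\<close> and then on
  \<open>L(t)\<close>, gives \<open>E exp(i \<xi> W(t)) = E exp(- \<xi>\<^sup>2 T(L(t))) = E exp(- \<theta> L(t))\<close>
  (\<open>expectation_at_independent_time\<close>). Because \<open>L\<close> is the inverse of the
  subordinator \<open>H = H\<^sub>1 + (2k)\<^bsup>1/\<beta>\<^esup> H\<^sub>2\<close>, the events \<open>s < L(t)\<close> and \<open>H(s) < t\<close> agree, and Tonelli's theorem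
  computes the Laplace transform of \<open>t \<mapsto> E exp(- \<theta> L(t))\<close> as \<open>\<Phi>(p) / (p (\<Phi>(p) + \<theta>))\<close> with
  \<open>\<Phi>(p) = p\<^bsup>2\<beta>\<^esup> + 2k p\<^sup>\<beta>\<close>. The relaxation series has the same Laplace transform for large \<open>p\<close>; one
  of the two functions is monotone, the other is continuous, and so they coincide
  (\<open>laplace_inverse_process\<close>). Hence the characteristic function of \<open>W(t)\<close> is the relaxation function.

  A solution exists: \<open>B\<close> at the independent time \<open>T(L(t)) > 0\<close> has as density a mixture \<open>U\<close> of centred
  normal densities, and the Fourier transform of \<open>U\<close> is the relaxation function. Tested against a
  Schwartz function, both sides of the equation become integrals over \<open>\<xi>\<close> of the scalar equation,
  once time derivatives may be taken under the integral. The majorant needed for that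
  comes from combining the two points of view: since \<open>L\<close> increases in time, the relaxation function
  decreases, and then a Volterra equation for its derivative bounds the derivative by
  \<open>\<theta> t\<^bsup>2\<beta>-1\<^esup> / \<Gamma>(2\<beta>)\<close>, which grows at most quadratically in \<open>\<xi>\<close> (\<open>relaxation_deriv_bound\<close>, \<open>solution_U\<close>).

  It is unique: testing with the wave packets \<open>exp(i \<xi>\<^sub>0 x) exp(- \<epsilon>\<^sup>2 x\<^sup>2 / 2)\<close> and letting \<open>\<epsilon> \<rightarrow> 0\<close>
  isolates the single frequency \<open>\<xi>\<^sub>0\<close>. The limit is taken in the equation after fractional
  integration, which is a Volterra equation free of derivatives; a bounded solution of such an
  equation is unique by a contraction argument. So every solution has the relaxation function as
  its Fourier transform (\<open>fourier_solution\<close>), equals \<open>U(\<cdot>, t)\<close> almost everywhere, and is the density of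
  \<open>W(t)\<close> by Levy's uniqueness theorem. At a frequency with \<open>\<theta> = k\<^sup>2\<close> the closed formula is recovered
  as a limit because characteristic functions are continuous.
\<close>

section \<open>Fractional integrals and Caputo derivatives\<close>

text \<open>Euler's integral for the Gamma function after rescaling.\<close>

lemma has_bochner_integral_powr_exp:
  fixes c p :: real
  assumes c: "0 < c" and p: "0 < p"
  shows "has_bochner_integral lborel (\<lambda>t. indicator {0<..} t * (exp (- (p * t)) * t powr (c - 1))) (Gamma c * p powr (- c))"
proof -
  have "has_bochner_integral lborel (\<lambda>x. indicator {0..} x * (x powr (c - 1) / exp x)) (Gamma c)"
  proof (rule has_bochner_integral_nn_integral)
    show "(\<integral>\<^sup>+ x. ennreal (indicator {0..} x * (x powr (c - 1) / exp x)) \<partial>lborel) = ennreal (Gamma c)"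
      using Gamma_conv_nn_integral_real[OF c] by (simp add: mult.assoc)
  qed (use c in \<open>auto intro: Gamma_real_nonneg\<close>)
  then have "has_bochner_integral lborel (\<lambda>x. p powr (1 - c) * (indicator {0..} x * (x powr (c - 1) / exp x))) (p powr (1 - c) * Gamma c)"
    by (rule has_bochner_integral_mult_right)
  moreover have "p powr (1 - c) * (indicator {0..} x * (x powr (c - 1) / exp x)) =
    indicator {0<..} (0 + (1 / p) * x) * (exp (- (p * (0 + (1 / p) * x))) * (0 + (1 / p) * x) powr (c - 1))" for x
  proof -
    have "(x / p) powr (c - 1) = p powr (1 - c) * x powr (c - 1)" if "0 < x"
      using powr_minus_divide[of p "c - 1"] p that by (simp add: powr_divide)
    then show ?thesis using p by (cases "x = 0") (auto simp: indicator_def exp_minus field_simps zero_less_divide_iff)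
  qed
  ultimately have "has_bochner_integral lborel (\<lambda>x. indicator {0<..} (0 + (1 / p) * x) * (exp (- (p * (0 + (1 / p) * x))) * (0 + (1 / p) * x) powr (c - 1))) (p powr (1 - c) * Gamma c)"
    by simp
  moreover have "p powr (1 - c) * Gamma c = (Gamma c * p powr (- c)) /\<^sub>R \<bar>1 / p\<bar>"
    using p by (simp add: powr_diff powr_minus field_simps)
  ultimately show ?thesis
    by (subst lborel_has_bochner_integral_real_affine_iff[where c = "1 / p" and t = 0]) (use p in simp_all)
qed

lemma has_bochner_integral_exp:
  fixes p :: real
  assumes "0 < p"
  shows "has_bochner_integral lborel (\<lambda>t. indicator {0<..} t * exp (- (p * t))) (1 / p)"
proof -
  have e: "(\<lambda>t :: real. indicator {0<..} t * (exp (- (p * t)) * t powr (1 - 1))) = (\<lambda>t. indicator {0<..} t * exp (- (p * t)))"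
    by (auto simp: indicator_def fun_eq_iff)
  show ?thesis
    using has_bochner_integral_powr_exp[OF zero_less_one assms, unfolded e] assms by (simp add: powr_minus_divide)
qed

text \<open>The Riemann--Liouville fractional integral of order \<open>a\<close>, started at time 0.\<close>

definition frac_integral :: "real \<Rightarrow> (real \<Rightarrow> complex) \<Rightarrow> real \<Rightarrow> complex" where
  "frac_integral a f t = (1 / Gamma a) *\<^sub>R (LBINT s:{0<..<t}. (t - s) powr (a - 1) *\<^sub>R f s)"

text \<open>An affine substitution carrying \<open>{0..1}\<close> to \<open>{s..t}\<close> turns Euler's Beta integral into a
  convolution of two power kernels. The cut-off is written into the integrand so that it can serve
  as a kernel in two variables for Fubini's theorem.\<close>

lemma has_bochner_integral_beta_kernel:
  fixes a b s t :: real
  assumes "0 < a" "0 < b" "s < t"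
  shows "has_bochner_integral lborel
    (\<lambda>x. if s < x \<and> x < t then (t - x) powr (a - 1) * (x - s) powr (b - 1) else 0)
    (Beta a b * (t - s) powr (a + b - 1))"
proof -
  let ?f = "\<lambda>x. if s < x \<and> x < t then (t - x) powr (a - 1) * (x - s) powr (b - 1) else 0"
  define c where "c = t - s"
  have c: "c > 0" using assms by (simp add: c_def)
  have 1: "set_integrable lborel {0..1} (\<lambda>t. t powr (b - 1) * (1 - t) powr (a - 1))"
    by (rule integrable_Beta) (use assms in auto)
  have 2: "(LBINT x:{0..1}. x powr (b - 1) * (1 - x) powr (a - 1)) = Beta b a"
    using has_integral_Beta_real[OF assms(2,1)] set_borel_integral_eq_integral(2)[OF 1]
    by (simp add: integral_unique)
  have 3: "has_bochner_integral lborel (\<lambda>x. indicator {0..1} x *\<^sub>R (x powr (b - 1) * (1 - x) powr (a - 1)))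
     (Beta a b)"
    using 1 2 unfolding set_integrable_def set_lebesgue_integral_def
    by (simp add: has_bochner_integral_iff Beta_commute)
  have 4: "has_bochner_integral lborel (\<lambda>x. c powr (a + b - 2) *
      (indicator {0..1} x *\<^sub>R (x powr (b - 1) * (1 - x) powr (a - 1)))) (c powr (a + b - 2) * Beta a b)"
    by (rule has_bochner_integral_mult_right[OF 3])
  have 5: "?f (s + c * x) = c powr (a + b - 2) *
      (indicator {0..1} x *\<^sub>R (x powr (b - 1) * (1 - x) powr (a - 1)))" for x
  proof (cases "0 < x \<and> x < 1")
    case True
    have e: "t - (s + c * x) = c * (1 - x)" "s + c * x - s = c * x"
      by (auto simp: c_def algebra_simps)
    have "s < s + c * x" using True c by simp
    moreover have "s + c * x < t"
    proof -
      have "0 < c * (1 - x)" using True c by simp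
      then show ?thesis using e(1) by linarith
    qed
    ultimately have "?f (s + c * x) = (c * (1 - x)) powr (a - 1) * (c * x) powr (b - 1)"
      using e by simp
    also have "\<dots> = (c powr (a - 1) * c powr (b - 1)) * (x powr (b - 1) * (1 - x) powr (a - 1))"
      using True c by (simp add: powr_mult)
    also have "c powr (a - 1) * c powr (b - 1) = c powr (a + b - 2)"
      by (simp add: powr_add[symmetric] algebra_simps)
    finally show ?thesis using True by simp
  next
    case False
    have "\<not> (s < s + c * x \<and> s + c * x < t)"
    proof
      assume h: "s < s + c * x \<and> s + c * x < t"
      then have "0 < c * x" by simp
      then have "0 < x" using c by (simp add: zero_less_mult_iff)
      moreover have "c * x < c * 1" using h c_def by linarith
      then have "x < 1" using c by (simp only: mult_less_cancel_left_pos)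
      ultimately show False using False by simp
    qed
    moreover have "x = 0 \<or> x = 1 \<or> x < 0 \<or> x > 1" using False by linarith
    then have "indicator {0..1} x *\<^sub>R (x powr (b - 1) * (1 - x) powr (a - 1)) = 0" by auto
    ultimately show ?thesis by (metis mult_zero_right)
  qed
  have "has_bochner_integral lborel (\<lambda>x. ?f (s + c * x)) (c powr (a + b - 2) * Beta a b)"
    using 4 unfolding 5 .
  moreover have "c powr (a + b - 2) * Beta a b = (Beta a b * c powr (a + b - 1)) /\<^sub>R \<bar>c\<bar>"
  proof -
    have "c powr (a + b - 1) = c powr (a + b - 2) * c powr 1"
      by (subst powr_add[symmetric]) simp
    then show ?thesis using c by (simp add: field_simps)
  qed
  ultimately have "has_bochner_integral lborel (\<lambda>x. ?f (s + c * x)) ((Beta a b * c powr (a + b - 1)) /\<^sub>R \<bar>c\<bar>)"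
    by simp
  then have "has_bochner_integral lborel ?f (Beta a b * c powr (a + b - 1))"
    by (subst lborel_has_bochner_integral_real_affine_iff[where c = c and t = s]) (use c in simp_all)
  then show ?thesis by (simp add: c_def)
qed

text \<open>Fubini's theorem on the triangle \<open>0 < r < s < t\<close>: the inner integral of the two kernels over
  \<open>s\<close> is a Beta integral. Because of \<open>1 \<le> a + b\<close> the resulting kernel \<open>(t - r) powr (a + b - 1)\<close>
  is bounded, which makes integrability of \<open>f\<close> sufficient.\<close>

lemma frac_integral_semigroup:
  fixes f :: "real \<Rightarrow> complex"
  assumes a: "0 < a" and b: "0 < b" and ab: "1 \<le> a + b"
    and f: "set_integrable lborel {0<..<t} f"
  shows set_integrable_frac_integral:
      "set_integrable lborel {0<..<t} (\<lambda>s. (t - s) powr (a - 1) *\<^sub>R frac_integral b f s)"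
    and frac_integral_frac_integral:
      "frac_integral a (frac_integral b f) t = frac_integral (a + b) f t"
proof -
  define f0 where "f0 = (\<lambda>r. indicator {0<..<t} r *\<^sub>R f r)"
  have f0: "integrable lborel f0" using f by (simp add: f0_def set_integrable_def)
  note [measurable] = borel_measurable_integrable[OF f0]
  define K where "K = (\<lambda>r s. if r < s \<and> s < t then (t - s) powr (a - 1) * (s - r) powr (b - 1) else 0)"
  have K: "has_bochner_integral lborel (K r) (Beta a b * (t - r) powr (a + b - 1))" if "r < t" for r
    unfolding K_def by (rule has_bochner_integral_beta_kernel) (use that a b in auto)
  have Kpos: "K r s \<ge> 0" for r s by (simp add: K_def)
  define F where "F = (\<lambda>r s. K r s *\<^sub>R f0 r)"
  have Fm[measurable]: "case_prod F \<in> borel_measurable (lborel \<Otimes>\<^sub>M lborel)"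
    unfolding F_def K_def by measurable
  have f00: "f0 r = 0" if "\<not> r < t" for r using that by (simp add: f0_def)
  have nF: "(LINT s|lborel. norm (F r s)) = Beta a b * (t - r) powr (a + b - 1) * norm (f0 r)" for r
  proof (cases "r < t")
    case True
    then show ?thesis using K[OF True] Kpos
      by (simp add: F_def has_bochner_integral_iff)
  qed (simp add: F_def f00)
  have IF: "integrable (lborel \<Otimes>\<^sub>M lborel) (case_prod F)"
  proof (rule lborel_pair.Fubini_integrable)
    show "integrable lborel (\<lambda>x. LINT y|lborel. norm ((case_prod F) (x, y)))"
    proof (rule Bochner_Integration.integrable_bound)
      show "integrable lborel (\<lambda>r. (Beta a b * t powr (a + b - 1)) *\<^sub>R f0 r)" using f0 by simp
      have B: "Beta a b \<ge> 0" using a b by (simp add: Beta_def Gamma_real_nonneg)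
      show "AE x in lborel. norm (LINT y|lborel. norm ((case_prod F) (x, y)))
            \<le> norm ((Beta a b * t powr (a + b - 1)) *\<^sub>R f0 x)"
      proof (rule AE_I2)
        fix x
        show "norm (LINT y|lborel. norm ((case_prod F) (x, y)))
            \<le> norm ((Beta a b * t powr (a + b - 1)) *\<^sub>R f0 x)"
        proof (cases "0 < x \<and> x < t")
          case True
          have "(t - x) powr (a + b - 1) \<le> t powr (a + b - 1)"
            by (rule powr_mono2) (use True ab in auto)
          then show ?thesis using B nF[of x] by (simp add: abs_mult mult_left_mono mult_right_mono)
        next
          case False
          then have "f0 x = 0" by (auto simp: f0_def)
          then show ?thesis by (simp add: F_def)
        qed
      qed
    qed measurable
    show "AE x in lborel. integrable lborel (\<lambda>y. (case_prod F) (x, y))"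
    proof (rule AE_I2)
      fix x
      show "integrable lborel (\<lambda>y. (case_prod F) (x, y))"
        using K[of x] f00[of x] by (cases "x < t") (auto simp: F_def has_bochner_integral_iff)
    qed
  qed measurable
  have E: "(LINT r|lborel. F r s) =
      indicator {0<..<t} s *\<^sub>R (Gamma b *\<^sub>R ((t - s) powr (a - 1) *\<^sub>R frac_integral b f s))" for s
  proof (cases "0 < s \<and> s < t")
    case True
    have "F r s = (t - s) powr (a - 1) *\<^sub>R (indicator {0<..<s} r *\<^sub>R ((s - r) powr (b - 1) *\<^sub>R f r))" for r
      using True by (auto simp: F_def K_def f0_def indicator_def)
    then have "(LINT r|lborel. F r s) = (t - s) powr (a - 1) *\<^sub>R (LBINT r:{0<..<s}. (s - r) powr (b - 1) *\<^sub>R f r)"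
      by (simp only: set_lebesgue_integral_def integral_scaleR_right)
    moreover have "Gamma b \<noteq> 0" using b by (simp add: less_imp_neq[OF Gamma_real_pos, symmetric])
    ultimately show ?thesis using True by (simp add: frac_integral_def)
  next
    case False
    then have "F r s = 0" for r by (auto simp: F_def K_def f0_def)
    then show ?thesis using False by auto
  qed
  have Gb: "Gamma b > 0" "Gamma a > 0" "Gamma (a + b) > 0" using a b by (auto intro: Gamma_real_pos)
  have "integrable lborel (\<lambda>s. LINT r|lborel. F r s)"
    by (rule lborel_pair.integrable_snd[OF IF])
  then have I1: "set_integrable lborel {0<..<t} (\<lambda>s. Gamma b *\<^sub>R ((t - s) powr (a - 1) *\<^sub>R frac_integral b f s))"
    unfolding E set_integrable_def .
  have "set_integrable lborel {0<..<t} (\<lambda>s. (1 / Gamma b) *\<^sub>R (Gamma b *\<^sub>R ((t - s) powr (a - 1) *\<^sub>R frac_integral b f s)))"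
    by (rule set_integrable_scaleR_right) (rule I1)
  then show "set_integrable lborel {0<..<t} (\<lambda>s. (t - s) powr (a - 1) *\<^sub>R frac_integral b f s)"
    using Gb by simp
  have "(LINT s|lborel. LINT r|lborel. F r s) = (LINT r|lborel. LINT s|lborel. F r s)"
    by (rule lborel_pair.Fubini_integral[OF IF])
  also have "(\<lambda>r. LINT s|lborel. F r s) =
      (\<lambda>r. Beta a b *\<^sub>R (indicator {0<..<t} r *\<^sub>R ((t - r) powr (a + b - 1) *\<^sub>R f r)))"
  proof
    fix r
    show "(LINT s|lborel. F r s) = Beta a b *\<^sub>R (indicator {0<..<t} r *\<^sub>R ((t - r) powr (a + b - 1) *\<^sub>R f r))"
      using K[of r] by (cases "r < t") (auto simp: F_def has_bochner_integral_iff f0_def)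
  qed
  also have "(LINT s|lborel. LINT r|lborel. F r s) =
     Gamma b *\<^sub>R (LBINT s:{0<..<t}. (t - s) powr (a - 1) *\<^sub>R frac_integral b f s)"
    unfolding E by (simp only: set_lebesgue_integral_def[symmetric] set_integral_scaleR_right)
  finally have "Gamma b *\<^sub>R (LBINT s:{0<..<t}. (t - s) powr (a - 1) *\<^sub>R frac_integral b f s)
      = Beta a b *\<^sub>R (LBINT r:{0<..<t}. (t - r) powr (a + b - 1) *\<^sub>R f r)"
    by (simp only: set_lebesgue_integral_def integral_scaleR_right)
  then have "(1 / (Gamma a * Gamma b)) *\<^sub>R (Gamma b *\<^sub>R (LBINT s:{0<..<t}. (t - s) powr (a - 1) *\<^sub>R frac_integral b f s))
      = (1 / (Gamma a * Gamma b)) *\<^sub>R (Beta a b *\<^sub>R (LBINT r:{0<..<t}. (t - r) powr (a + b - 1) *\<^sub>R f r))"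
    by simp
  then show "frac_integral a (frac_integral b f) t = frac_integral (a + b) f t"
    using Gb by (simp add: frac_integral_def[of a] frac_integral_def[of "a + b"] Beta_def)
qed

lemma frac_integral_one: "frac_integral 1 f t = (LBINT s:{0<..<t}. f s)"
proof -
  have "(LBINT s:{0<..<t}. (t - s) powr (1 - 1) *\<^sub>R f s) = (LBINT s:{0<..<t}. f s)"
    by (rule set_lebesgue_integral_cong) auto
  then show ?thesis by (simp add: frac_integral_def)
qed

lemma caputo_eq_frac_integral:
  "caputo g p t = frac_integral (1 - g) (\<lambda>s. vector_derivative p (at s)) t"
  by (simp add: caputo_def frac_integral_def)

lemma frac_integral_cong:
  assumes "\<And>s. 0 < s \<Longrightarrow> s < t \<Longrightarrow> f s = g s"
  shows "frac_integral a f t = frac_integral a g t"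
  unfolding frac_integral_def
  by (intro arg_cong[where f = "\<lambda>x. _ *\<^sub>R x"] set_lebesgue_integral_cong) (use assms in auto)

lemma frac_integral_power:
  fixes a b t :: real
  assumes a: "0 < a" and b: "0 < b" and t: "0 < t"
  shows "set_integrable lborel {0<..<t} (\<lambda>s. (t - s) powr (a - 1) * s powr (b - 1))"
    and "(LBINT s:{0<..<t}. (t - s) powr (a - 1) * s powr (b - 1)) = Beta a b * t powr (a + b - 1)"
proof -
  have e: "(\<lambda>x. if 0 < x \<and> x < t then (t - x) powr (a - 1) * (x - 0) powr (b - 1) else 0) =
      (\<lambda>x. indicator {0<..<t} x *\<^sub>R ((t - x) powr (a - 1) * x powr (b - 1)))"
    by (auto simp: indicator_def)
  note h = has_bochner_integral_beta_kernel[OF a b t, unfolded e]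
  show "set_integrable lborel {0<..<t} (\<lambda>s. (t - s) powr (a - 1) * s powr (b - 1))"
    using h by (simp add: set_integrable_def has_bochner_integral_iff)
  show "(LBINT s:{0<..<t}. (t - s) powr (a - 1) * s powr (b - 1)) = Beta a b * t powr (a + b - 1)"
    using h by (simp add: set_lebesgue_integral_def has_bochner_integral_iff)
qed

lemma set_integrable_kernel:
  fixes a t :: real
  assumes a: "0 < a" and t: "0 < t"
  shows "set_integrable lborel {0<..<t} (\<lambda>s. (t - s) powr (a - 1))"
proof -
  have "set_integrable lborel {0<..<t} (\<lambda>s. (t - s) powr (a - 1) * s powr (1 - 1))"
    by (rule frac_integral_power) (use assms in auto)
  moreover have "set_integrable lborel {0<..<t} (\<lambda>s. (t - s) powr (a - 1) * s powr (1 - 1)) =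
      set_integrable lborel {0<..<t} (\<lambda>s. (t - s) powr (a - 1))"
    by (rule set_integrable_cong) auto
  ultimately show ?thesis by simp
qed

text \<open>Dominated convergence with the integrable kernel as majorant. Equations between fractional
  integrals therefore survive bounded pointwise limits, in contrast to equations between
  fractional derivatives.\<close>

lemma frac_integral_tendsto:
  fixes f :: "real \<Rightarrow> complex"
  assumes a: "0 < a" and t: "0 < t"
    and lim: "\<And>s. 0 < s \<Longrightarrow> s < t \<Longrightarrow> (\<lambda>n. fn n s) \<longlonglongrightarrow> f s"
    and bd: "\<And>n s. 0 < s \<Longrightarrow> s < t \<Longrightarrow> norm (fn n s) \<le> C"
    and meas: "\<And>n. (\<lambda>s. indicator {0<..<t} s *\<^sub>R ((t - s) powr (a - 1) *\<^sub>R fn n s)) \<in> borel_measurable lborel"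
  shows "(\<lambda>n. frac_integral a (fn n) t) \<longlonglongrightarrow> frac_integral a f t"
    and "set_integrable lborel {0<..<t} (\<lambda>s. (t - s) powr (a - 1) *\<^sub>R f s)"
proof -
  have lim': "(\<lambda>n. indicator {0<..<t} s *\<^sub>R ((t - s) powr (a - 1) *\<^sub>R fn n s)) \<longlonglongrightarrow> indicator {0<..<t} s *\<^sub>R ((t - s) powr (a - 1) *\<^sub>R f s)" for s
    by (cases "0 < s \<and> s < t") (auto intro!: tendsto_intros lim)
  have mf: "(\<lambda>s. indicator {0<..<t} s *\<^sub>R ((t - s) powr (a - 1) *\<^sub>R f s)) \<in> borel_measurable lborel"
    by (rule borel_measurable_LIMSEQ_metric[OF meas lim'])
  have w: "integrable lborel (\<lambda>s. C * (indicator {0<..<t} s *\<^sub>R (t - s) powr (a - 1)))"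
    using set_integrable_kernel[OF a t] unfolding set_integrable_def by (rule integrable_mult_right)
  have b: "norm (indicator {0<..<t} s *\<^sub>R ((t - s) powr (a - 1) *\<^sub>R fn n s)) \<le> C * (indicator {0<..<t} s *\<^sub>R (t - s) powr (a - 1))" for s n
    using bd[of s n] by (auto simp: indicator_def mult.commute intro!: mult_left_mono)
  note dct = mf meas w AE_I2[OF lim'] AE_I2[OF b]
  show "(\<lambda>n. frac_integral a (fn n) t) \<longlonglongrightarrow> frac_integral a f t"
    unfolding frac_integral_def set_lebesgue_integral_def by (intro tendsto_intros integral_dominated_convergence[OF dct])
  show "set_integrable lborel {0<..<t} (\<lambda>s. (t - s) powr (a - 1) *\<^sub>R f s)"
    unfolding set_integrable_def by (rule integrable_dominated_convergence[OF dct])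
qed

lemma frac_integral_diff:
  assumes "set_integrable lborel {0<..<t} (\<lambda>s. (t - s) powr (a - 1) *\<^sub>R f s)"
    and "set_integrable lborel {0<..<t} (\<lambda>s. (t - s) powr (a - 1) *\<^sub>R g s)"
  shows "frac_integral a (\<lambda>s. f s - g s) t = frac_integral a f t - frac_integral a g t"
proof -
  have "(LBINT s:{0<..<t}. (t - s) powr (a - 1) *\<^sub>R (f s - g s)) =
    (LBINT s:{0<..<t}. (t - s) powr (a - 1) *\<^sub>R f s) - (LBINT s:{0<..<t}. (t - s) powr (a - 1) *\<^sub>R g s)"
    unfolding scaleR_diff_right by (rule set_integral_diff(2)[OF assms])
  then show ?thesis by (simp add: frac_integral_def scaleR_diff_right)
qed

lemma frac_integral_cmult: "frac_integral a (\<lambda>s. c * f s) t = c * frac_integral a f t"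
  unfolding frac_integral_def mult_scaleR_right[symmetric] set_integral_mult_right ..

text \<open>The reciprocal \<open>(t - s) powr g\<close> of the kernel is bounded by \<open>t powr g\<close>, so the kernel can be
  divided out.\<close>

lemma caputo_differentiable_integrable_deriv:
  assumes g: "0 < g" and t: "0 < t" and p: "caputo_differentiable g p t"
  shows "set_integrable lborel {0<..<t} (\<lambda>s. vector_derivative p (at s))"
proof -
  let ?d = "\<lambda>s. vector_derivative p (at s)"
  have I: "integrable lborel (\<lambda>s. indicator {0<..<t} s *\<^sub>R ((t - s) powr (- g) *\<^sub>R ?d s))"
    using p by (simp add: caputo_differentiable_def set_integrable_def)
  have e: "indicator {0<..<t} s *\<^sub>R ?d s =
      (t - s) powr g *\<^sub>R (indicator {0<..<t} s *\<^sub>R ((t - s) powr (- g) *\<^sub>R ?d s))" for s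
    by (auto simp: indicator_def powr_minus)
  have m: "(\<lambda>s. indicator {0<..<t} s *\<^sub>R ?d s) \<in> borel_measurable lborel"
    unfolding e by (rule borel_measurable_scaleR[OF _ borel_measurable_integrable[OF I]]) simp
  show ?thesis unfolding set_integrable_def
  proof (rule Bochner_Integration.integrable_bound[OF integrable_scaleR_right[OF I, of "t powr g"] m])
    show "AE s in lborel. norm (indicator {0<..<t} s *\<^sub>R ?d s) \<le>
        norm (t powr g *\<^sub>R indicator {0<..<t} s *\<^sub>R ((t - s) powr (- g) *\<^sub>R ?d s))"
    proof (rule AE_I2)
      fix s
      show "norm (indicator {0<..<t} s *\<^sub>R ?d s) \<le>
        norm (t powr g *\<^sub>R indicator {0<..<t} s *\<^sub>R ((t - s) powr (- g) *\<^sub>R ?d s))"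
      proof (cases "0 < s \<and> s < t")
        case True
        have "1 = (t - s) powr g * (t - s) powr (- g)" using True by (simp add: powr_minus)
        also have "\<dots> \<le> t powr g * (t - s) powr (- g)"
          by (intro mult_right_mono powr_mono2) (use True g in auto)
        finally have "1 * norm (?d s) \<le> (t powr g * (t - s) powr (- g)) * norm (?d s)"
          by (rule mult_right_mono) simp
        then show ?thesis using True by (simp add: mult.assoc)
      qed auto
    qed
  qed
qed

text \<open>Nothing is known about differentiability at time 0. The fundamental theorem of calculus is
  applied on \<open>{t / (n + 2)..t}\<close>, an interval that stays nondegenerate for every \<open>n\<close>, and
  integrability of the derivative up to 0 allows \<open>n\<close> to tend to infinity.\<close>

lemma integral_deriv_from_0:
  fixes p :: "real \<Rightarrow> complex"
  assumes t: "0 < t"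
    and d: "\<And>s. 0 < s \<Longrightarrow> s \<le> t \<Longrightarrow> p differentiable (at s)"
    and I: "set_integrable lborel {0<..<t} (\<lambda>s. vector_derivative p (at s))"
    and p0: "(p \<longlongrightarrow> c) (at_right 0)"
  shows "(LBINT s:{0<..<t}. vector_derivative p (at s)) = p t - c"
proof -
  let ?d = "\<lambda>s. vector_derivative p (at s)"
  define A where "A = (\<lambda>n::nat. {t / (real n + 2)<..<t})"
  have tp: "0 < t / (real n + 2)" "t / (real n + 2) < t" for n
    using t by (auto simp: field_simps intro!: add_pos_nonneg)
  have "(\<lambda>n. LINT s|lborel. indicator (A n) s *\<^sub>R ?d s) \<longlonglongrightarrow> (LINT s|lborel. indicator {0<..<t} s *\<^sub>R ?d s)"
  proof (rule integral_dominated_convergence[where w = "\<lambda>s. norm (indicator {0<..<t} s *\<^sub>R ?d s)"])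
    show m: "(\<lambda>s. indicator {0<..<t} s *\<^sub>R ?d s) \<in> borel_measurable lborel"
      using I by (auto simp: set_integrable_def)
    show "integrable lborel (\<lambda>s. norm (indicator {0<..<t} s *\<^sub>R ?d s))"
      by (rule integrable_norm) (use I in \<open>simp add: set_integrable_def\<close>)
    show "(\<lambda>s. indicator (A n) s *\<^sub>R ?d s) \<in> borel_measurable lborel" for n
    proof -
      have e: "indicator (A n) s *\<^sub>R ?d s = indicat_real (A n) s *\<^sub>R (indicator {0<..<t} s *\<^sub>R ?d s)" for s
        using tp(1)[of n] by (auto simp: A_def indicator_def)
      moreover have "(\<lambda>s. indicat_real (A n) s *\<^sub>R (indicator {0<..<t} s *\<^sub>R ?d s)) \<in> borel_measurable lborel"
        by (rule borel_measurable_scaleR[OF _ m]) (auto simp: A_def)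
      ultimately show ?thesis unfolding e by blast
    qed
    show "AE s in lborel. (\<lambda>n. indicator (A n) s *\<^sub>R ?d s) \<longlonglongrightarrow> indicator {0<..<t} s *\<^sub>R ?d s"
    proof (rule AE_I2)
      fix s
      show "(\<lambda>n. indicator (A n) s *\<^sub>R ?d s) \<longlonglongrightarrow> indicator {0<..<t} s *\<^sub>R ?d s"
      proof (cases "0 < s \<and> s < t")
        case True
        have "(\<lambda>n. t / (real n + 2)) \<longlonglongrightarrow> 0" by real_asymp
        then have "eventually (\<lambda>n. t / (real n + 2) < s) sequentially"
          using True by (intro order_tendstoD) auto
        then have "eventually (\<lambda>n. indicator (A n) s *\<^sub>R ?d s = indicator {0<..<t} s *\<^sub>R ?d s) sequentially"
          by eventually_elim (use True in \<open>auto simp: A_def\<close>)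
        then show ?thesis by (rule tendsto_eventually)
      next
        case False
        have e: "indicator (A n) s *\<^sub>R ?d s = indicator {0<..<t} s *\<^sub>R ?d s" for n
          using False tp(1)[of n] by (auto simp: A_def indicator_def)
        show ?thesis unfolding e by (rule tendsto_const)
      qed
    qed
    show "AE s in lborel. norm (indicator (A n) s *\<^sub>R ?d s) \<le> norm (indicator {0<..<t} s *\<^sub>R ?d s)" for n
      using tp(1)[of n] by (intro AE_I2) (auto simp: A_def indicator_def)
  qed
  moreover have "(LINT s|lborel. indicator (A n) s *\<^sub>R ?d s) = p t - p (t / (real n + 2))" for n
  proof -
    let ?a = "t / (real n + 2)"
    have SI: "set_integrable lborel {?a<..<t} ?d"
      by (rule set_integrable_subset[OF I]) (use tp[of n] in auto)
    have "(?d has_integral (p t - p ?a)) {?a..t}"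
    proof (rule fundamental_theorem_of_calculus)
      show "?a \<le> t" using tp[of n] by simp
      fix x assume "x \<in> {?a..t}"
      then have "p differentiable (at x)" using tp[of n] d by auto
      then show "(p has_vector_derivative ?d x) (at x within {?a..t})"
        by (simp add: vector_derivative_works has_vector_derivative_at_within)
    qed
    then have "(?d has_integral (p t - p ?a)) {?a<..<t}"
      by (simp add: has_integral_Icc_iff_Ioo)
    then show ?thesis using set_borel_integral_eq_integral(2)[OF SI]
      by (simp add: set_lebesgue_integral_def A_def integral_unique)
  qed
  moreover have "(\<lambda>n. p t - p (t / (real n + 2))) \<longlonglongrightarrow> p t - c"
  proof -
    have "filterlim (\<lambda>n. t / (real n + 2)) (at_right 0) sequentially"
      using t by real_asymp
    then have "(\<lambda>n. p (t / (real n + 2))) \<longlonglongrightarrow> c" by (rule filterlim_compose[OF p0])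
    then show ?thesis by (intro tendsto_intros)
  qed
  ultimately show ?thesis unfolding set_lebesgue_integral_def by (auto intro: LIMSEQ_unique)
qed

text \<open>Fractional integration of order \<open>2 * b\<close> undoes both Caputo derivatives by the semigroup law.
  The order of the first term becomes 1, that of the second \<open>b + 1\<close>, and one integration in each
  is used up by the fundamental theorem of calculus.\<close>

lemma caputo_equation_imp_volterra:
  fixes p q :: "real \<Rightarrow> complex" and k :: real
  assumes b: "0 < b" "b < 1/2"
    and d: "\<And>t. 0 < t \<Longrightarrow> caputo_differentiable (2 * b) p t"
    and eq: "\<And>t. 0 < t \<Longrightarrow> caputo (2 * b) p t + 2 * of_real k * caputo b p t = q t"
    and p0: "(p \<longlongrightarrow> c) (at_right 0)"
    and t: "0 < t"
  shows "set_integrable lborel {0<..<t} (\<lambda>s. (t - s) powr (2 * b - 1) *\<^sub>R q s)"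
    and "p t - c + 2 * of_real k * frac_integral b (\<lambda>s. p s - c) t = frac_integral (2 * b) q t"
proof -
  let ?d = "\<lambda>s. vector_derivative p (at s)"
  have I: "set_integrable lborel {0<..<s} ?d" if "0 < s" for s
    by (rule caputo_differentiable_integrable_deriv[OF _ that d[OF that]]) (use b in auto)
  have df: "p differentiable (at s)" if "0 < s" for s
    using d[of "s + 1"] that by (auto simp: caputo_differentiable_def)
  have J: "frac_integral 1 ?d s = p s - c" if "0 < s" for s
    unfolding frac_integral_one
    by (rule integral_deriv_from_0) (use that df I p0 in auto)
  have q: "q s = frac_integral (1 - 2 * b) ?d s + 2 * of_real k * frac_integral (1 - b) ?d s" if "0 < s" for s
    using eq[OF that] by (simp add: caputo_eq_frac_integral)
  have i1: "set_integrable lborel {0<..<t} (\<lambda>s. (t - s) powr (2 * b - 1) *\<^sub>R frac_integral (1 - 2 * b) ?d s)"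
    by (rule set_integrable_frac_integral) (use b I t in auto)
  have i2: "set_integrable lborel {0<..<t} (\<lambda>s. (t - s) powr (2 * b - 1) *\<^sub>R frac_integral (1 - b) ?d s)"
    by (rule set_integrable_frac_integral) (use b I t in auto)
  have i3: "set_integrable lborel {0<..<t} (\<lambda>s. 2 * of_real k * ((t - s) powr (2 * b - 1) *\<^sub>R frac_integral (1 - b) ?d s))"
    by (rule set_integrable_mult_right) (rule i2)
  have e: "(t - s) powr (2 * b - 1) *\<^sub>R q s = (t - s) powr (2 * b - 1) *\<^sub>R frac_integral (1 - 2 * b) ?d s
      + 2 * of_real k * ((t - s) powr (2 * b - 1) *\<^sub>R frac_integral (1 - b) ?d s)" if "s \<in> {0<..<t}" for s
    using that q[of s] by (simp add: algebra_simps)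
  show "set_integrable lborel {0<..<t} (\<lambda>s. (t - s) powr (2 * b - 1) *\<^sub>R q s)"
    by (subst set_integrable_cong[OF refl refl e]) (assumption, rule set_integral_add(1)[OF i1 i3])
  have "(LBINT s:{0<..<t}. (t - s) powr (2 * b - 1) *\<^sub>R q s) =
    (LBINT s:{0<..<t}. (t - s) powr (2 * b - 1) *\<^sub>R frac_integral (1 - 2 * b) ?d s
      + 2 * of_real k * ((t - s) powr (2 * b - 1) *\<^sub>R frac_integral (1 - b) ?d s))"
    by (rule set_lebesgue_integral_cong) (use e in auto)
  also have "\<dots> = (LBINT s:{0<..<t}. (t - s) powr (2 * b - 1) *\<^sub>R frac_integral (1 - 2 * b) ?d s)
    + 2 * of_real k * (LBINT s:{0<..<t}. (t - s) powr (2 * b - 1) *\<^sub>R frac_integral (1 - b) ?d s)"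
    by (subst set_integral_add(2)[OF i1 i3]) (simp only: set_integral_mult_right)
  finally have "frac_integral (2 * b) q t = frac_integral (2 * b) (frac_integral (1 - 2 * b) ?d) t +
    2 * of_real k * frac_integral (2 * b) (frac_integral (1 - b) ?d) t"
    by (simp add: frac_integral_def[of "2 * b"] scaleR_add_right)
  also have "frac_integral (2 * b) (frac_integral (1 - 2 * b) ?d) t = frac_integral (2 * b + (1 - 2 * b)) ?d t"
    by (rule frac_integral_frac_integral) (use b I t in auto)
  also have "frac_integral (2 * b) (frac_integral (1 - b) ?d) t = frac_integral (2 * b + (1 - b)) ?d t"
    by (rule frac_integral_frac_integral) (use b I t in auto)
  also have "2 * b + (1 - b) = b + 1" by simp
  also have "frac_integral (b + 1) ?d t = frac_integral b (frac_integral 1 ?d) t"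
    by (rule frac_integral_frac_integral[symmetric]) (use b I t in auto)
  also have "\<dots> = frac_integral b (\<lambda>s. p s - c) t"
    by (rule frac_integral_cong) (use J in auto)
  finally show "p t - c + 2 * of_real k * frac_integral b (\<lambda>s. p s - c) t = frac_integral (2 * b) q t"
    using J[OF t] by simp
qed

section \<open>Linear Volterra equations\<close>

text \<open>Over the half-line \<open>s < t\<close> this would be a Gamma integral. The factor \<open>M powr (- a)\<close> makes
  fractional integration a contraction with respect to the weight \<open>exp (M * s)\<close> once \<open>M\<close> is
  large.\<close>

lemma exp_kernel_integral_le:
  fixes a M t :: real
  assumes a: "0 < a" and M: "0 < M"
  shows "(LBINT s:{0<..<t}. (t - s) powr (a - 1) * exp (M * s)) \<le> Gamma a * M powr (- a) * exp (M * t)"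
    and "set_integrable lborel {0<..<t} (\<lambda>s. (t - s) powr (a - 1) * exp (M * s))"
proof -
  let ?h = "\<lambda>s. indicator {..<t} s * ((t - s) powr (a - 1) * exp (M * s))"
  have e: "exp (M * t) * (indicator {0<..} x * (exp (- (M * x)) * x powr (a - 1))) = ?h (t + (- 1) * x)" for x
    by (auto simp: indicator_def right_diff_distrib exp_diff exp_minus field_simps)
  have "has_bochner_integral lborel (\<lambda>x. exp (M * t) * (indicator {0<..} x * (exp (- (M * x)) * x powr (a - 1))))
      (exp (M * t) * (Gamma a * M powr (- a)))"
    by (rule has_bochner_integral_mult_right[OF has_bochner_integral_powr_exp[OF a M]])
  then have "has_bochner_integral lborel (\<lambda>x. ?h (t + (- 1) * x)) ((Gamma a * M powr (- a) * exp (M * t)) /\<^sub>R \<bar>- 1\<bar>)"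
    unfolding e by (simp add: mult_ac)
  then have H: "has_bochner_integral lborel ?h (Gamma a * M powr (- a) * exp (M * t))"
    by (subst lborel_has_bochner_integral_real_affine_iff[where c = "- 1" and t = t]) simp_all
  show S: "set_integrable lborel {0<..<t} (\<lambda>s. (t - s) powr (a - 1) * exp (M * s))"
    unfolding set_integrable_def
    by (rule Bochner_Integration.integrable_bound[of _ ?h]) (use H in \<open>auto simp: has_bochner_integral_iff indicator_def\<close>)
  have "(LBINT s:{0<..<t}. (t - s) powr (a - 1) * exp (M * s)) \<le> (LINT s|lborel. ?h s)"
    unfolding set_lebesgue_integral_def
    by (rule integral_mono) (use H S in \<open>auto simp: has_bochner_integral_iff indicator_def set_integrable_def\<close>)
  then show "(LBINT s:{0<..<t}. (t - s) powr (a - 1) * exp (M * s)) \<le> Gamma a * M powr (- a) * exp (M * t)"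
    using H by (simp add: has_bochner_integral_iff)
qed

lemma norm_frac_integral_exp_bound:
  fixes d :: "real \<Rightarrow> complex"
  assumes a: "0 < a" and M: "0 < M" and C: "0 \<le> C" and d: "\<And>s. 0 < s \<Longrightarrow> s < t \<Longrightarrow> norm (d s) \<le> C * exp (M * s)"
  shows "norm (frac_integral a d t) \<le> C * M powr (- a) * exp (M * t)"
proof -
  have S: "integrable lborel (\<lambda>s. C * (indicator {0<..<t} s *\<^sub>R ((t - s) powr (a - 1) * exp (M * s))))"
    using exp_kernel_integral_le(2)[OF a M, of t] by (simp add: set_integrable_def)
  have "norm (LBINT s:{0<..<t}. (t - s) powr (a - 1) *\<^sub>R d s) \<le>
      (LINT s|lborel. C * (indicator {0<..<t} s *\<^sub>R ((t - s) powr (a - 1) * exp (M * s))))"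
  \<comment> \<open>The integral of a function that is not integrable is 0, so only the integrable case has
    content.\<close>
  proof (cases "set_integrable lborel {0<..<t} (\<lambda>s. (t - s) powr (a - 1) *\<^sub>R d s)")
    case True
    have "norm (LBINT s:{0<..<t}. (t - s) powr (a - 1) *\<^sub>R d s) \<le>
       (LINT s|lborel. norm (indicator {0<..<t} s *\<^sub>R ((t - s) powr (a - 1) *\<^sub>R d s)))"
      unfolding set_lebesgue_integral_def by (rule integral_norm_bound)
    also have "\<dots> \<le> (LINT s|lborel. C * (indicator {0<..<t} s *\<^sub>R ((t - s) powr (a - 1) * exp (M * s))))"
    proof (rule integral_mono)
      show "integrable lborel (\<lambda>s. norm (indicator {0<..<t} s *\<^sub>R ((t - s) powr (a - 1) *\<^sub>R d s)))"
        by (rule integrable_norm) (use True in \<open>simp only: set_integrable_def\<close>)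
      fix s
      have "(t - s) powr (a - 1) * norm (d s) \<le> (t - s) powr (a - 1) * (C * exp (M * s))" if "0 < s" "s < t"
        by (rule mult_left_mono[OF d[OF that]]) simp
      then show "norm (indicator {0<..<t} s *\<^sub>R ((t - s) powr (a - 1) *\<^sub>R d s))
         \<le> C * (indicator {0<..<t} s *\<^sub>R ((t - s) powr (a - 1) * exp (M * s)))"
        by (auto simp: indicator_def mult_ac)
    qed (rule S)
    finally show ?thesis .
  next
    case False
    have "0 \<le> (LINT s|lborel. C * (indicator {0<..<t} s *\<^sub>R ((t - s) powr (a - 1) * exp (M * s))))"
      by (rule Bochner_Integration.integral_nonneg) (use C in auto)
    then show ?thesis using False
      by (simp add: set_integrable_def set_lebesgue_integral_def not_integrable_integral_eq)
  qed
  also have "\<dots> = C * (LBINT s:{0<..<t}. (t - s) powr (a - 1) * exp (M * s))"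
    by (simp add: set_lebesgue_integral_def)
  also have "\<dots> \<le> C * (Gamma a * M powr (- a) * exp (M * t))"
    by (rule mult_left_mono[OF exp_kernel_integral_le(1)[OF a M] C])
  finally have h: "norm (LBINT s:{0<..<t}. (t - s) powr (a - 1) *\<^sub>R d s) \<le> Gamma a * (C * M powr (- a) * exp (M * t))"
    by (simp add: mult_ac)
  have "Gamma a > 0" using a by (rule Gamma_real_pos)
  then show ?thesis using h by (simp add: frac_integral_def field_simps)
qed

text \<open>In the supremum norm weighted by \<open>exp (- M * s)\<close> the two fractional integrals have norms at
  most \<open>M powr (- b)\<close> and \<open>M powr (- (2 * b))\<close>. For large \<open>M\<close> the equation thus bounds \<open>d\<close> by one
  half of any bound that it has, and iteration gives 0.\<close>

lemma volterra_unique_zero: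
  fixes d :: "real \<Rightarrow> complex" and k th b :: real
  assumes b: "0 < b"
    and bd: "\<And>s. 0 < s \<Longrightarrow> s \<le> T \<Longrightarrow> norm (d s) \<le> C"
    and eq: "\<And>s. 0 < s \<Longrightarrow> s \<le> T \<Longrightarrow>
       d s + 2 * of_real k * frac_integral b d s + of_real th * frac_integral (2 * b) d s = 0"
    and t: "0 < t" "t \<le> T"
  shows "d t = 0"
proof -
  have C: "0 \<le> C" using bd[OF t] norm_ge_zero order_trans by blast
  have "((\<lambda>M. 2 * \<bar>k\<bar> * M powr (- b) + \<bar>th\<bar> * M powr (- (2 * b))) \<longlongrightarrow> 0) at_top"
    using b by real_asymp
  then have "eventually (\<lambda>M. 2 * \<bar>k\<bar> * M powr (- b) + \<bar>th\<bar> * M powr (- (2 * b)) < 1/2) at_top"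
    by (rule order_tendstoD) simp
  then have "eventually (\<lambda>M. 0 < M \<and> 2 * \<bar>k\<bar> * M powr (- b) + \<bar>th\<bar> * M powr (- (2 * b)) < 1/2) at_top"
    using eventually_gt_at_top[of 0] by eventually_elim auto
  then obtain M where M: "0 < M" "2 * \<bar>k\<bar> * M powr (- b) + \<bar>th\<bar> * M powr (- (2 * b)) < 1/2"
    by (metis (no_types, lifting) eventually_at_top_linorder order_refl)
  have *: "norm (d s) \<le> C * (1/2)^n * exp (M * s)" if "0 < s" "s \<le> T" for s n
    using that
  proof (induction n arbitrary: s)
    case 0
    have "1 \<le> exp (M * s)" using M 0 by simp
    then have "C * 1 \<le> C * exp (M * s)" by (rule mult_left_mono[OF _ C])
    then show ?case using bd[OF 0] by simp
  next
    case (Suc n)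
    let ?K = "C * (1/2)^n"
    have K: "0 \<le> ?K" using C by simp
    have "d s = - (2 * of_real k * frac_integral b d s + of_real th * frac_integral (2 * b) d s)"
      using eq[OF Suc.prems] by (simp add: add_eq_0_iff2 add.assoc)
    then have "norm (d s) \<le> norm (2 * of_real k * frac_integral b d s) + norm (of_real th * frac_integral (2 * b) d s)"
      by (metis norm_minus_cancel norm_triangle_ineq)
    also have "\<dots> = 2 * \<bar>k\<bar> * norm (frac_integral b d s) + \<bar>th\<bar> * norm (frac_integral (2 * b) d s)"
      by (simp add: norm_mult)
    also have "\<dots> \<le> 2 * \<bar>k\<bar> * (?K * M powr (- b) * exp (M * s)) + \<bar>th\<bar> * (?K * M powr (- (2 * b)) * exp (M * s))"
      by (intro add_mono mult_left_mono norm_frac_integral_exp_bound) (use b M K Suc in auto)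
    also have "\<dots> = (2 * \<bar>k\<bar> * M powr (- b) + \<bar>th\<bar> * M powr (- (2 * b))) * (?K * exp (M * s))"
      by (simp add: algebra_simps)
    also have "\<dots> \<le> (1/2) * (?K * exp (M * s))"
      by (rule mult_right_mono) (use M K in auto)
    finally show ?case by simp
  qed
  have "(\<lambda>n. C * (1/2)^n * exp (M * t)) \<longlonglongrightarrow> C * 0 * exp (M * t)"
    by (intro tendsto_intros) auto
  then have "norm (d t) \<le> C * 0 * exp (M * t)"
    by (rule LIMSEQ_le_const) (use *[OF t] in auto)
  then show ?thesis by simp
qed

section \<open>Fractional power series\<close>

text \<open>Only the part of Euler's integral beyond \<open>x\<close> is kept, where the power is at least
  \<open>x powr a\<close>. This is the growth of the Gamma function at real arguments that the convergence of
  the series below rests on.\<close>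

lemma powr_le_Gamma_exp:
  fixes a x :: real
  assumes a: "0 \<le> a" and x: "0 < x"
  shows "x powr a \<le> Gamma (a + 1) * exp x"
proof -
  have "(\<integral>\<^sup>+u. ennreal (exp (- u)) * indicator {x..} u \<partial>lborel) = ennreal (0 - (- exp (- x)))"
  proof (rule nn_integral_FTC_atLeast)
    show "((\<lambda>u. - exp (- u)) \<longlongrightarrow> 0) (at_top :: real filter)" by real_asymp
  qed (auto intro!: derivative_eq_intros)
  then have "ennreal (x powr a * exp (- x)) = ennreal (x powr a) * (\<integral>\<^sup>+u. ennreal (exp (- u)) * indicator {x..} u \<partial>lborel)"
    by (simp add: ennreal_mult)
  also have "\<dots> = (\<integral>\<^sup>+u. ennreal (x powr a) * (ennreal (exp (- u)) * indicator {x..} u) \<partial>lborel)"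
    by (subst nn_integral_cmult) auto
  also have "\<dots> \<le> (\<integral>\<^sup>+u. ennreal (indicator {0..} u * u powr (a + 1 - 1) / exp u) \<partial>lborel)"
  proof (rule nn_integral_mono)
    fix u
    have "x powr a * exp (- u) \<le> u powr a / exp u" if "x \<le> u"
      using powr_mono2[of a x u] a x that by (simp add: exp_minus field_simps)
    then show "ennreal (x powr a) * (ennreal (exp (- u)) * indicator {x..} u) \<le>
        ennreal (indicator {0..} u * u powr (a + 1 - 1) / exp u)"
      using x by (auto simp: indicator_def ennreal_mult[symmetric] intro!: ennreal_leI)
  qed
  also have "\<dots> = ennreal (Gamma (a + 1))"
    by (rule Gamma_conv_nn_integral_real[symmetric]) (use a in auto)
  finally have "x powr a * exp (- x) \<le> Gamma (a + 1)"
    using a by (subst (asm) ennreal_le_iff) (auto intro: Gamma_real_nonneg)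
  then show ?thesis by (simp add: exp_minus field_simps)
qed

text \<open>The lower bound for the Gamma function is used at the point \<open>x = (4 * z) powr (1 / b)\<close>,
  where \<open>x powr (b * n)\<close> is \<open>4 ^ n * z ^ n\<close>. The factor \<open>b * n + m\<close> that it leaves costs at most
  \<open>2 ^ n\<close>, and a geometric series of ratio \<open>2 / 4\<close> remains.\<close>

lemma summable_power_Gamma:
  fixes b m z :: real
  assumes b: "0 < b" and m: "0 < m" and z: "0 \<le> z"
  shows "summable (\<lambda>n. z ^ n / Gamma (b * real n + m))"
proof (cases "z = 0")
  case True
  show ?thesis unfolding True
    by (rule summable_finite[of "{0}"]) auto
next
  case False
  define x where "x = (4 * z) powr (1 / b)"
  have x: "0 < x" using False z by (simp add: x_def)
  define D where "D = (b + m) * exp x * x powr (- m)"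
  show ?thesis
  proof (rule summable_comparison_test')
    show "summable (\<lambda>n. D * (1 / 2) ^ n)" by (intro summable_mult summable_geometric) auto
    fix n :: nat
    let ?a = "b * real n + m"
    have a: "0 < ?a" using b m by (simp add: add_nonneg_pos)
    have "x powr (b * real n) = (4 * z) ^ n"
      using b False z by (simp add: x_def powr_powr powr_realpow)
    then have "(4 * z) ^ n = x powr ?a * x powr (- m)"
      using x by (simp add: powr_add[symmetric])
    also have "\<dots> \<le> (Gamma (?a + 1) * exp x) * x powr (- m)"
      by (rule mult_right_mono[OF powr_le_Gamma_exp]) (use a x in auto)
    also have "Gamma (?a + 1) = ?a * Gamma ?a" using a by (subst Gamma_plus1) auto
    finally have 1: "(4 * z) ^ n \<le> ?a * (exp x * x powr (- m) * Gamma ?a)" by (simp add: mult_ac)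
    have "real n \<le> 2 ^ n" using of_nat_less_two_power[of n, where ?'a = real] by simp
    then have "b * real n \<le> b * 2 ^ n" using b by simp
    moreover have "m * 1 \<le> m * 2 ^ n" by (rule mult_left_mono) (use m in auto)
    ultimately have 2: "?a \<le> (b + m) * 2 ^ n" by (simp add: algebra_simps)
    have G: "0 < Gamma ?a" using a by (rule Gamma_real_pos)
    have "(4 * z) ^ n \<le> ((b + m) * 2 ^ n) * (exp x * x powr (- m) * Gamma ?a)"
      by (rule order_trans[OF 1 mult_right_mono[OF 2]]) (use G in auto)
    then have "4 ^ n * z ^ n \<le> (2 ^ n * D) * Gamma ?a"
      by (simp add: D_def mult_ac power_mult_distrib)
    then have "(4 ^ n * z ^ n) / 4 ^ n \<le> ((2 ^ n * D) * Gamma ?a) / 4 ^ n"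
      by (rule divide_right_mono) simp
    moreover have "(2::real) ^ n / 4 ^ n = (1 / 2) ^ n"
      by (simp add: power_divide[symmetric])
    ultimately have "z ^ n \<le> (1 / 2) ^ n * D * Gamma ?a" by (simp add: field_simps)
    then show "norm (z ^ n / Gamma ?a) \<le> D * (1 / 2) ^ n"
      using G z by (simp add: field_simps)
  qed
qed

lemma powr_mult_of_nat: "0 < t \<Longrightarrow> t powr (b * real n) = (t powr b) ^ n"
  by (simp add: powr_powr[symmetric] powr_realpow)

lemma powr_series_exponent:
  assumes "0 < t"
  shows "t powr (b * real n + m - 1) = (t powr b) ^ n * t powr (m - 1)"
proof -
  have "t powr (b * real n + m - 1) = t powr (b * real n) * t powr (m - 1)"
    by (simp add: powr_add[symmetric] algebra_simps)
  then show ?thesis by (simp add: powr_mult_of_nat[OF assms])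
qed

text \<open>The function \<open>t powr (e - 1) / Gamma e\<close> is the kernel of the fractional integral of order
  \<open>e\<close>. In this normalisation fractional integration leaves the coefficients alone and raises the
  exponent \<open>m\<close> by its order.\<close>

definition frac_series :: "real \<Rightarrow> (nat \<Rightarrow> real) \<Rightarrow> real \<Rightarrow> real \<Rightarrow> real" where
  "frac_series b d m t = (\<Sum>n. d n * t powr (b * real n + m - 1) / Gamma (b * real n + m))"

definition geom_bounded :: "(nat \<Rightarrow> real) \<Rightarrow> bool" where
  "geom_bounded d \<longleftrightarrow> (\<exists>C R. 0 \<le> R \<and> (\<forall>n. \<bar>d n\<bar> \<le> C * R ^ n))"

lemma summable_frac_series:
  assumes b: "0 < b" and m: "0 < m" and t: "0 < t" and d: "geom_bounded d"
  shows "summable (\<lambda>n. norm (d n * t powr (b * real n + m - 1) / Gamma (b * real n + m)))"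
proof -
  obtain C R where R: "0 \<le> R" "\<And>n. \<bar>d n\<bar> \<le> C * R ^ n" using d by (auto simp: geom_bounded_def)
  show ?thesis
  proof (rule summable_comparison_test')
    show "summable (\<lambda>n. (C * t powr (m - 1)) * ((R * t powr b) ^ n / Gamma (b * real n + m)))"
      by (intro summable_mult summable_power_Gamma) (use b m R in auto)
    fix n :: nat
    have G: "0 < Gamma (b * real n + m)" using b m by (intro Gamma_real_pos) (simp add: add_nonneg_pos)
    have "t powr (b * real n + m - 1) = (t powr b) ^ n * t powr (m - 1)"
      by (rule powr_series_exponent[OF t])
    then have "norm (d n * t powr (b * real n + m - 1) / Gamma (b * real n + m)) =
        \<bar>d n\<bar> * ((t powr b) ^ n * t powr (m - 1) / Gamma (b * real n + m))"
      using G by (simp add: abs_mult)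
    also have "\<dots> \<le> (C * R ^ n) * ((t powr b) ^ n * t powr (m - 1) / Gamma (b * real n + m))"
      by (rule mult_right_mono[OF R(2)]) (use G in auto)
    also have "\<dots> = (C * t powr (m - 1)) * ((R * t powr b) ^ n / Gamma (b * real n + m))"
      by (simp add: power_mult_distrib)
    finally show "norm (norm (d n * t powr (b * real n + m - 1) / Gamma (b * real n + m))) \<le>
       (C * t powr (m - 1)) * ((R * t powr b) ^ n / Gamma (b * real n + m))" by simp
  qed
qed

lemma frac_series_sums:
  assumes "0 < b" "0 < m" "0 < t" "geom_bounded d"
  shows "(\<lambda>n. d n * t powr (b * real n + m - 1) / Gamma (b * real n + m)) sums frac_series b d m t"
  unfolding frac_series_def
  by (rule summable_sums[OF summable_norm_cancel[OF summable_frac_series[OF assms]]])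

lemma frac_series_shift:
  assumes "0 < b" "0 < m" "0 < t" "geom_bounded d" and d: "d 0 = 0"
  shows "frac_series b (\<lambda>n. d (Suc n)) (m + b) t = frac_series b d m t"
proof -
  note s = frac_series_sums[OF assms(1-4)]
  from s have "(\<lambda>n. d (Suc n) * t powr (b * real (Suc n) + m - 1) / Gamma (b * real (Suc n) + m)) sums frac_series b d m t"
    using sums_Suc_iff[of "\<lambda>n. d n * t powr (b * real n + m - 1) / Gamma (b * real n + m)" "frac_series b d m t"] d
    by simp
  then have "frac_series b d m t = (\<Sum>n. d (Suc n) * t powr (b * real (Suc n) + m - 1) / Gamma (b * real (Suc n) + m))"
    by (rule sums_unique)
  then show ?thesis by (simp add: frac_series_def algebra_simps)
qed

text \<open>Every term is a Beta integral. The integrals of the absolute values form a series of the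
  same kind, hence a convergent one, so integration and summation may be exchanged.\<close>

lemma frac_integral_series:
  assumes b: "0 < b" and m: "0 < m" and t: "0 < t" and a: "0 < a" and d: "geom_bounded d"
  shows frac_integral_series_integrable:
    "set_integrable lborel {0<..<t} (\<lambda>s. (t - s) powr (a - 1) * frac_series b d m s)"
  and frac_integral_series_eq:
    "(LBINT s:{0<..<t}. (t - s) powr (a - 1) * frac_series b d m s) = Gamma a * frac_series b d (m + a) t"
proof -
  let ?e = "\<lambda>n. b * real n + m"
  have e: "0 < ?e n" for n using b m by (simp add: add_nonneg_pos)
  have Ga: "0 < Gamma a" using a by (rule Gamma_real_pos)
  have G: "0 < Gamma (?e n)" "0 < Gamma (?e n + a)" for n
    using e[of n] a by (auto intro!: Gamma_real_pos)
  define F where "F = (\<lambda>n s. indicator {0<..<t} s *\<^sub>R ((t - s) powr (a - 1) * (d n * s powr (?e n - 1) / Gamma (?e n))))"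
  have F: "F n s = (d n / Gamma (?e n)) * (indicator {0<..<t} s *\<^sub>R ((t - s) powr (a - 1) * s powr (?e n - 1)))" for n s
    by (simp add: F_def)
  have nF: "norm (F n s) = (\<bar>d n\<bar> / Gamma (?e n)) * (indicator {0<..<t} s *\<^sub>R ((t - s) powr (a - 1) * s powr (?e n - 1)))" for n s
    using G(1)[of n] by (simp add: F_def abs_mult)
  have Bint: "(LINT s|lborel. indicator {0<..<t} s *\<^sub>R ((t - s) powr (a - 1) * s powr (?e n - 1))) = Beta a (?e n) * t powr (a + ?e n - 1)" for n
    using frac_integral_power(2)[OF a e[of n] t] by (simp only: set_lebesgue_integral_def)
  have iF: "integrable lborel (F n)" for n
    unfolding F using frac_integral_power(1)[OF a e[of n] t] unfolding set_integrable_def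
    by (rule integrable_mult_right)
  have Fint: "(LINT s|lborel. F n s) = Gamma a * (d n * t powr (b * real n + (m + a) - 1) / Gamma (b * real n + (m + a)))" for n
    unfolding F integral_mult_right_zero Bint using G[of n] Ga by (simp add: Beta_def add_ac)
  have nFint: "(LINT s|lborel. norm (F n s)) = Gamma a * norm (d n * t powr (b * real n + (m + a) - 1) / Gamma (b * real n + (m + a)))" for n
    unfolding nF integral_mult_right_zero Bint using G[of n] Ga by (simp add: Beta_def add_ac abs_mult)
  have ma: "0 < m + a" using m a by simp
  have S1: "AE s in lborel. summable (\<lambda>n. norm (F n s))"
  proof (rule AE_I2)
    fix s
    show "summable (\<lambda>n. norm (F n s))"
    proof (cases "0 < s \<and> s < t")
      case True
      have "norm (F n s) = (t - s) powr (a - 1) * norm (d n * s powr (?e n - 1) / Gamma (?e n))" for n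
        using True by (simp add: F_def abs_mult)
      then show ?thesis using summable_mult[OF summable_frac_series[OF b m _ d, of s]] True by simp
    qed (auto simp: F_def)
  qed
  have S2: "summable (\<lambda>n. LINT s|lborel. norm (F n s))"
    unfolding nFint by (intro summable_mult summable_frac_series[OF b ma t d])
  have sF: "(\<Sum>n. F n s) = indicator {0<..<t} s *\<^sub>R ((t - s) powr (a - 1) * frac_series b d m s)" for s
  proof (cases "0 < s \<and> s < t")
    case True
    then have "(\<lambda>n. (t - s) powr (a - 1) * (d n * s powr (?e n - 1) / Gamma (?e n))) sums
       ((t - s) powr (a - 1) * frac_series b d m s)"
      by (intro sums_mult frac_series_sums b m d) auto
    then show ?thesis using True by (simp add: F_def sums_iff)
  qed (auto simp: F_def)
  show "set_integrable lborel {0<..<t} (\<lambda>s. (t - s) powr (a - 1) * frac_series b d m s)"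
    using integrable_suminf[OF iF S1 S2] unfolding sF set_integrable_def .
  have "(LINT s|lborel. (\<Sum>n. F n s)) = (\<Sum>n. LINT s|lborel. F n s)"
    by (rule integral_suminf[OF iF S1 S2])
  also have "\<dots> = Gamma a * frac_series b d (m + a) t"
    unfolding Fint frac_series_def
    by (rule suminf_mult) (rule sums_summable[OF frac_series_sums[OF b ma t d]])
  finally show "(LBINT s:{0<..<t}. (t - s) powr (a - 1) * frac_series b d m s) = Gamma a * frac_series b d (m + a) t"
    unfolding sF set_lebesgue_integral_def .
qed

lemma frac_integral_of_real_series:
  assumes b: "0 < b" and m: "0 < m" and t: "0 < t" and a: "0 < a" and d: "geom_bounded d"
  shows "frac_integral a (\<lambda>s. of_real (frac_series b d m s)) t = of_real (frac_series b d (m + a) t)"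
proof -
  have e: "indicator {0<..<t} s *\<^sub>R ((t - s) powr (a - 1) *\<^sub>R complex_of_real (frac_series b d m s)) =
    complex_of_real (indicator {0<..<t} s *\<^sub>R ((t - s) powr (a - 1) * frac_series b d m s))" for s
    by (simp add: scaleR_conv_of_real)
  have "(LBINT s:{0<..<t}. (t - s) powr (a - 1) *\<^sub>R complex_of_real (frac_series b d m s)) =
      of_real (LBINT s:{0<..<t}. (t - s) powr (a - 1) * frac_series b d m s)"
    unfolding set_lebesgue_integral_def e by (rule integral_complex_of_real)
  moreover have "0 < Gamma a" using a by (rule Gamma_real_pos)
  ultimately show ?thesis
    by (simp add: frac_integral_def frac_integral_series_eq[OF assms] scaleR_conv_of_real)
qed

lemma summable_entire:
  fixes z :: real
  assumes b: "0 < b" and m: "0 < m" and d: "geom_bounded d"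
  shows "summable (\<lambda>n. (d n / Gamma (b * real n + m)) * z ^ n)"
proof -
  obtain C R where R: "0 \<le> R" "\<And>n. \<bar>d n\<bar> \<le> C * R ^ n" using d by (auto simp: geom_bounded_def)
  show ?thesis
  proof (rule summable_comparison_test')
    show "summable (\<lambda>n. C * ((R * \<bar>z\<bar>) ^ n / Gamma (b * real n + m)))"
      by (intro summable_mult summable_power_Gamma) (use b m R in auto)
    fix n :: nat
    have G: "0 < Gamma (b * real n + m)" using b m by (intro Gamma_real_pos) (simp add: add_nonneg_pos)
    have "\<bar>d n\<bar> * (\<bar>z\<bar> ^ n / Gamma (b * real n + m)) \<le> (C * R ^ n) * (\<bar>z\<bar> ^ n / Gamma (b * real n + m))"
      by (rule mult_right_mono[OF R(2)]) (use G in auto)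
    then show "norm ((d n / Gamma (b * real n + m)) * z ^ n) \<le> C * ((R * \<bar>z\<bar>) ^ n / Gamma (b * real n + m))"
      using G by (simp add: abs_mult power_mult_distrib power_abs)
  qed
qed

lemma frac_series_power_form:
  assumes t: "0 < t" and b: "0 < b" and m: "0 < m" and d: "geom_bounded d"
  shows "frac_series b d m t = t powr (m - 1) * (\<Sum>n. (d n / Gamma (b * real n + m)) * (t powr b) ^ n)"
proof -
  have e: "d n * t powr (b * real n + m - 1) / Gamma (b * real n + m) =
     t powr (m - 1) * ((d n / Gamma (b * real n + m)) * (t powr b) ^ n)" for n
    by (simp add: powr_series_exponent[OF t])
  show ?thesis unfolding frac_series_def e by (rule suminf_mult[OF summable_entire[OF b m d]])
qed

text \<open>By \<open>frac_series_power_form\<close> the function is a power of \<open>t\<close> times an entire function of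
  \<open>t powr b\<close>. The product rule gives the factor \<open>b * n + m\<close> in the term of index \<open>n\<close>, which
  \<open>Gamma (x + 1) = x * Gamma x\<close> absorbs.\<close>

lemma has_real_derivative_frac_series:
  assumes b: "0 < b" and m: "0 < m" and t: "0 < t" and d: "geom_bounded d"
  shows "((frac_series b d (m + 1)) has_real_derivative frac_series b d m t) (at t)"
proof -
  let ?a = "\<lambda>n. d n / Gamma (b * real n + (m + 1))"
  let ?F = "\<lambda>z. \<Sum>n. ?a n * z ^ n"
  let ?z = "t powr b"
  have m1: "0 < m + 1" using m by simp
  have sm: "summable (\<lambda>n. ?a n * z ^ n)" for z by (rule summable_entire[OF b m1 d])
  have F': "(?F has_field_derivative (\<Sum>n. diffs ?a n * z ^ n)) (at z)" for z
    by (rule termdiffs_strong_converges_everywhere) (rule sm)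
  have sd: "summable (\<lambda>n. diffs ?a n * ?z ^ n)"
    by (rule termdiff_converges_all) (rule sm)
  have "(\<lambda>n. of_nat n * ?a n * ?z ^ (n - Suc 0)) sums (\<Sum>n. diffs ?a n * ?z ^ n)"
    by (rule diffs_equiv[OF sd])
  then have "(\<lambda>n. b * (of_nat n * ?a n * ?z ^ (n - Suc 0) * ?z) + m * (?a n * ?z ^ n)) sums
      (b * ((\<Sum>n. diffs ?a n * ?z ^ n) * ?z) + m * ?F ?z)"
    by (intro sums_add sums_mult sums_mult2 summable_sums sm)
  moreover have "b * (of_nat n * ?a n * ?z ^ (n - Suc 0) * ?z) + m * (?a n * ?z ^ n) =
      (d n / Gamma (b * real n + m)) * ?z ^ n" for n
  proof -
    have p: "0 < b * real n + m" using b m by (simp add: add_nonneg_pos)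
    have "Gamma (b * real n + (m + 1)) = (b * real n + m) * Gamma (b * real n + m)"
      using p by (subst add.assoc[symmetric], subst Gamma_plus1) auto
    then have "(b * real n + m) * ?a n = d n / Gamma (b * real n + m)" using p by simp
    moreover have "b * (of_nat n * ?a n * ?z ^ (n - Suc 0) * ?z) + m * (?a n * ?z ^ n) = ((b * real n + m) * ?a n) * ?z ^ n"
      by (cases n) (simp_all add: algebra_simps add_divide_distrib)
    ultimately show ?thesis by simp
  qed
  ultimately have S: "(\<Sum>n. (d n / Gamma (b * real n + m)) * ?z ^ n) = b * ((\<Sum>n. diffs ?a n * ?z ^ n) * ?z) + m * ?F ?z"
    by (simp add: sums_iff)
  have "((\<lambda>t. t powr m * ?F (t powr b)) has_real_derivative
     (m * t powr (m - 1)) * ?F ?z + ((\<Sum>n. diffs ?a n * ?z ^ n) * (b * t powr (b - 1))) * t powr m) (at t)"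
    by (rule DERIV_mult[OF has_real_derivative_powr[OF t] DERIV_chain2[OF F' has_real_derivative_powr[OF t]]])
  also have "(m * t powr (m - 1)) * ?F ?z + ((\<Sum>n. diffs ?a n * ?z ^ n) * (b * t powr (b - 1))) * t powr m =
     frac_series b d m t"
  proof -
    have "t powr (b - 1) * t powr m = t powr (m - 1) * ?z"
      by (simp add: powr_add[symmetric] algebra_simps)
    have gen: "X * (b * u) * v = w * (b * (X * z))" if "u * v = w * z" for X u v w z :: real
    proof -
      have "X * (b * u) * v = b * X * (u * v)" by (simp only: ac_simps)
      also have "\<dots> = w * (b * (X * z))" unfolding that by (simp only: ac_simps)
      finally show ?thesis .
    qed
    have "((\<Sum>n. diffs ?a n * ?z ^ n) * (b * t powr (b - 1))) * t powr m =
      t powr (m - 1) * (b * ((\<Sum>n. diffs ?a n * ?z ^ n) * ?z))"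
      by (rule gen) fact
    then show ?thesis unfolding frac_series_power_form[OF t b m d] S
      by (simp add: algebra_simps)
  qed
  finally show ?thesis
  proof (rule has_field_derivative_transform_within_open[where S = "{0<..}"])
    fix x :: real assume "x \<in> {0<..}"
    then show "x powr m * ?F (x powr b) = frac_series b d (m + 1) x"
      using frac_series_power_form[of x b "m + 1" d] b m d by simp
  qed (use t in auto)
qed

lemma frac_series_tendsto_0:
  assumes b: "0 < b" and m: "1 < m" and d: "geom_bounded d"
  shows "(frac_series b d m \<longlongrightarrow> 0) (at_right 0)"
proof -
  let ?F = "\<lambda>z. \<Sum>n. (d n / Gamma (b * real n + m)) * z ^ n"
  have "isCont ?F 0"
    by (rule isCont_powser_converges_everywhere) (rule summable_entire[OF b _ d], use m in simp)
  moreover have "((\<lambda>t::real. t powr b) \<longlongrightarrow> 0) (at_right 0)" using b by real_asymp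
  ultimately have "((\<lambda>t. ?F (t powr b)) \<longlongrightarrow> ?F 0) (at_right 0)"
    by (rule isCont_tendsto_compose)
  moreover have "((\<lambda>t::real. t powr (m - 1)) \<longlongrightarrow> 0) (at_right 0)" using m by real_asymp
  ultimately have "((\<lambda>t. t powr (m - 1) * ?F (t powr b)) \<longlongrightarrow> 0 * ?F 0) (at_right 0)"
    by (intro tendsto_mult)
  then have "((\<lambda>t. t powr (m - 1) * ?F (t powr b)) \<longlongrightarrow> 0) (at_right 0)" by simp
  moreover have "eventually (\<lambda>t. t powr (m - 1) * ?F (t powr b) = frac_series b d m t) (at_right 0)"
    using eventually_at_right_less[of 0] by eventually_elim (use b m d in \<open>simp add: frac_series_power_form\<close>)
  ultimately show ?thesis by (rule Lim_transform_eventually)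
qed

text \<open>Termwise, the Laplace transform of \<open>t powr (e - 1) / Gamma e\<close> is \<open>p powr (- e)\<close>. The result
  is the generating function of the coefficients at \<open>p powr (- b)\<close>, under the assumption that it
  converges absolutely there.\<close>

lemma frac_series_laplace:
  assumes b: "0 < b" and m: "0 < m" and p: "0 < p" and d: "geom_bounded d"
    and S: "summable (\<lambda>n. \<bar>d n\<bar> * (p powr (- b)) ^ n)"
  shows "integrable lborel (\<lambda>t. indicator {0<..} t * (exp (- (p * t)) * frac_series b d m t))"
    and "(LINT t|lborel. indicator {0<..} t * (exp (- (p * t)) * frac_series b d m t)) =
       p powr (- m) * (\<Sum>n. d n * (p powr (- b)) ^ n)"
proof -
  let ?e = "\<lambda>n. b * real n + m"
  have e: "0 < ?e n" for n using b m by (simp add: add_nonneg_pos)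
  have G: "0 < Gamma (?e n)" for n using e[of n] by (auto intro!: Gamma_real_pos)
  define F where "F = (\<lambda>n t. (d n / Gamma (?e n)) * (indicator {0<..} t * (exp (- (p * t)) * t powr (?e n - 1))))"
  have iF: "integrable lborel (F n)" for n
    unfolding F_def using has_bochner_integral_powr_exp[OF e[of n] p] by (intro integrable_mult_right) (simp add: has_bochner_integral_iff)
  have pe: "p powr (- ?e n) = p powr (- m) * (p powr (- b)) ^ n" for n
  proof -
    have "p powr (- ?e n) = p powr (- m) * p powr (- b * real n)"
      by (simp add: powr_add[symmetric] algebra_simps)
    then show ?thesis by (simp only: powr_mult_of_nat[OF p])
  qed
  have Fint: "(LINT t|lborel. F n t) = p powr (- m) * (d n * (p powr (- b)) ^ n)" for n
    using has_bochner_integral_powr_exp[OF e[of n] p] G[of n] unfolding F_def integral_mult_right_zero pe by (simp add: has_bochner_integral_iff)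
  have nF: "norm (F n t) = (\<bar>d n\<bar> / Gamma (?e n)) * (indicator {0<..} t * (exp (- (p * t)) * t powr (?e n - 1)))" for n t
    using G[of n] by (simp add: F_def abs_mult)
  have nFint: "(LINT t|lborel. norm (F n t)) = p powr (- m) * (\<bar>d n\<bar> * (p powr (- b)) ^ n)" for n
    using has_bochner_integral_powr_exp[OF e[of n] p] G[of n] unfolding nF integral_mult_right_zero pe by (simp add: has_bochner_integral_iff)
  have S1: "AE t in lborel. summable (\<lambda>n. norm (F n t))"
  proof (rule AE_I2)
    fix t
    show "summable (\<lambda>n. norm (F n t))"
    proof (cases "0 < t")
      case True
      have "norm (F n t) = exp (- (p * t)) * norm (d n * t powr (?e n - 1) / Gamma (?e n))" for n
        using True by (simp add: F_def abs_mult)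
      then show ?thesis using summable_mult[OF summable_frac_series[OF b m True d]] by simp
    qed (auto simp: F_def)
  qed
  have S2: "summable (\<lambda>n. LINT t|lborel. norm (F n t))"
    unfolding nFint by (intro summable_mult S)
  have sF: "(\<Sum>n. F n t) = indicator {0<..} t * (exp (- (p * t)) * frac_series b d m t)" for t
  proof (cases "0 < t")
    case True
    then have "(\<lambda>n. exp (- (p * t)) * (d n * t powr (?e n - 1) / Gamma (?e n))) sums
       (exp (- (p * t)) * frac_series b d m t)"
      by (intro sums_mult frac_series_sums b m d) auto
    then show ?thesis using True by (simp add: F_def sums_iff mult_ac)
  qed (auto simp: F_def)
  show "integrable lborel (\<lambda>t. indicator {0<..} t * (exp (- (p * t)) * frac_series b d m t))"
    using integrable_suminf[OF iF S1 S2] unfolding sF .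
  have "(LINT t|lborel. (\<Sum>n. F n t)) = (\<Sum>n. LINT t|lborel. F n t)"
    by (rule integral_suminf[OF iF S1 S2])
  also have "\<dots> = p powr (- m) * (\<Sum>n. d n * (p powr (- b)) ^ n)"
    unfolding Fint by (rule suminf_mult) (rule summable_norm_cancel, use S in \<open>simp add: abs_mult\<close>)
  finally show "(LINT t|lborel. indicator {0<..} t * (exp (- (p * t)) * frac_series b d m t)) =
       p powr (- m) * (\<Sum>n. d n * (p powr (- b)) ^ n)"
    unfolding sF .
qed

section \<open>The relaxation function\<close>

text \<open>Comparison of coefficients when a series in powers of \<open>t powr b\<close> is inserted into
  \<open>D\<^sup>2\<^sup>b g + 2k D\<^sup>b g = - \<theta> g\<close> with \<open>g(0) = 1\<close>. The coefficient of \<open>t powr b\<close> has to vanish because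
  the derivative of order \<open>2 * b\<close> would turn this power into a multiple of \<open>t powr (- b)\<close>, which
  nothing else can cancel.\<close>

fun relax_coeff :: "real \<Rightarrow> real \<Rightarrow> nat \<Rightarrow> real" where
  "relax_coeff k th 0 = 1"
| "relax_coeff k th (Suc 0) = 0"
| "relax_coeff k th (Suc (Suc n)) = - 2 * k * relax_coeff k th (Suc n) - th * relax_coeff k th n"

definition relaxation :: "real \<Rightarrow> real \<Rightarrow> real \<Rightarrow> real \<Rightarrow> real" where
  "relaxation b k th t = frac_series b (relax_coeff k th) 1 t"

text \<open>The first two coefficients contribute the constant 1 to the relaxation function, so its
  derivative involves only the coefficients from index 2 on.\<close>

definition relaxation_deriv :: "real \<Rightarrow> real \<Rightarrow> real \<Rightarrow> real \<Rightarrow> real" where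
  "relaxation_deriv b k th t = frac_series b (\<lambda>n. relax_coeff k th (Suc (Suc n))) (2 * b) t"

lemma relax_coeff_bound: "\<bar>relax_coeff k th n\<bar> \<le> (1 + 2 * \<bar>k\<bar> + \<bar>th\<bar>) ^ n"
proof (induction k th n rule: relax_coeff.induct)
  case (3 k th n)
  let ?R = "1 + 2 * \<bar>k\<bar> + \<bar>th\<bar>"
  have "\<bar>relax_coeff k th (Suc (Suc n))\<bar> \<le> \<bar>2 * k * relax_coeff k th (Suc n)\<bar> + \<bar>th * relax_coeff k th n\<bar>"
    by simp
  also have "\<dots> = 2 * \<bar>k\<bar> * \<bar>relax_coeff k th (Suc n)\<bar> + \<bar>th\<bar> * \<bar>relax_coeff k th n\<bar>"
    by (simp add: abs_mult)
  also have "\<dots> \<le> 2 * \<bar>k\<bar> * ?R ^ Suc n + \<bar>th\<bar> * ?R ^ Suc n"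
  proof (intro add_mono mult_left_mono)
    show "\<bar>relax_coeff k th n\<bar> \<le> ?R ^ Suc n"
      by (rule order_trans[OF 3(2)]) (rule power_increasing, auto)
  qed (use 3 in auto)
  also have "\<dots> \<le> ?R * ?R ^ Suc n" by (simp add: distrib_right)
  finally show ?case by simp
qed auto

lemma geom_bounded_Suc: "geom_bounded d \<Longrightarrow> geom_bounded (\<lambda>n. d (Suc n))"
proof -
  assume "geom_bounded d"
  then obtain C R where R: "0 \<le> R" "\<And>n. \<bar>d n\<bar> \<le> C * R ^ n" by (auto simp: geom_bounded_def)
  have "\<bar>d (Suc n)\<bar> \<le> (C * R) * R ^ n" for n using R(2)[of "Suc n"] by (simp add: mult_ac)
  then show ?thesis using R(1) unfolding geom_bounded_def by blast
qed

lemma geom_bounded_relax_coeff: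
  "geom_bounded (relax_coeff k th)"
  "geom_bounded (\<lambda>n. relax_coeff k th (Suc n))"
  "geom_bounded (\<lambda>n. relax_coeff k th (Suc (Suc n)))"
proof -
  show 1: "geom_bounded (relax_coeff k th)"
    unfolding geom_bounded_def
    by (rule exI[of _ 1], rule exI[of _ "1 + 2 * \<bar>k\<bar> + \<bar>th\<bar>"]) (simp add: relax_coeff_bound)
  show 2: "geom_bounded (\<lambda>n. relax_coeff k th (Suc n))" by (rule geom_bounded_Suc[OF 1])
  show "geom_bounded (\<lambda>n. relax_coeff k th (Suc (Suc n)))" by (rule geom_bounded_Suc[OF 2])
qed

lemma geom_bounded_unit: "geom_bounded (\<lambda>n. if n = 0 then 1 else 0)"
  unfolding geom_bounded_def by (rule exI[of _ 1], rule exI[of _ 1]) auto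

lemma frac_series_unit: "frac_series b (\<lambda>n. if n = 0 then 1 else 0) m t = t powr (m - 1) / Gamma m"
proof -
  have "(\<lambda>n. (if n = 0 then 1 else 0) * t powr (b * real n + m - 1) / Gamma (b * real n + m)) =
     (\<lambda>n. if n = 0 then t powr (b * real n + m - 1) / Gamma (b * real n + m) else 0)"
    by (intro ext) auto
  then show ?thesis unfolding frac_series_def
    using sums_unique[OF sums_single[of 0 "\<lambda>n. t powr (b * real n + m - 1) / Gamma (b * real n + m)"]]
    by simp
qed

lemma frac_series_lincomb:
  assumes bmt: "0 < b" "0 < m" "0 < t"
    and d: "geom_bounded d1" "geom_bounded d2" "geom_bounded d3"
    and e: "\<And>n. d1 n = x * d2 n + y * d3 n"
  shows "frac_series b d1 m t = x * frac_series b d2 m t + y * frac_series b d3 m t"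
proof -
  have "(\<lambda>n. x * (d2 n * t powr (b * real n + m - 1) / Gamma (b * real n + m)) +
      y * (d3 n * t powr (b * real n + m - 1) / Gamma (b * real n + m))) sums
    (x * frac_series b d2 m t + y * frac_series b d3 m t)"
    by (intro sums_add sums_mult frac_series_sums bmt d)
  moreover have "x * (d2 n * t powr (b * real n + m - 1) / Gamma (b * real n + m)) +
      y * (d3 n * t powr (b * real n + m - 1) / Gamma (b * real n + m)) =
      d1 n * t powr (b * real n + m - 1) / Gamma (b * real n + m)" for n
    by (simp add: e algebra_simps add_divide_distrib)
  ultimately show ?thesis using frac_series_sums[OF bmt d(1)] by (simp add: sums_iff)
qed

lemma relaxation_split:
  assumes b: "0 < b" and m: "0 < m" and t: "0 < t"
  shows "frac_series b (relax_coeff k th) m t =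
    t powr (m - 1) / Gamma m + frac_series b (\<lambda>n. relax_coeff k th (Suc (Suc n))) (m + 2 * b) t"
proof -
  define c' where "c' = (\<lambda>n. if n = 0 then 0 else relax_coeff k th n)"
  have gb: "geom_bounded c'"
    unfolding geom_bounded_def c'_def
    by (rule exI[of _ 1], rule exI[of _ "1 + 2 * \<bar>k\<bar> + \<bar>th\<bar>"]) (simp add: relax_coeff_bound)
  have "frac_series b (relax_coeff k th) m t = 1 * frac_series b (\<lambda>n. if n = 0 then 1 else 0) m t + 1 * frac_series b c' m t"
    by (rule frac_series_lincomb[OF b m t geom_bounded_relax_coeff(1) geom_bounded_unit gb]) (auto simp: c'_def)
  also have "frac_series b c' m t = frac_series b (\<lambda>n. c' (Suc n)) (m + b) t"
    by (rule frac_series_shift[symmetric]) (use b m t gb in \<open>auto simp: c'_def\<close>)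
  also have "\<dots> = frac_series b (\<lambda>n. c' (Suc (Suc n))) (m + b + b) t"
    by (rule frac_series_shift[symmetric]) (use b m t geom_bounded_Suc[OF gb] in \<open>auto simp: c'_def\<close>)
  finally show ?thesis by (simp add: frac_series_unit c'_def add_ac)
qed

text \<open>The recurrence of the coefficients, read as an identity between series with an arbitrary
  first exponent \<open>m\<close>. For \<open>m = 1\<close> it is the fractional relaxation equation, for \<open>m = 2 * b\<close> a
  Volterra equation for the derivative.\<close>

lemma relax_recurrence:
  assumes b: "0 < b" and m: "0 < m" and t: "0 < t"
  shows "frac_series b (\<lambda>n. relax_coeff k th (Suc (Suc n))) m t +
      2 * k * frac_series b (\<lambda>n. relax_coeff k th (Suc (Suc n))) (m + b) t =
      - th * frac_series b (relax_coeff k th) m t"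
proof -
  have "frac_series b (\<lambda>n. relax_coeff k th (Suc (Suc n))) (m + b) t = frac_series b (\<lambda>n. relax_coeff k th (Suc n)) m t"
    by (rule frac_series_shift) (use b m t geom_bounded_relax_coeff in auto)
  moreover have "frac_series b (\<lambda>n. relax_coeff k th (Suc (Suc n))) m t =
     (- 2 * k) * frac_series b (\<lambda>n. relax_coeff k th (Suc n)) m t + (- th) * frac_series b (relax_coeff k th) m t"
    by (rule frac_series_lincomb[OF b m t]) (use geom_bounded_relax_coeff in auto)
  ultimately show ?thesis by simp
qed

lemma relaxation_deriv_resolvent:
  assumes b: "0 < b" and t: "0 < t"
  shows "relaxation_deriv b k th t
     + 2 * k / Gamma b * (LBINT s:{0<..<t}. (t - s) powr (b - 1) * relaxation_deriv b k th s)
     + th / Gamma (2 * b) * (LBINT s:{0<..<t}. (t - s) powr (2 * b - 1) * relaxation_deriv b k th s)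
     = - th * t powr (2 * b - 1) / Gamma (2 * b)"
proof -
  let ?c2 = "\<lambda>n. relax_coeff k th (Suc (Suc n))"
  have b2: "0 < 2 * b" using b by simp
  have g: "0 < Gamma b" "0 < Gamma (2 * b)" using b by (auto intro: Gamma_real_pos)
  have 1: "(LBINT s:{0<..<t}. (t - s) powr (a - 1) * relaxation_deriv b k th s) = Gamma a * frac_series b ?c2 (2 * b + a) t"
    if "0 < a" for a unfolding relaxation_deriv_def
    by (rule frac_integral_series_eq) (use b t that geom_bounded_relax_coeff in auto)
  show ?thesis unfolding 1[OF b] 1[OF b2] unfolding relaxation_deriv_def
    using relax_recurrence[OF b b2 t, of k th] relaxation_split[OF b b2 t, of k th] g
    by (simp add: algebra_simps)
qed

text \<open>If the derivative is nonpositive, then so are its fractional integrals. All three terms on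
  the left of \<open>relaxation_deriv_resolvent\<close> have the same sign, so each of them is at most as large
  as the right-hand side. The resulting bound is linear in \<open>th\<close>, whereas termwise estimates of the
  series grow exponentially with a power of \<open>th\<close>.\<close>

lemma relaxation_deriv_bound:
  assumes b: "0 < b" and t: "0 < t" and k: "0 \<le> k" and th: "0 \<le> th"
    and neg: "\<And>s. 0 < s \<Longrightarrow> relaxation_deriv b k th s \<le> 0"
  shows "\<bar>relaxation_deriv b k th t\<bar> \<le> th * t powr (2 * b - 1) / Gamma (2 * b)"
proof -
  have g: "0 < Gamma b" "0 < Gamma (2 * b)" using b by (auto intro: Gamma_real_pos)
  have 1: "(LBINT s:{0<..<t}. (t - s) powr (a - 1) * relaxation_deriv b k th s) \<le> 0" for a
  proof -
    have "0 \<le> (LINT s|lborel. - (indicator {0<..<t} s *\<^sub>R ((t - s) powr (a - 1) * relaxation_deriv b k th s)))"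
      by (rule Bochner_Integration.integral_nonneg) (auto simp: indicator_def intro!: mult_nonneg_nonpos neg)
    then show ?thesis by (simp add: set_lebesgue_integral_def)
  qed
  have "2 * k / Gamma b * (LBINT s:{0<..<t}. (t - s) powr (b - 1) * relaxation_deriv b k th s) \<le> 0"
    "th / Gamma (2 * b) * (LBINT s:{0<..<t}. (t - s) powr (2 * b - 1) * relaxation_deriv b k th s) \<le> 0"
    using g k th by (intro mult_nonneg_nonpos 1; simp)+
  then show ?thesis using relaxation_deriv_resolvent[OF b t, of k th] neg[OF t] by simp
qed

lemma has_real_derivative_relaxation:
  assumes b: "0 < b" and t: "0 < t"
  shows "(relaxation b k th has_real_derivative relaxation_deriv b k th t) (at t)"
proof -
  let ?c2 = "\<lambda>n. relax_coeff k th (Suc (Suc n))"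
  have "(frac_series b ?c2 (2 * b + 1) has_real_derivative relaxation_deriv b k th t) (at t)"
    unfolding relaxation_deriv_def
    by (rule has_real_derivative_frac_series) (use b t geom_bounded_relax_coeff in auto)
  then have "((\<lambda>s. 1 + frac_series b ?c2 (2 * b + 1) s) has_real_derivative relaxation_deriv b k th t) (at t)"
    by (auto intro!: derivative_eq_intros)
  then show ?thesis
  proof (rule has_field_derivative_transform_within_open[where S = "{0<..}"])
    fix x :: real assume "x \<in> {0<..}"
    then show "1 + frac_series b ?c2 (2 * b + 1) x = relaxation b k th x"
      using relaxation_split[of b 1 x k th] b by (simp add: relaxation_def add.commute)
  qed (use t in auto)
qed

lemma relaxation_tendsto_1:
  assumes b: "0 < b"
  shows "(relaxation b k th \<longlongrightarrow> 1) (at_right 0)"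
proof -
  let ?c2 = "\<lambda>n. relax_coeff k th (Suc (Suc n))"
  have "((\<lambda>t. 1 + frac_series b ?c2 (2 * b + 1) t) \<longlongrightarrow> 1 + 0) (at_right 0)"
    by (intro tendsto_intros frac_series_tendsto_0) (use b geom_bounded_relax_coeff in auto)
  then have "((\<lambda>t. 1 + frac_series b ?c2 (2 * b + 1) t) \<longlongrightarrow> 1) (at_right 0)" by simp
  moreover have "eventually (\<lambda>t. 1 + frac_series b ?c2 (2 * b + 1) t = relaxation b k th t) (at_right 0)"
    using eventually_at_right_less[of 0]
    by eventually_elim (use b in \<open>simp add: relaxation_def relaxation_split add.commute\<close>)
  ultimately show ?thesis by (rule Lim_transform_eventually)
qed

lemma relaxation_deriv_caputo:
  assumes b: "0 < b" "b < 1/2" and t: "0 < t"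
  shows "frac_integral (1 - 2 * b) (\<lambda>s. of_real (relaxation_deriv b k th s)) t
     + 2 * of_real k * frac_integral (1 - b) (\<lambda>s. of_real (relaxation_deriv b k th s)) t
     = - of_real th * of_real (relaxation b k th t)"
proof -
  let ?c2 = "\<lambda>n. relax_coeff k th (Suc (Suc n))"
  have 1: "frac_integral a (\<lambda>s. of_real (relaxation_deriv b k th s)) t = of_real (frac_series b ?c2 (2 * b + a) t)"
    if "0 < a" for a unfolding relaxation_deriv_def
    by (rule frac_integral_of_real_series) (use b t that geom_bounded_relax_coeff in auto)
  have "frac_series b ?c2 1 t + 2 * k * frac_series b ?c2 (1 + b) t = - th * relaxation b k th t"
    unfolding relaxation_def by (rule relax_recurrence) (use b t in auto)
  then have "complex_of_real (frac_series b ?c2 1 t + 2 * k * frac_series b ?c2 (1 + b) t) = of_real (- th * relaxation b k th t)"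
    by simp
  then show ?thesis using b by (subst 1, simp, subst 1, simp) (simp add: algebra_simps)
qed

text \<open>The recurrence shows that the generating function of the coefficients is rational. The
  condition on \<open>p\<close> keeps \<open>p powr (- b)\<close> inside the disc of convergence guaranteed by
  \<open>relax_coeff_bound\<close>.\<close>

lemma relaxation_laplace:
  assumes b: "0 < b" and k: "0 < k" and th: "0 \<le> th" and p: "0 < p"
    and large: "(1 + 2 * k + th) * p powr (- b) < 1"
  shows "integrable lborel (\<lambda>t. indicator {0<..} t * (exp (- (p * t)) * relaxation b k th t))"
    and "(LINT t|lborel. indicator {0<..} t * (exp (- (p * t)) * relaxation b k th t)) =
      (p powr (2 * b) + 2 * k * p powr b) / (p * (p powr (2 * b) + 2 * k * p powr b + th))"
proof -
  let ?c = "relax_coeff k th" and ?z = "p powr (- b)"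
  have z: "0 < ?z" using p by simp
  have S: "summable (\<lambda>n. \<bar>?c n\<bar> * ?z ^ n)"
  proof (rule summable_comparison_test')
    show "summable (\<lambda>n. ((1 + 2 * k + th) * ?z) ^ n)" using large k th z by (intro summable_geometric) auto
    show "norm (\<bar>?c n\<bar> * ?z ^ n) \<le> ((1 + 2 * k + th) * ?z) ^ n" for n
      using relax_coeff_bound[of k th n] k th z by (simp add: power_mult_distrib mult_right_mono abs_mult)
  qed
  note L = frac_series_laplace[OF b zero_less_one p geom_bounded_relax_coeff(1) S]
  show "integrable lborel (\<lambda>t. indicator {0<..} t * (exp (- (p * t)) * relaxation b k th t))"
    unfolding relaxation_def by (rule L(1))
  define C where "C = (\<Sum>n. ?c n * ?z ^ n)"
  have s0: "(\<lambda>n. ?c n * ?z ^ n) sums C"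
    unfolding C_def by (rule summable_sums, rule summable_norm_cancel) (use S in \<open>simp add: abs_mult\<close>)
  have s1: "(\<lambda>n. ?c (Suc n) * ?z ^ Suc n) sums (C - 1)"
    using sums_Suc_iff[of "\<lambda>n. ?c n * ?z ^ n" "C - 1"] s0 by simp
  have s2: "(\<lambda>n. ?c (Suc (Suc n)) * ?z ^ Suc (Suc n)) sums (C - 1)"
    using sums_Suc_iff[of "\<lambda>n. ?c (Suc n) * ?z ^ Suc n" "C - 1"] s1 by simp
  have "(\<lambda>n. (- 2 * k * ?z) * (?c (Suc n) * ?z ^ Suc n) + (- th * ?z\<^sup>2) * (?c n * ?z ^ n)) sums
      ((- 2 * k * ?z) * (C - 1) + (- th * ?z\<^sup>2) * C)"
    by (intro sums_add sums_mult s0 s1)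
  moreover have "(- 2 * k * ?z) * (?c (Suc n) * ?z ^ Suc n) + (- th * ?z\<^sup>2) * (?c n * ?z ^ n) =
     ?c (Suc (Suc n)) * ?z ^ Suc (Suc n)" for n
    by (simp add: algebra_simps power2_eq_square)
  ultimately have "(\<lambda>n. ?c (Suc (Suc n)) * ?z ^ Suc (Suc n)) sums ((- 2 * k * ?z) * (C - 1) + (- th * ?z\<^sup>2) * C)"
    by (simp only:)
  then have "C - 1 = (- 2 * k * ?z) * (C - 1) + (- th * ?z\<^sup>2) * C"
    by (rule sums_unique2[OF s2])
  then have e: "C * (1 + 2 * k * ?z + th * ?z\<^sup>2) = 1 + 2 * k * ?z" by (simp add: algebra_simps)
  have zz: "?z * p powr b = 1" using p by (simp add: powr_minus)
  have pp: "p powr (2 * b) = (p powr b)\<^sup>2" by (simp add: power2_eq_square powr_add[symmetric])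
  have "C * (1 + 2 * k * ?z + th * ?z\<^sup>2) * (p powr b)\<^sup>2 = C * ((p powr b)\<^sup>2 + 2 * k * (?z * p powr b) * p powr b + th * (?z * p powr b)\<^sup>2)"
    by (simp add: algebra_simps power2_eq_square)
  then have "C * ((p powr b)\<^sup>2 + 2 * k * p powr b + th) = (1 + 2 * k * ?z) * (p powr b)\<^sup>2"
    unfolding e zz by simp
  also have "\<dots> = (p powr b)\<^sup>2 + 2 * k * (?z * p powr b) * p powr b" by (simp add: algebra_simps power2_eq_square)
  finally have e2: "C * (p powr (2 * b) + 2 * k * p powr b + th) = p powr (2 * b) + 2 * k * p powr b"
    unfolding zz pp by simp
  have "0 < p powr (2 * b) + 2 * k * p powr b + th"
    using p k th by (intro add_pos_nonneg) auto
  then have "C = (p powr (2 * b) + 2 * k * p powr b) / (p powr (2 * b) + 2 * k * p powr b + th)"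
    using e2 by (simp add: field_simps)
  then show "(LINT t|lborel. indicator {0<..} t * (exp (- (p * t)) * relaxation b k th t)) =
      (p powr (2 * b) + 2 * k * p powr b) / (p * (p powr (2 * b) + 2 * k * p powr b + th))"
    unfolding relaxation_def L(2) C_def[symmetric] using p by (simp add: powr_minus divide_inverse)
qed

text \<open>The numbers \<open>- k + q\<close> and \<open>- k - q\<close> are the roots of \<open>r\<^sup>2 + 2 k r + th\<close>, so both sides
  satisfy the same recurrence; the weights are those that reproduce the initial values 1 and 0.\<close>

lemma relax_coeff_roots:
  fixes q :: complex
  assumes q: "q\<^sup>2 = of_real (k\<^sup>2 - th)" and q0: "q \<noteq> 0"
  shows "1 / 2 * ((1 + of_real k / q) * (- of_real k + q) ^ n + (1 - of_real k / q) * (- of_real k - q) ^ n)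
     = of_real (relax_coeff k th n)"
proof -
  let ?r1 = "- of_real k + q" and ?r2 = "- of_real k - q"
  have r: "?r1\<^sup>2 = - 2 * of_real k * ?r1 - of_real th" "?r2\<^sup>2 = - 2 * of_real k * ?r2 - of_real th"
    using q by (simp_all add: power2_eq_square algebra_simps)
  let ?A = "1 + of_real k / q" and ?B = "1 - of_real k / q"
  let ?f = "\<lambda>n. 1 / 2 * (?A * ?r1 ^ n + ?B * ?r2 ^ n)"
  have gen: "1 / 2 * (A * ((- 2 * K * r - T) * x) + B * ((- 2 * K * r' - T) * y)) =
      - 2 * K * (1 / 2 * (A * (r * x) + B * (r' * y))) - T * (1 / 2 * (A * x + B * y))"
    for A B K r r' T x y :: complex by (simp add: algebra_simps)
  have rec: "?f (Suc (Suc n)) = - 2 * of_real k * ?f (Suc n) - of_real th * ?f n" for n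
  proof -
    have "?f (Suc (Suc n)) = 1 / 2 * (?A * (?r1\<^sup>2 * ?r1 ^ n) + ?B * (?r2\<^sup>2 * ?r2 ^ n))"
      by (simp add: power2_eq_square mult.assoc)
    also have "\<dots> = - 2 * of_real k * ?f (Suc n) - of_real th * ?f n"
      unfolding r power_Suc by (rule gen)
    finally show ?thesis .
  qed
  have "?f n = of_real (relax_coeff k th n)"
  proof (induction n rule: induct_nat_012)
    case 1
    show ?case using q0 by (simp add: field_simps)
  next
    case (ge2 n)
    then show ?case unfolding rec by simp
  qed simp
  then show ?thesis .
qed

lemma mittag_leffler_sums:
  assumes b: "0 < b"
  shows "(\<lambda>n. z ^ n / of_real (Gamma (b * real n + 1))) sums mittag_leffler b 1 z"
proof -
  have G: "0 < Gamma (b * real n + 1)" for n using b by (intro Gamma_real_pos) (simp add: add_nonneg_pos)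
  have e: "z ^ n / Gamma (of_real b * of_nat n + 1) = z ^ n / of_real (Gamma (b * real n + 1))" for n
    by (simp add: Gamma_complex_of_real[symmetric])
  have "summable (\<lambda>n. norm (z ^ n / of_real (Gamma (b * real n + 1))))"
    using summable_power_Gamma[OF b zero_less_one norm_ge_zero[of z]] G
    by (simp add: norm_divide norm_power less_imp_le)
  then show ?thesis unfolding mittag_leffler_def e by (rule summable_sums[OF summable_norm_cancel])
qed

lemma fund_sol_fourier_eq_relaxation:
  assumes b: "0 < b" and t: "0 < t" and ne: "theta \<alpha> lam \<xi> \<noteq> k\<^sup>2"
  shows "fund_sol_fourier \<alpha> b lam k \<xi> t = of_real (relaxation b k (theta \<alpha> lam \<xi>) t)"
proof -
  let ?th = "theta \<alpha> lam \<xi>"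
  define q where "q = csqrt (of_real (k\<^sup>2 - ?th))"
  have q2: "q\<^sup>2 = of_real (k\<^sup>2 - ?th)" by (simp add: q_def)
  have "complex_of_real (k\<^sup>2 - ?th) \<noteq> 0" unfolding of_real_eq_0_iff using ne by simp
  then have q0: "q \<noteq> 0" using q2 by auto
  let ?r1 = "- of_real k + q" and ?r2 = "- of_real k - q"
  let ?z = "of_real (t powr b) :: complex"
  have "(\<lambda>n. 1 / 2 * ((1 + of_real k / q) * ((?r1 * ?z) ^ n / of_real (Gamma (b * real n + 1))) +
      (1 - of_real k / q) * ((?r2 * ?z) ^ n / of_real (Gamma (b * real n + 1))))) sums
    fund_sol_fourier \<alpha> b lam k \<xi> t"
    unfolding fund_sol_fourier_def Let_def q_def[symmetric]
    by (intro sums_add sums_mult mittag_leffler_sums b)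
  moreover have "1 / 2 * ((1 + of_real k / q) * ((?r1 * ?z) ^ n / of_real (Gamma (b * real n + 1))) +
      (1 - of_real k / q) * ((?r2 * ?z) ^ n / of_real (Gamma (b * real n + 1)))) =
      complex_of_real (relax_coeff k ?th n * t powr (b * real n + 1 - 1) / Gamma (b * real n + 1))" for n
  proof -
    have gen: "1 / 2 * (A * (X * Z / w) + B * (Y * Z / w)) = 1 / 2 * (A * X + B * Y) * (Z / w)"
      for A B X Y Z w :: complex by (simp add: algebra_simps add_divide_distrib)
    have "1 / 2 * ((1 + of_real k / q) * ((?r1 * ?z) ^ n / of_real (Gamma (b * real n + 1))) +
      (1 - of_real k / q) * ((?r2 * ?z) ^ n / of_real (Gamma (b * real n + 1)))) =
      1 / 2 * ((1 + of_real k / q) * ?r1 ^ n + (1 - of_real k / q) * ?r2 ^ n) * (?z ^ n / of_real (Gamma (b * real n + 1)))"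
      unfolding power_mult_distrib by (rule gen)
    then show ?thesis unfolding relax_coeff_roots[OF q2 q0]
      by (simp add: powr_mult_of_nat[OF t])
  qed
  ultimately have "(\<lambda>n. complex_of_real (relax_coeff k ?th n * t powr (b * real n + 1 - 1) / Gamma (b * real n + 1))) sums
     fund_sol_fourier \<alpha> b lam k \<xi> t" by simp
  moreover have "(\<lambda>n. complex_of_real (relax_coeff k ?th n * t powr (b * real n + 1 - 1) / Gamma (b * real n + 1))) sums
     of_real (relaxation b k ?th t)"
    unfolding relaxation_def by (intro sums_of_real frac_series_sums b t zero_less_one geom_bounded_relax_coeff)
  ultimately show ?thesis by (rule sums_unique2)
qed

lemma measurable_relax_coeff: "(\<lambda>th. relax_coeff k th n) \<in> borel_measurable borel"
proof (induction n rule: induct_nat_012)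
  case (ge2 n)
  then show ?case by simp
qed auto

lemma measurable_relaxation_deriv:
  "(\<lambda>(th, t). relaxation_deriv b k th t) \<in> borel_measurable (borel \<Otimes>\<^sub>M borel)"
proof -
  note [measurable] = measurable_relax_coeff
  show ?thesis unfolding relaxation_deriv_def frac_series_def by measurable
qed

section \<open>Uniqueness for Laplace transforms\<close>

text \<open>In terms of \<open>y = exp (- t)\<close>, which ranges over \<open>{0<..<1}\<close>, all moments vanish. Polynomials
  in \<open>y\<close> therefore integrate to 0, and so do continuous functions of \<open>y\<close> by Weierstrass
  approximation.\<close>

lemma integral_compose_exp_eq_0:
  fixes f h :: "real \<Rightarrow> real"
  assumes f: "integrable lborel f" and f0: "\<And>t. t \<le> 0 \<Longrightarrow> f t = 0"
    and z: "\<And>n::nat. (LINT t|lborel. f t * exp (- (real n * t))) = 0"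
    and h: "continuous_on UNIV h"
  shows "(LINT t|lborel. f t * h (exp (- t))) = 0"
proof -
  note [measurable] = borel_measurable_integrable[OF f]
  have h': "h \<in> borel_measurable borel" using h by (rule borel_measurable_continuous_onI)
  note [measurable] = h'
  have I: "integrable lborel (\<lambda>t. f t * q (exp (- t)))"
    if q: "continuous_on {0..1} q" and [measurable]: "q \<in> borel_measurable borel" for q :: "real \<Rightarrow> real"
  proof -
    have "bounded (q ` {0..1})"
      by (rule compact_imp_bounded[OF compact_continuous_image[OF q]]) simp
    then obtain B where "\<forall>x\<in>q ` {0..1}. norm x \<le> B" unfolding bounded_iff by blast
    then have B: "\<bar>q y\<bar> \<le> B" if "y \<in> {0..1}" for y using that by auto
    show ?thesis
    proof (rule Bochner_Integration.integrable_bound[of _ "\<lambda>t. B * f t"])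
      show "AE t in lborel. norm (f t * q (exp (- t))) \<le> norm (B * f t)"
      proof (rule AE_I2)
        fix t
        show "norm (f t * q (exp (- t))) \<le> norm (B * f t)"
        proof (cases "t \<le> 0")
          case False
          then have "\<bar>q (exp (- t))\<bar> \<le> B" by (intro B) auto
          then have "\<bar>q (exp (- t))\<bar> \<le> \<bar>B\<bar>" by linarith
          then show ?thesis using mult_left_mono[of "\<bar>q (exp (- t))\<bar>" "\<bar>B\<bar>" "\<bar>f t\<bar>"]
            by (simp add: abs_mult mult.commute)
        qed (simp add: f0)
      qed
    qed (use f in auto)
  qed
  have P: "(LINT t|lborel. f t * q (exp (- t))) = 0" if qp: "real_polynomial_function q" for q
  proof -
    obtain a n where q: "q = (\<lambda>x. \<Sum>i\<le>n. a i * x ^ i)"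
      using qp unfolding real_polynomial_function_iff_sum by blast
    have e: "f t * q (exp (- t)) = (\<Sum>i\<le>n. a i * (f t * exp (- (real i * t))))" for t
      by (simp add: q sum_distrib_left exp_of_nat_mult[symmetric] mult_ac)
    have Ii: "integrable lborel (\<lambda>t. f t * exp (- (real i * t)))" for i
    proof -
      have "integrable lborel (\<lambda>t. f t * (exp (- t)) ^ i)"
        by (rule I) (auto intro!: continuous_intros)
      then show ?thesis by (simp add: exp_of_nat_mult[symmetric])
    qed
    show ?thesis unfolding e
      by (subst Bochner_Integration.integral_sum) (auto intro: Ii simp: z)
  qed
  define N where "N = (LINT t|lborel. \<bar>f t\<bar>)"
  have "\<bar>LINT t|lborel. f t * h (exp (- t))\<bar> \<le> e * N" if e: "0 < e" for e
  proof -
    have h1: "continuous_on {0..1} h" using h continuous_on_subset by blast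
    obtain q where q: "real_polynomial_function q" "\<And>x. x \<in> {0..1} \<Longrightarrow> \<bar>h x - q x\<bar> < e"
      using Stone_Weierstrass_real_polynomial_function[OF compact_Icc h1 e] by blast
    have qc: "continuous_on S q" for S using q(1)
      by (simp add: continuous_on_polymonial_function real_polynomial_function_eq)
    have [measurable]: "q \<in> borel_measurable borel" by (rule borel_measurable_continuous_onI[OF qc])
    have Iq: "integrable lborel (\<lambda>t. f t * q (exp (- t)))" by (rule I[OF qc]) simp
    have Ih: "integrable lborel (\<lambda>t. f t * h (exp (- t)))" by (rule I[OF h1]) simp
    have "(LINT t|lborel. f t * h (exp (- t))) = (LINT t|lborel. f t * h (exp (- t)) - f t * q (exp (- t)))"
      by (subst Bochner_Integration.integral_diff[OF Ih Iq]) (simp add: P[OF q(1)])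
    also have "\<bar>\<dots>\<bar> \<le> (LINT t|lborel. e * \<bar>f t\<bar>)"
    proof (rule order_trans[OF integral_abs_bound integral_mono])
      show "integrable lborel (\<lambda>t. \<bar>f t * h (exp (- t)) - f t * q (exp (- t))\<bar>)"
        by (intro integrable_abs Bochner_Integration.integrable_diff Ih Iq)
      show "\<bar>f t * h (exp (- t)) - f t * q (exp (- t))\<bar> \<le> e * \<bar>f t\<bar>" for t
      proof (cases "t \<le> 0")
        case False
        then have "\<bar>h (exp (- t)) - q (exp (- t))\<bar> < e" by (intro q(2)) auto
        then have "\<bar>f t\<bar> * \<bar>h (exp (- t)) - q (exp (- t))\<bar> \<le> \<bar>f t\<bar> * e"
          by (intro mult_left_mono) auto
        then show ?thesis by (simp add: right_diff_distrib[symmetric] abs_mult mult.commute)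
      qed (simp add: f0)
    qed (use f in auto)
    also have "\<dots> = e * N" by (simp add: N_def)
    finally show ?thesis .
  qed
  moreover have "((\<lambda>e. e * N) \<longlongrightarrow> 0 * N) (at_right 0)" by (intro tendsto_intros)
  ultimately have "\<bar>LINT t|lborel. f t * h (exp (- t))\<bar> \<le> 0 * N"
    by (intro tendsto_lowerbound[of "\<lambda>e. e * N" _ "at_right 0"])
       (auto simp: eventually_at_right_less intro!: eventually_mono[OF eventually_at_right_less[of 0]])
  then show ?thesis by simp
qed

text \<open>The indicator of \<open>{a<..}\<close> is a bounded pointwise limit of continuous functions of
  \<open>exp (- t)\<close>, namely of piecewise linear ramps that start at the value \<open>exp (- a)\<close> and get
  steeper.\<close>

lemma laplace_zero_imp_tail_zero:
  fixes f :: "real \<Rightarrow> real"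
  assumes f: "integrable lborel f" and f0: "\<And>t. t \<le> 0 \<Longrightarrow> f t = 0"
    and z: "\<And>n::nat. (LINT t|lborel. f t * exp (- (real n * t))) = 0"
  shows "(LINT t|lborel. indicator {a<..} t * f t) = 0"
proof -
  note [measurable] = borel_measurable_integrable[OF f]
  define h where "h = (\<lambda>(n::nat) y. max 0 (min 1 (real n * (exp (- a) - y))))"
  have "(\<lambda>n. LINT t|lborel. f t * h n (exp (- t))) \<longlonglongrightarrow> (LINT t|lborel. indicator {a<..} t * f t)"
  proof (rule integral_dominated_convergence[where w = "\<lambda>t. \<bar>f t\<bar>"])
    show "(\<lambda>t. f t * h n (exp (- t))) \<in> borel_measurable lborel" for n
      unfolding h_def by measurable
    show "AE t in lborel. (\<lambda>n. f t * h n (exp (- t))) \<longlonglongrightarrow> indicator {a<..} t * f t"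
    proof (rule AE_I2)
      fix t
      show "(\<lambda>n. f t * h n (exp (- t))) \<longlonglongrightarrow> indicator {a<..} t * f t"
      proof (cases "a < t")
        case True
        then have c: "0 < exp (- a) - exp (- t)" by simp
        have "eventually (\<lambda>n::nat. 1 \<le> real n * (exp (- a) - exp (- t))) sequentially"
          using c by real_asymp
        then have "eventually (\<lambda>n. f t * h n (exp (- t)) = indicator {a<..} t * f t) sequentially"
          by eventually_elim (use True in \<open>simp add: h_def min_absorb1\<close>)
        then show ?thesis by (rule tendsto_eventually)
      next
        case False
        then have "real n * (exp (- a) - exp (- t)) \<le> 0" for n by (simp add: mult_nonneg_nonpos)
        then have "h n (exp (- t)) = 0" for n unfolding h_def by (intro max_absorb1 min.coboundedI2)
        then show ?thesis using False by simp
      qed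
    qed
    show "AE t in lborel. norm (f t * h n (exp (- t))) \<le> \<bar>f t\<bar>" for n
    proof (rule AE_I2)
      fix t
      have "\<bar>h n (exp (- t))\<bar> \<le> 1" by (auto simp: h_def)
      then have "\<bar>f t\<bar> * \<bar>h n (exp (- t))\<bar> \<le> \<bar>f t\<bar> * 1" by (rule mult_left_mono) simp
      then show "norm (f t * h n (exp (- t))) \<le> \<bar>f t\<bar>" by (simp add: abs_mult)
    qed
  qed (use f in auto)
  moreover have "(LINT t|lborel. f t * h n (exp (- t))) = 0" for n
    by (rule integral_compose_exp_eq_0[OF f f0 z]) (auto simp: h_def intro!: continuous_intros)
  ultimately show ?thesis by (simp add: LIMSEQ_const_iff)
qed

text \<open>Lerch's theorem for a monotone and a continuous function. After multiplication with
  \<open>exp (- p0 * t)\<close> the difference is integrable, and the transforms at \<open>p0 + n\<close> for natural \<open>n\<close>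
  force its integral over every interval to vanish. If the two functions differed at \<open>t\<close>,
  monotonicity of the one and continuity of the other would keep them apart on a whole interval,
  to the right of \<open>t\<close> if \<open>g t < G t\<close> and to the left of \<open>t\<close> if \<open>G t < g t\<close>.\<close>

lemma laplace_unique_antimono_continuous:
  fixes g G :: "real \<Rightarrow> real"
  assumes g: "\<And>s t. 0 < s \<Longrightarrow> s \<le> t \<Longrightarrow> g t \<le> g s"
    and g01: "\<And>t. 0 < t \<Longrightarrow> 0 \<le> g t" "\<And>t. 0 < t \<Longrightarrow> g t \<le> 1"
    and G: "\<And>t. 0 < t \<Longrightarrow> isCont G t"
    and p0: "0 < p0"
    and IG: "\<And>p. p0 \<le> p \<Longrightarrow> integrable lborel (\<lambda>t. indicator {0<..} t * (exp (- (p * t)) * G t))"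
    and eq: "\<And>p. p0 \<le> p \<Longrightarrow> (LINT t|lborel. indicator {0<..} t * (exp (- (p * t)) * G t)) =
       (LINT t|lborel. indicator {0<..} t * (exp (- (p * t)) * g t))"
    and t: "0 < t"
  shows "g t = G t"
proof -
  define g1 where "g1 = (\<lambda>t. if 0 < t then g t else 1)"
  have "mono (\<lambda>t. - g1 t)" unfolding g1_def by (rule monoI) (auto intro: g g01)
  then have "(\<lambda>t. - g1 t) \<in> borel_measurable borel" by (rule borel_measurable_mono)
  then have [measurable]: "g1 \<in> borel_measurable borel" by simp
  have gg1: "indicator {0<..} t * (exp (- (p * t)) * g t) = indicator {0<..} t * (exp (- (p * t)) * g1 t)" for p t :: real
    by (auto simp: g1_def indicator_def)
  have Iexp: "integrable lborel (\<lambda>t. indicator {0<..} t * exp (- (p * t)) :: real)" if "0 < p" for p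
    using has_bochner_integral_exp[OF that] by (simp add: has_bochner_integral_iff)
  have Ig: "integrable lborel (\<lambda>t. indicator {0<..} t * (exp (- (p * t)) * g t))" if "0 < p" for p
    unfolding gg1
  proof (rule Bochner_Integration.integrable_bound[OF Iexp[OF that]])
    show "(\<lambda>t. indicator {0<..} t * (exp (- (p * t)) * g1 t)) \<in> borel_measurable lborel"
      by measurable
  qed (use g01 in \<open>auto simp: indicator_def g1_def\<close>)
  define h where "h = (\<lambda>t. exp (- (p0 * t)) * g t)"
  define H where "H = (\<lambda>t. exp (- (p0 * t)) * G t)"
  define f where "f = (\<lambda>t. indicator {0<..} t * H t - indicator {0<..} t * h t)"
  have If: "integrable lborel f"
    unfolding f_def h_def H_def by (intro Bochner_Integration.integrable_diff IG Ig p0) simp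
  have tail: "(LINT t|lborel. indicator {a<..} t * f t) = 0" for a
  proof (rule laplace_zero_imp_tail_zero[OF If])
    fix n :: nat
    have e: "f t * exp (- (real n * t)) = indicator {0<..} t * (exp (- ((p0 + real n) * t)) * G t) -
       indicator {0<..} t * (exp (- ((p0 + real n) * t)) * g t)" for t
      by (simp add: f_def h_def H_def exp_add[symmetric] algebra_simps)
    show "(LINT t|lborel. f t * exp (- (real n * t))) = 0"
      unfolding e using p0
      by (subst Bochner_Integration.integral_diff) (auto intro!: IG Ig simp: eq)
  qed (simp add: f_def)
  have int0: "(LINT s|lborel. indicator {a<..b} s * f s) = 0" if "a \<le> b" for a b
  proof -
    have I: "integrable lborel (\<lambda>s. indicator {a<..} s * f s)" for a
      using integrable_mult_indicator[OF _ If, of "{a<..}"] by simp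
    have "indicator {a<..b} s * f s = indicator {a<..} s * f s - indicator {b<..} s * f s" for s
      using that by (auto simp: indicator_def)
    then show ?thesis using Bochner_Integration.integral_diff[OF I I, of a b] by (simp add: tail)
  qed
  have Iab: "integrable lborel (\<lambda>s. indicator {a<..b} s * f s)" for a b
    using integrable_mult_indicator[OF _ If, of "{a<..b}"] by simp
  have Hc: "isCont H t" unfolding H_def using G[OF t] by (intro continuous_intros) auto
  have hmono: "h v \<le> h u" if "0 < u" "u \<le> v" for u v
    unfolding h_def by (rule mult_mono) (use that p0 g g01 in auto)
  have "\<not> h t < H t"
  proof
    assume a: "h t < H t"
    define c where "c = (h t + H t) / 2"
    have "eventually (\<lambda>s. c < H s) (at t)"
      using Hc a by (intro order_tendstoD(1)[of H "H t"]) (auto simp: isCont_def c_def)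
    then obtain d where d: "0 < d" "\<And>s. s \<noteq> t \<Longrightarrow> dist s t < d \<Longrightarrow> c < H s"
      by (auto simp: eventually_at)
    have "(LINT s|lborel. (c - h t) * indicator {t<..t + d / 2} s) \<le> (LINT s|lborel. indicator {t<..t + d / 2} s * f s)"
    proof (rule integral_mono[OF _ Iab])
      show "integrable lborel (\<lambda>s. (c - h t) * indicator {t<..t + d / 2} s)"
        by (intro integrable_mult_right integrable_real_indicator) (use d in simp_all)
      fix s :: real
      show "(c - h t) * indicator {t<..t + d / 2} s \<le> indicator {t<..t + d / 2} s * f s"
      proof (cases "s \<in> {t<..t + d / 2}")
        case True
        then have "c < H s" "h s \<le> h t" using d t by (auto intro!: d hmono simp: dist_real_def)
        then show ?thesis using True t by (simp add: f_def)
      qed simp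
    qed
    then have "(c - h t) * (d / 2) \<le> 0" using int0[of t "t + d / 2"] d by simp
    moreover have "0 < (c - h t) * (d / 2)" using a d by (simp add: c_def)
    ultimately show False by simp
  qed
  moreover have "\<not> H t < h t"
  proof
    assume a: "H t < h t"
    define c where "c = (h t + H t) / 2"
    have "eventually (\<lambda>s. H s < c) (at t)"
      using Hc a by (intro order_tendstoD(2)[of H "H t"]) (auto simp: isCont_def c_def)
    then obtain d' where d': "0 < d'" "\<And>s. s \<noteq> t \<Longrightarrow> dist s t < d' \<Longrightarrow> H s < c"
      by (auto simp: eventually_at)
    define d where "d = min (d' / 2) (t / 2)"
    have d: "0 < d" "d < d'" "d < t" using d' t by (auto simp: d_def)
    have Ht: "H t < c" using a by (simp add: c_def)
    have "(LINT s|lborel. (h t - c) * indicator {t - d<..t} s) \<le> (LINT s|lborel. - (indicator {t - d<..t} s * f s))"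
    proof (rule integral_mono)
      show "integrable lborel (\<lambda>s. (h t - c) * indicator {t - d<..t} s)"
        by (intro integrable_mult_right integrable_real_indicator) (use d in simp_all)
      show "integrable lborel (\<lambda>s. - (indicator {t - d<..t} s * f s))"
        by (intro Bochner_Integration.integrable_minus Iab)
      fix s :: real
      show "(h t - c) * indicator {t - d<..t} s \<le> - (indicator {t - d<..t} s * f s)"
      proof (cases "s \<in> {t - d<..t}")
        case True
        then have "H s < c" using d Ht by (cases "s = t") (auto intro!: d' simp: dist_real_def)
        moreover have "h t \<le> h s" using True d by (intro hmono) auto
        ultimately show ?thesis using True d by (simp add: f_def)
      qed simp
    qed
    then have "(h t - c) * d \<le> 0" using int0[of "t - d" t] d by simp
    moreover have "0 < (h t - c) * d" using a d by (simp add: c_def)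
    ultimately show False by simp
  qed
  ultimately have "h t = H t" by simp
  then show ?thesis by (simp add: h_def H_def)
qed

section \<open>Independent random times\<close>

text \<open>For \<open>s \<ge> 0\<close>, the least multiple of \<open>1 / (n + 1)\<close> that is strictly greater than \<open>s\<close>.
  Strictness makes the grid points converge to \<open>s\<close> in the filter \<open>at_right s\<close>, as right-continuity
  of paths requires.\<close>

definition grid :: "nat \<Rightarrow> real \<Rightarrow> real" where
  "grid n s = (real (nat \<lfloor>real (Suc n) * s\<rfloor>) + 1) / real (Suc n)"

lemma grid_bounds:
  assumes "0 \<le> s"
  shows "s < grid n s" "grid n s \<le> s + 1 / real (Suc n)"
proof -
  have f: "real (nat \<lfloor>real (Suc n) * s\<rfloor>) = of_int \<lfloor>real (Suc n) * s\<rfloor>" using assms by simp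
  have "real (Suc n) * s < real (nat \<lfloor>real (Suc n) * s\<rfloor>) + 1" unfolding f by linarith
  then show "s < grid n s" unfolding grid_def by (simp add: field_simps)
  have "real (nat \<lfloor>real (Suc n) * s\<rfloor>) \<le> real (Suc n) * s" unfolding f by linarith
  then have "real (nat \<lfloor>real (Suc n) * s\<rfloor>) / real (Suc n) \<le> s"
    by (subst pos_divide_le_eq) (simp_all add: mult.commute)
  then show "grid n s \<le> s + 1 / real (Suc n)" unfolding grid_def add_divide_distrib by simp
qed

lemma grid_filterlim:
  assumes "0 \<le> s"
  shows "filterlim (\<lambda>n. grid n s) (at_right s) sequentially"
proof (rule tendsto_imp_filterlim_at_right)
  have lim: "(\<lambda>n. s + 1 / real (Suc n)) \<longlonglongrightarrow> s" by real_asymp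
  show "(\<lambda>n. grid n s) \<longlonglongrightarrow> s"
    by (rule tendsto_sandwich[OF _ _ tendsto_const lim])
       (auto intro!: always_eventually grid_bounds(2) less_imp_le[OF grid_bounds(1)] assms simp del: of_nat_Suc)
  show "eventually (\<lambda>n. s < grid n s) sequentially" by (auto intro!: always_eventually grid_bounds assms)
qed

lemma grid_compose_tendsto:
  fixes X :: "real \<Rightarrow> 'a::topological_space"
  assumes "0 \<le> s" "continuous (at_right s) X"
  shows "(\<lambda>n. X (grid n s)) \<longlonglongrightarrow> X s"
  by (rule filterlim_compose[OF _ grid_filterlim[OF assms(1)]]) (use assms(2) in \<open>simp add: continuous_within\<close>)

text \<open>Rounded up to the grid, the random time takes countably many values; right-continuity
  carries measurability over to the limit.\<close>

lemma measurable_random_time: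
  fixes X :: "real \<Rightarrow> 'w \<Rightarrow> real"
  assumes X: "\<And>t. 0 \<le> t \<Longrightarrow> X t \<in> borel_measurable F"
    and S[measurable]: "S \<in> borel_measurable F" and S0: "\<And>\<omega>. \<omega> \<in> space F \<Longrightarrow> 0 \<le> S \<omega>"
    and rc: "\<And>\<omega> t. \<omega> \<in> space F \<Longrightarrow> 0 \<le> t \<Longrightarrow> continuous (at_right t) (\<lambda>s. X s \<omega>)"
  shows "(\<lambda>\<omega>. X (S \<omega>) \<omega>) \<in> borel_measurable F"
proof (rule borel_measurable_LIMSEQ_real)
  show "(\<lambda>n. X (grid n (S \<omega>)) \<omega>) \<longlonglongrightarrow> X (S \<omega>) \<omega>" if "\<omega> \<in> space F" for \<omega>
    by (rule grid_compose_tendsto[where X = "\<lambda>s. X s \<omega>"]) (use that S0 rc in auto)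
  show "(\<lambda>\<omega>. X (grid n (S \<omega>)) \<omega>) \<in> borel_measurable F" for n
    unfolding grid_def
  proof (rule measurable_compose_countable[where f = "\<lambda>j \<omega>. X ((real j + 1) / real (Suc n)) \<omega>"])
    show "X ((real j + 1) / real (Suc n)) \<in> borel_measurable F" for j by (rule X) simp
    show "(\<lambda>\<omega>. nat \<lfloor>real (Suc n) * S \<omega>\<rfloor>) \<in> F \<rightarrow>\<^sub>M count_space UNIV" by measurable
  qed
qed

text \<open>On the event that the random time rounded up to the grid has the value \<open>t\<close>, independence
  replaces \<open>f (X t)\<close> by its expectation \<open>exp (- t * \<psi>)\<close>. Summation over the countably many grid
  values gives the claim for the rounded time, and right-continuity of the paths gives it in the
  limit.\<close>

lemma (in prob_space) expectation_at_independent_time: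
  fixes X :: "real \<Rightarrow> 'a \<Rightarrow> real" and f :: "real \<Rightarrow> complex" and \<psi> :: real
  assumes ind: "\<And>t. 0 \<le> t \<Longrightarrow> indep_var borel S borel (X t)"
    and S0: "\<And>\<omega>. \<omega> \<in> space M \<Longrightarrow> 0 \<le> S \<omega>"
    and rc: "\<And>\<omega> t. \<omega> \<in> space M \<Longrightarrow> 0 \<le> t \<Longrightarrow> continuous (at_right t) (\<lambda>s. X s \<omega>)"
    and f: "continuous_on UNIV f" "\<And>\<omega> t. \<omega> \<in> space M \<Longrightarrow> 0 \<le> t \<Longrightarrow> norm (f (X t \<omega>)) \<le> 1"
    and E: "\<And>t. 0 \<le> t \<Longrightarrow> (LINT \<omega>|M. f (X t \<omega>)) = of_real (exp (- (t * \<psi>)))" and \<psi>: "0 \<le> \<psi>"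
  shows "(LINT \<omega>|M. f (X (S \<omega>) \<omega>)) = of_real (LINT \<omega>|M. exp (- (S \<omega> * \<psi>)))"
proof -
  have Sm[measurable]: "S \<in> borel_measurable M" using indep_var_rv1[OF ind[of 0]] by simp
  have Xm[measurable]: "X t \<in> borel_measurable M" if "0 \<le> t" for t using indep_var_rv2[OF ind[OF that]] .
  have fm[measurable]: "f \<in> borel_measurable borel" by (rule borel_measurable_continuous_onI[OF f(1)])
  have XS[measurable]: "(\<lambda>\<omega>. X (S \<omega>) \<omega>) \<in> borel_measurable M"
    by (rule measurable_random_time) (use Xm S0 rc in auto)
  have grid0: "0 \<le> grid n s" for n s by (simp add: grid_def)
  have gm[measurable]: "grid n \<in> borel_measurable borel" for n unfolding grid_def by measurable
  have Xg[measurable]: "(\<lambda>\<omega>. X (grid n (S \<omega>)) \<omega>) \<in> borel_measurable M" for n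
    by (rule measurable_random_time[where S = "\<lambda>\<omega>. grid n (S \<omega>)"]) (use Xm grid0 rc in auto)
  have step: "(LINT \<omega>|M. f (X (grid n (S \<omega>)) \<omega>)) = (LINT \<omega>|M. of_real (exp (- (grid n (S \<omega>) * \<psi>))))" for n
  proof -
    define J where "J = (\<lambda>s. nat \<lfloor>real (Suc n) * s\<rfloor>)"
    define tt where "tt = (\<lambda>j::nat. (real j + 1) / real (Suc n))"
    have tt0: "0 \<le> tt j" for j by (simp add: tt_def)
    have Jm[measurable]: "J \<in> borel \<rightarrow>\<^sub>M count_space UNIV" unfolding J_def by measurable
    have gJ: "grid n s = tt (J s)" for s by (simp add: grid_def tt_def J_def)
    define i where "i = (\<lambda>(j::nat) s. if J s = j then 1 else 0 :: complex)"
    have im[measurable]: "i j \<in> borel_measurable borel" for j unfolding i_def by measurable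
    \<comment> \<open>Decomposition of an expectation according to the grid cell that contains the random time.\<close>
    have split: "(\<lambda>j. LINT \<omega>|M. i j (S \<omega>) * h j \<omega>) sums (LINT \<omega>|M. h (J (S \<omega>)) \<omega>)"
      if hm[measurable]: "\<And>j. h j \<in> borel_measurable M" and h1: "\<And>j \<omega>. \<omega> \<in> space M \<Longrightarrow> norm (h j \<omega>) \<le> 1"
      for h :: "nat \<Rightarrow> 'a \<Rightarrow> complex"
    proof -
      have I: "integrable M (\<lambda>\<omega>. i j (S \<omega>) * h j \<omega>)" for j
        by (rule integrable_const_bound[where B = 1]) (auto simp: i_def h1)
      have S1: "AE \<omega> in M. summable (\<lambda>j. norm (i j (S \<omega>) * h j \<omega>))"
      proof (rule AE_I2)
        fix \<omega>
        show "summable (\<lambda>j. norm (i j (S \<omega>) * h j \<omega>))"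
          by (rule summable_finite[of "{J (S \<omega>)}"]) (auto simp: i_def)
      qed
      have Ji: "(\<lambda>j. LINT \<omega>|M. (if J (S \<omega>) = j then 1 else 0 :: real)) = (\<lambda>j. prob {\<omega> \<in> space M. J (S \<omega>) = j})"
      proof
        fix j
        have "(LINT \<omega>|M. (if J (S \<omega>) = j then 1 else 0 :: real)) = (LINT \<omega>|M. indicator {\<omega> \<in> space M. J (S \<omega>) = j} \<omega>)"
          by (rule Bochner_Integration.integral_cong) auto
        then show "(LINT \<omega>|M. (if J (S \<omega>) = j then 1 else 0 :: real)) = prob {\<omega> \<in> space M. J (S \<omega>) = j}"
          by (simp add: Int_def conj_commute)
      qed
      have pj: "summable (\<lambda>j. prob {\<omega> \<in> space M. J (S \<omega>) = j})"
      proof -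
        have "(\<lambda>j. prob {\<omega> \<in> space M. J (S \<omega>) = j}) sums prob (\<Union>j. {\<omega> \<in> space M. J (S \<omega>) = j})"
          by (rule finite_measure_UNION) (auto simp: disjoint_family_on_def)
        then show ?thesis by (rule sums_summable)
      qed
      have S2: "summable (\<lambda>j. LINT \<omega>|M. norm (i j (S \<omega>) * h j \<omega>))"
      proof (rule summable_comparison_test'[OF pj])
        fix j
        have "(LINT \<omega>|M. norm (i j (S \<omega>) * h j \<omega>)) \<le> (LINT \<omega>|M. (if J (S \<omega>) = j then 1 else 0 :: real))"
        proof (rule integral_mono[OF integrable_norm[OF I]])
          show "integrable M (\<lambda>\<omega>. (if J (S \<omega>) = j then 1 else 0 :: real))"
            by (rule integrable_const_bound[where B = 1]) auto
        qed (auto simp: i_def h1)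
        also have "\<dots> = prob {\<omega> \<in> space M. J (S \<omega>) = j}" using fun_cong[OF Ji, of j] .
        finally show "norm (LINT \<omega>|M. norm (i j (S \<omega>) * h j \<omega>)) \<le> prob {\<omega> \<in> space M. J (S \<omega>) = j}"
          by simp
      qed
      have sE: "(\<Sum>j. i j (S \<omega>) * h j \<omega>) = h (J (S \<omega>)) \<omega>" for \<omega>
      proof -
        have "(\<lambda>j. i j (S \<omega>) * h j \<omega>) = (\<lambda>j. if j = J (S \<omega>) then h j \<omega> else 0)"
          by (auto simp: i_def)
        then show ?thesis using sums_unique[OF sums_single[of "J (S \<omega>)" "\<lambda>j. h j \<omega>"]] by simp
      qed
      show ?thesis using sums_integral[OF I S1 S2] unfolding sE .
    qed
    have A: "(\<lambda>j. LINT \<omega>|M. i j (S \<omega>) * f (X (tt j) \<omega>)) sums (LINT \<omega>|M. f (X (tt (J (S \<omega>))) \<omega>))"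
    proof (rule split[of "\<lambda>j \<omega>. f (X (tt j) \<omega>)"])
      show "(\<lambda>\<omega>. f (X (tt j) \<omega>)) \<in> borel_measurable M" for j using Xm[OF tt0, of j] by measurable
      show "norm (f (X (tt j) \<omega>)) \<le> 1" if "\<omega> \<in> space M" for j \<omega> by (rule f(2)[OF that tt0])
    qed
    have B: "(\<lambda>j. LINT \<omega>|M. i j (S \<omega>) * of_real (exp (- (tt j * \<psi>)))) sums (LINT \<omega>|M. of_real (exp (- (tt (J (S \<omega>)) * \<psi>))))"
      by (rule split[of "\<lambda>j \<omega>. of_real (exp (- (tt j * \<psi>)))"]) (use tt0 \<psi> in auto)
    have "(LINT \<omega>|M. i j (S \<omega>) * f (X (tt j) \<omega>)) = (LINT \<omega>|M. i j (S \<omega>) * of_real (exp (- (tt j * \<psi>))))" for j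
    proof -
      have iv: "indep_var borel (\<lambda>\<omega>. i j (S \<omega>)) borel (\<lambda>\<omega>. f (X (tt j) \<omega>))"
        using indep_var_compose[OF ind[OF tt0[of j]] im[of j] fm] by (simp add: o_def)
      have m1: "(\<lambda>\<omega>. f (X (tt j) \<omega>)) \<in> borel_measurable M" using Xm[OF tt0, of j] by measurable
      have "(LINT \<omega>|M. i j (S \<omega>) * f (X (tt j) \<omega>)) = (LINT \<omega>|M. i j (S \<omega>)) * (LINT \<omega>|M. f (X (tt j) \<omega>))"
      proof (rule indep_var_lebesgue_integral[OF iv])
        show "integrable M (\<lambda>\<omega>. i j (S \<omega>))" by (rule integrable_const_bound[where B = 1]) (auto simp: i_def)
        show "integrable M (\<lambda>\<omega>. f (X (tt j) \<omega>))"
          by (rule integrable_const_bound[where B = 1, OF _ m1]) (auto intro!: AE_I2 f(2) tt0)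
      qed
      then show ?thesis by (simp add: E[OF tt0])
    qed
    then show ?thesis unfolding gJ using A B by (simp add: sums_iff)
  qed
  have L1: "(\<lambda>n. LINT \<omega>|M. f (X (grid n (S \<omega>)) \<omega>)) \<longlonglongrightarrow> (LINT \<omega>|M. f (X (S \<omega>) \<omega>))"
  proof (rule integral_dominated_convergence[where w = "\<lambda>_. 1"])
    show "AE \<omega> in M. (\<lambda>n. f (X (grid n (S \<omega>)) \<omega>)) \<longlonglongrightarrow> f (X (S \<omega>) \<omega>)"
    proof (rule AE_I2)
      fix \<omega> assume w: "\<omega> \<in> space M"
      have "isCont f (X (S \<omega>) \<omega>)" using f(1) by (simp add: continuous_on_eq_continuous_at)
      then show "(\<lambda>n. f (X (grid n (S \<omega>)) \<omega>)) \<longlonglongrightarrow> f (X (S \<omega>) \<omega>)"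
        by (rule isCont_tendsto_compose)
           (rule grid_compose_tendsto[where X = "\<lambda>s. X s \<omega>"], use w S0 rc in auto)
    qed
    show "AE \<omega> in M. norm (f (X (grid n (S \<omega>)) \<omega>)) \<le> 1" for n by (auto intro!: AE_I2 f(2) grid0)
  qed auto
  have L2: "(\<lambda>n. LINT \<omega>|M. complex_of_real (exp (- (grid n (S \<omega>) * \<psi>)))) \<longlonglongrightarrow> (LINT \<omega>|M. of_real (exp (- (S \<omega> * \<psi>))))"
  proof (rule integral_dominated_convergence[where w = "\<lambda>_. 1"])
    show "AE \<omega> in M. (\<lambda>n. complex_of_real (exp (- (grid n (S \<omega>) * \<psi>)))) \<longlonglongrightarrow> of_real (exp (- (S \<omega> * \<psi>)))"
    proof (rule AE_I2)
      fix \<omega> assume w: "\<omega> \<in> space M"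
      have "(\<lambda>n. grid n (S \<omega>)) \<longlonglongrightarrow> S \<omega>"
        by (rule grid_compose_tendsto[where X = "\<lambda>s. s"]) (use S0[OF w] in auto)
      then show "(\<lambda>n. complex_of_real (exp (- (grid n (S \<omega>) * \<psi>)))) \<longlonglongrightarrow> of_real (exp (- (S \<omega> * \<psi>)))"
        by (intro tendsto_intros)
    qed
    show "AE \<omega> in M. norm (complex_of_real (exp (- (grid n (S \<omega>) * \<psi>)))) \<le> 1" for n
      using \<psi> grid0 by (auto intro!: AE_I2 mult_nonneg_nonneg)
  qed auto
  have "(LINT \<omega>|M. f (X (S \<omega>) \<omega>)) = (LINT \<omega>|M. of_real (exp (- (S \<omega> * \<psi>))))"
    using L1 L2 unfolding step by (rule LIMSEQ_unique)
  then show ?thesis by simp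
qed

text \<open>The sigma-algebra generated by the paths of the processes with index in \<open>A\<close>. Measurability
  with respect to it expresses that a random variable is a functional of these processes alone,
  which is how the independence of composed quantities is obtained.\<close>

definition path_algebra :: "'w measure \<Rightarrow> (real \<Rightarrow> 'w \<Rightarrow> real) list \<Rightarrow> nat set \<Rightarrow> 'w measure" where
  "path_algebra M Xs A = vimage_algebra (space M)
     (\<lambda>\<omega>. \<lambda>i\<in>A. \<lambda>t\<in>{0..}. (Xs ! i) t \<omega>) (PiM A (\<lambda>_. PiM {0..} (\<lambda>_. borel)))"

lemma space_path_algebra[simp]: "space (path_algebra M Xs A) = space M"
  by (simp add: path_algebra_def)

lemma measurable_path_algebra:
  assumes "i \<in> A" "0 \<le> t"
  shows "(Xs ! i) t \<in> borel_measurable (path_algebra M Xs A)"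
proof -
  let ?Y = "\<lambda>\<omega>. \<lambda>i\<in>A. \<lambda>t\<in>{0..}. (Xs ! i) t \<omega>" and ?N = "PiM A (\<lambda>_. PiM {0..} (\<lambda>_. borel))"
  have Y: "?Y \<in> path_algebra M Xs A \<rightarrow>\<^sub>M ?N"
    unfolding path_algebra_def by (rule measurable_vimage_algebra1) (auto simp: space_PiM)
  have "(\<lambda>x. x i) \<in> ?N \<rightarrow>\<^sub>M PiM {0..} (\<lambda>_. borel)" using assms by measurable
  moreover have "(\<lambda>x. x t) \<in> PiM {0..} (\<lambda>_. borel) \<rightarrow>\<^sub>M borel"
    by (rule measurable_component_singleton) (use assms in simp)
  ultimately have "(\<lambda>x. x i t) \<in> ?N \<rightarrow>\<^sub>M (borel :: real measure)" by (rule measurable_compose)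
  from measurable_compose[OF Y this] show ?thesis using assms by simp
qed

text \<open>Disjoint groups of independent processes are independent, and so are the functionals of each
  group.\<close>

lemma (in prob_space) indep_var_path_algebra:
  fixes U V :: "'a \<Rightarrow> real"
  assumes ind: "independent_processes M Xs" and AB: "A \<inter> B = {}" "A \<subseteq> {..<length Xs}" "B \<subseteq> {..<length Xs}"
    and U: "U \<in> borel_measurable (path_algebra M Xs A)" and V: "V \<in> borel_measurable (path_algebra M Xs B)"
  shows "indep_var borel U borel V"
proof -
  let ?Y = "\<lambda>A \<omega>. \<lambda>i\<in>A. \<lambda>t\<in>{0..}. (Xs ! i) t \<omega>" and ?N = "\<lambda>A. PiM A (\<lambda>_. PiM {0..} (\<lambda>_. borel)) :: (nat \<Rightarrow> real \<Rightarrow> real) measure"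
  have i: "indep_var (?N A) (?Y A) (?N B) (?Y B)"
    by (rule indep_var_restrict[OF _ AB]) (use ind in \<open>simp add: independent_processes_def\<close>)
  have sp: "?Y C \<in> space M \<rightarrow> space (?N C)" for C by (auto simp: space_PiM)
  have sub: "sets (path_algebra M Xs C) \<subseteq> sets M" if "random_variable (?N C) (?Y C)" for C
    unfolding path_algebra_def sets_vimage_algebra2[OF sp] using that by (auto simp: measurable_sets)
  have Um: "U \<in> borel_measurable M"
    using U sub[OF indep_var_rv1[OF i]] by (auto simp: measurable_def)
  have Vm: "V \<in> borel_measurable M"
    using V sub[OF indep_var_rv2[OF i]] by (auto simp: measurable_def)
  have g: "sigma_sets (space M) {Z -` E \<inter> space M |E. E \<in> sets borel} \<subseteq>
      sigma_sets (space M) {?Y C -` E \<inter> space M |E. E \<in> sets (?N C)}"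
    if "Z \<in> borel_measurable (path_algebra M Xs C)" for Z :: "'a \<Rightarrow> real" and C
  proof (rule sigma_sets_subseteq, safe)
    fix E :: "real set" assume "E \<in> sets borel"
    then have "Z -` E \<inter> space M \<in> sets (path_algebra M Xs C)"
      using measurable_sets[OF that] by simp
    then show "\<exists>E'. Z -` E \<inter> space M = ?Y C -` E' \<inter> space M \<and> E' \<in> sets (?N C)"
      unfolding path_algebra_def sets_vimage_algebra2[OF sp] by auto
  qed
  have "indep_set (sigma_sets (space M) {U -` E \<inter> space M |E. E \<in> sets borel})
     (sigma_sets (space M) {V -` E \<inter> space M |E. E \<in> sets borel})"
    using i g[OF U] g[OF V] unfolding indep_var_eq indep_sets2_eq by blast
  then show ?thesis unfolding indep_var_eq using Um Vm by simp
qed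

section \<open>First passage times of a subordinator\<close>

text \<open>If the level \<open>t\<close> is never reached, the value is 0 as for \<open>inverse_process\<close>.\<close>

definition first_passage :: "(real \<Rightarrow> 'w \<Rightarrow> real) \<Rightarrow> real \<Rightarrow> 'w \<Rightarrow> real" where
  "first_passage H t \<omega> = (let S = {s. 0 \<le> s \<and> t \<le> H s \<omega>} in if S = {} then 0 else Inf S)"

text \<open>Right-continuity makes the path reach the level at the infimum itself. Events about the
  first passage thus become events about \<open>H\<close> at a fixed time.\<close>

lemma first_passage_le_iff:
  assumes mono: "mono_on {0..} (\<lambda>s. H s \<omega>)" and rc: "\<And>s. 0 \<le> s \<Longrightarrow> continuous (at_right s) (\<lambda>s. H s \<omega>)"
    and ne: "\<exists>s\<ge>0. t \<le> H s \<omega>" and a: "0 \<le> a"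
  shows "first_passage H t \<omega> \<le> a \<longleftrightarrow> t \<le> H a \<omega>"
proof -
  define S where "S = {s. 0 \<le> s \<and> t \<le> H s \<omega>}"
  have Sne: "S \<noteq> {}" using ne by (auto simp: S_def)
  have bdd: "bdd_below S" by (auto simp: S_def intro!: bdd_belowI[of _ 0])
  have L: "first_passage H t \<omega> = Inf S" using Sne by (simp add: first_passage_def S_def[symmetric])
  have I0: "0 \<le> Inf S" by (rule cInf_greatest[OF Sne]) (auto simp: S_def)
  show ?thesis
  proof
    assume "t \<le> H a \<omega>"
    then show "first_passage H t \<omega> \<le> a" unfolding L using a bdd by (auto intro!: cInf_lower simp: S_def)
  next
    assume le: "first_passage H t \<omega> \<le> a"
    have up: "t \<le> H x \<omega>" if lt: "Inf S < x" for x
    proof -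
      obtain s where "s \<in> S" "s < x" using cInf_lessD[OF Sne lt] by auto
      then show ?thesis using mono_onD[OF mono, of s x] by (auto simp: S_def)
    qed
    have "(\<lambda>n. H (grid n (Inf S)) \<omega>) \<longlonglongrightarrow> H (Inf S) \<omega>"
      by (rule grid_compose_tendsto[where X = "\<lambda>s. H s \<omega>", OF I0 rc[OF I0]])
    then have "t \<le> H (Inf S) \<omega>"
      by (rule LIMSEQ_le_const) (auto intro!: up grid_bounds I0)
    also have "H (Inf S) \<omega> \<le> H a \<omega>" using mono_onD[OF mono, of "Inf S" a] I0 le L by auto
    finally show "t \<le> H a \<omega>" .
  qed
qed

lemma first_passage_nonneg: "0 \<le> first_passage H t \<omega>"
  unfolding first_passage_def Let_def by (auto intro!: cInf_greatest)

text \<open>For \<open>a \<ge> 0\<close> the event \<open>first_passage H t \<omega> \<le> a\<close> consists of the paths that have reached the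
  level by time \<open>a\<close>, and of those that never reach it, where the default value is taken. By
  monotonicity the latter are detected along the natural numbers.\<close>

lemma measurable_first_passage:
  assumes H: "\<And>s. 0 \<le> s \<Longrightarrow> H s \<in> borel_measurable F"
    and mono: "\<And>\<omega>. \<omega> \<in> space F \<Longrightarrow> mono_on {0..} (\<lambda>s. H s \<omega>)"
    and rc: "\<And>\<omega> s. \<omega> \<in> space F \<Longrightarrow> 0 \<le> s \<Longrightarrow> continuous (at_right s) (\<lambda>s. H s \<omega>)"
  shows "first_passage H t \<in> borel_measurable F"
  unfolding borel_measurable_iff_le
proof
  fix a
  show "{\<omega> \<in> space F. first_passage H t \<omega> \<le> a} \<in> sets F"
  proof (cases "0 \<le> a")
    case False
    then have "{\<omega> \<in> space F. first_passage H t \<omega> \<le> a} = {}"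
      using first_passage_nonneg[of H t] by (auto simp: not_le intro: less_le_trans)
    then show ?thesis by (simp only: sets.empty_sets)
  next
    case True
    have em: "(\<exists>s\<ge>0. t \<le> H s \<omega>) \<longleftrightarrow> (\<exists>n::nat. t \<le> H (real n) \<omega>)" if "\<omega> \<in> space F" for \<omega>
    proof safe
      fix s :: real assume s: "0 \<le> s" "t \<le> H s \<omega>"
      obtain n :: nat where "s \<le> real n" using real_arch_simple by blast
      then show "\<exists>n. t \<le> H (real n) \<omega>" using mono_onD[OF mono[OF that], of s "real n"] s by (auto intro!: exI[of _ n])
    next
      fix n assume "t \<le> H (real n) \<omega>"
      then show "\<exists>s\<ge>0. t \<le> H s \<omega>" by (intro exI[of _ "real n"]) auto
    qed
    have "{\<omega> \<in> space F. first_passage H t \<omega> \<le> a} =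
      {\<omega> \<in> space F. t \<le> H a \<omega>} \<union> {\<omega> \<in> space F. \<forall>n::nat. H (real n) \<omega> < t}"
    proof (intro set_eqI iffI)
      fix \<omega> assume w: "\<omega> \<in> {\<omega> \<in> space F. first_passage H t \<omega> \<le> a}"
      show "\<omega> \<in> {\<omega> \<in> space F. t \<le> H a \<omega>} \<union> {\<omega> \<in> space F. \<forall>n::nat. H (real n) \<omega> < t}"
      proof (cases "\<exists>s\<ge>0. t \<le> H s \<omega>")
        case T: True
        then show ?thesis using first_passage_le_iff[of H \<omega> t a] w mono rc True by auto
      next
        case False
        then have "\<forall>n::nat. H (real n) \<omega> < t" by (metis not_le of_nat_0_le_iff)
        then show ?thesis using w by auto
      qed
    next
      fix \<omega> assume w: "\<omega> \<in> {\<omega> \<in> space F. t \<le> H a \<omega>} \<union> {\<omega> \<in> space F. \<forall>n::nat. H (real n) \<omega> < t}"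
      show "\<omega> \<in> {\<omega> \<in> space F. first_passage H t \<omega> \<le> a}"
      proof (cases "\<exists>s\<ge>0. t \<le> H s \<omega>")
        case T: True
        have ws: "\<omega> \<in> space F" using w by auto
        then obtain n :: nat where "t \<le> H (real n) \<omega>" using T em[OF ws] by blast
        then have "t \<le> H a \<omega>" using w by (auto simp: not_le[symmetric])
        then show ?thesis using first_passage_le_iff[of H \<omega> t a] w mono rc True T by auto
      next
        case False
        then have "{s. 0 \<le> s \<and> t \<le> H s \<omega>} = {}" by auto
        then have "first_passage H t \<omega> = 0" by (simp add: first_passage_def)
        then show ?thesis using w True by auto
      qed
    qed
    moreover have "{\<omega> \<in> space F. t \<le> H a \<omega>} \<in> sets F" using H[OF True] by measurable
    moreover have "{\<omega> \<in> space F. \<forall>n::nat. H (real n) \<omega> < t} \<in> sets F"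
    proof -
      have [measurable]: "H (real n) \<in> borel_measurable F" for n by (rule H) simp
      show ?thesis by measurable
    qed
    ultimately show ?thesis by simp
  qed
qed

lemma nn_integral_exp_tail:
  fixes a p :: real
  assumes "0 < p"
  shows "(\<integral>\<^sup>+t. ennreal (exp (- (p * t))) * indicator {a..} t \<partial>lborel) = ennreal (exp (- (p * a)) / p)"
proof -
  have "(\<integral>\<^sup>+t. ennreal (exp (- (p * t))) * indicator {a..} t \<partial>lborel) = ennreal (0 - (- (exp (- (p * a)) / p)))"
  proof (rule nn_integral_FTC_atLeast)
    show "((\<lambda>t. - (exp (- (p * t)) / p)) \<longlongrightarrow> 0) at_top" using assms by real_asymp
  qed (use assms in \<open>auto intro!: derivative_eq_intros\<close>)
  then show ?thesis by simp
qed

lemma nn_integral_exp_upto: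
  fixes l th :: real
  assumes "0 \<le> l" "0 \<le> th"
  shows "(\<integral>\<^sup>+s. ennreal (th * exp (- (th * s))) * indicator {0..<l} s \<partial>lborel) = ennreal (1 - exp (- (th * l)))"
proof -
  have "(\<integral>\<^sup>+s. ennreal (th * exp (- (th * s))) * indicator {0..<l} s \<partial>lborel) =
     (\<integral>\<^sup>+s. ennreal (th * exp (- (th * s))) * indicator {0..l} s \<partial>lborel)"
    by (rule nn_integral_cong_AE) (use AE_lborel_singleton[of l] in \<open>eventually_elim, auto simp: indicator_def\<close>)
  also have "\<dots> = ennreal (- exp (- (th * l)) - (- exp (- (th * 0))))"
    by (rule nn_integral_FTC_Icc) (use assms in \<open>auto intro!: derivative_eq_intros\<close>)
  finally show ?thesis by simp
qed

text \<open>The law of a first passage time depends on \<open>H\<close> only through its one-dimensional marginals,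
  which are encoded here by the Laplace exponent \<open>\<Phi>\<close>.\<close>

locale subordinator_passage = prob_space M for M :: "'w measure" +
  fixes H :: "real \<Rightarrow> 'w \<Rightarrow> real" and \<Phi> :: "real \<Rightarrow> real"
  assumes H_meas: "\<And>s. 0 \<le> s \<Longrightarrow> H s \<in> borel_measurable M"
    and H_mono: "\<And>\<omega>. \<omega> \<in> space M \<Longrightarrow> mono_on {0..} (\<lambda>s. H s \<omega>)"
    and H_rc: "\<And>\<omega> s. \<omega> \<in> space M \<Longrightarrow> 0 \<le> s \<Longrightarrow> continuous (at_right s) (\<lambda>s. H s \<omega>)"
    and H_0: "\<And>\<omega>. \<omega> \<in> space M \<Longrightarrow> H 0 \<omega> = 0"
    and H_laplace: "\<And>s p. 0 \<le> s \<Longrightarrow> 0 < p \<Longrightarrow> (LINT \<omega>|M. exp (- (p * H s \<omega>))) = exp (- (s * \<Phi> p))"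
    and \<Phi>_pos: "\<And>p. 0 < p \<Longrightarrow> 0 < \<Phi> p"
begin

abbreviation "L \<equiv> first_passage H"

lemma L_meas[measurable]: "L t \<in> borel_measurable M"
  by (rule measurable_first_passage) (use H_meas H_mono H_rc in auto)

lemma H_nonneg: "\<omega> \<in> space M \<Longrightarrow> 0 \<le> s \<Longrightarrow> 0 \<le> H s \<omega>"
  using mono_onD[OF H_mono, of \<omega> 0 s] H_0 by auto

text \<open>Markov's inequality for \<open>exp (- H n)\<close>: the level \<open>t\<close> is not reached by time \<open>n\<close> with
  probability at most \<open>exp (t - n * \<Phi> 1)\<close>.\<close>

lemma AE_passage: "AE \<omega> in M. \<exists>s\<ge>0. t \<le> H s \<omega>"
proof -
  have [measurable]: "H (real n) \<in> borel_measurable M" for n by (rule H_meas) simp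
  define N where "N = {\<omega> \<in> space M. \<forall>n::nat. H (real n) \<omega> < t}"
  have Nm[measurable]: "N \<in> sets M" unfolding N_def by measurable
  have "prob N \<le> exp t * exp (- (real n * \<Phi> 1))" for n
  proof -
    have "prob N = (LINT \<omega>|M. indicator N \<omega>)" by simp
    also have "\<dots> \<le> (LINT \<omega>|M. exp t * exp (- (1 * H (real n) \<omega>)))"
    proof (rule integral_mono)
      show "integrable M (\<lambda>\<omega>. exp t * exp (- (1 * H (real n) \<omega>)))"
        by (rule integrable_mult_right, rule integrable_const_bound[where B = 1])
          (auto intro!: AE_I2 H_nonneg)
      fix \<omega> assume w: "\<omega> \<in> space M"
      show "indicator N \<omega> \<le> exp t * exp (- (1 * H (real n) \<omega>))"
      proof (cases "\<omega> \<in> N")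
        case True
        then have "H (real n) \<omega> < t" by (auto simp: N_def)
        then show ?thesis using True by (simp add: exp_add[symmetric])
      qed simp
    qed (auto intro: integrable_const_bound[where B = 1])
    also have "\<dots> = exp t * exp (- (real n * \<Phi> 1))"
      using H_laplace[of "real n" 1] by simp
    finally show ?thesis .
  qed
  moreover have "(\<lambda>n. exp t * exp (- (real n * \<Phi> 1))) \<longlonglongrightarrow> 0"
    using \<Phi>_pos[of 1] by real_asymp
  ultimately have "prob N \<le> 0" using LIMSEQ_le_const by blast
  then have "prob N = 0" using measure_nonneg[of M N] by simp
  then have "N \<in> null_sets M" by (intro null_setsI) (auto simp: emeasure_eq_measure)
  then have "AE \<omega> in M. \<omega> \<notin> N" by (rule AE_not_in)
  then show ?thesis using AE_space
  proof eventually_elim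
    case (elim \<omega>)
    then obtain n :: nat where "t \<le> H (real n) \<omega>" by (auto simp: N_def not_less)
    then show ?case by (intro exI[of _ "real n"]) auto
  qed
qed

lemma L_less_iff:
  assumes "\<omega> \<in> space M" "\<exists>s\<ge>0. t \<le> H s \<omega>" "0 \<le> s"
  shows "s < L t \<omega> \<longleftrightarrow> H s \<omega> < t"
  using first_passage_le_iff[of H \<omega> t s] assms H_mono H_rc by (auto simp: not_le[symmetric])

lemma AE_L_pos: "0 < t \<Longrightarrow> AE \<omega> in M. 0 < L t \<omega>"
  using AE_passage[of t] AE_space by eventually_elim (simp add: L_less_iff H_0)

lemma AE_L_mono: "s \<le> t \<Longrightarrow> AE \<omega> in M. L s \<omega> \<le> L t \<omega>"
  using AE_passage[of t] AE_passage[of s] AE_space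
proof eventually_elim
  case (elim \<omega>)
  have "t \<le> H (L t \<omega>) \<omega>"
    using first_passage_le_iff[of H \<omega> t "L t \<omega>"] first_passage_nonneg[of H t \<omega>] elim H_mono H_rc by auto
  then show ?case
    using first_passage_le_iff[of H \<omega> s "L t \<omega>"] first_passage_nonneg[of H t \<omega>] elim H_mono H_rc by auto
qed

definition G :: "real \<Rightarrow> real \<Rightarrow> real" where "G th t = (LINT \<omega>|M. exp (- (th * L t \<omega>)))"

lemma integrable_exp_L: "0 \<le> th \<Longrightarrow> integrable M (\<lambda>\<omega>. exp (- (th * L t \<omega>)))"
  by (rule integrable_const_bound[where B = 1]) (auto intro!: AE_I2 mult_nonneg_nonneg first_passage_nonneg)

lemma G_bounds: assumes "0 \<le> th" shows "0 \<le> G th t" "G th t \<le> 1"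
proof -
  show "0 \<le> G th t" unfolding G_def by (rule Bochner_Integration.integral_nonneg) simp
  have "G th t \<le> (LINT \<omega>|M. 1)" unfolding G_def
    by (rule integral_mono) (use assms in \<open>auto intro!: integrable_exp_L mult_nonneg_nonneg first_passage_nonneg\<close>)
  then show "G th t \<le> 1" by (simp add: prob_space)
qed

lemma G_antimono: assumes "0 \<le> th" "s \<le> t" shows "G th t \<le> G th s"
  unfolding G_def
proof (rule integral_mono_AE)
  show "AE \<omega> in M. exp (- (th * L t \<omega>)) \<le> exp (- (th * L s \<omega>))"
    using AE_L_mono[OF assms(2)] by eventually_elim (use assms in \<open>simp add: mult_left_mono\<close>)
qed (use assms integrable_exp_L in auto)

lemma G_meas[measurable]: assumes "0 \<le> th" shows "G th \<in> borel_measurable borel"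
proof -
  have "mono (\<lambda>t. - G th t)" by (rule monoI) (use G_antimono[OF assms] in auto)
  then have "(\<lambda>t. - G th t) \<in> borel_measurable borel" by (rule borel_measurable_mono)
  then show ?thesis by simp
qed

text \<open>Negative times are replaced by 0, since \<open>H\<close> is controlled only for nonnegative ones.\<close>

lemma H_joint[measurable]: "(\<lambda>(s, \<omega>). H (max 0 s) \<omega>) \<in> borel_measurable (lborel \<Otimes>\<^sub>M M)"
proof -
  have "(\<lambda>x. (\<lambda>t x. H t (snd x)) (max 0 (fst x)) x) \<in> borel_measurable (lborel \<Otimes>\<^sub>M M)"
  proof (rule measurable_random_time[where X = "\<lambda>t x. H t (snd x)" and S = "\<lambda>x. max 0 (fst x)"])
    fix t :: real assume "0 \<le> t"
    then have [measurable]: "H t \<in> borel_measurable M" by (rule H_meas)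
    show "(\<lambda>x. H t (snd x)) \<in> borel_measurable (lborel \<Otimes>\<^sub>M M)" by measurable
  qed (use H_rc in \<open>auto simp: space_pair_measure\<close>)
  then show ?thesis by (simp add: case_prod_beta')
qed

text \<open>The number \<open>1 - exp (- th * L)\<close> is the integral of \<open>th * exp (- th * s)\<close> over \<open>s < L\<close>, and
  \<open>s < L t\<close> means \<open>H s < t\<close>. This expresses the law of the first passage by the marginals of \<open>H\<close>.\<close>

lemma one_minus_G:
  assumes th: "0 \<le> th"
  shows "ennreal (1 - G th t) =
    (\<integral>\<^sup>+\<omega>. (\<integral>\<^sup>+s. ennreal (th * exp (- (th * s))) * (if 0 \<le> s \<and> H (max 0 s) \<omega> < t then 1 else 0) \<partial>lborel) \<partial>M)"
proof -
  have "(\<integral>\<^sup>+\<omega>. (\<integral>\<^sup>+s. ennreal (th * exp (- (th * s))) * (if 0 \<le> s \<and> H (max 0 s) \<omega> < t then 1 else 0) \<partial>lborel) \<partial>M)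
     = (\<integral>\<^sup>+\<omega>. ennreal (1 - exp (- (th * L t \<omega>))) \<partial>M)"
  proof (rule nn_integral_cong_AE)
    show "AE \<omega> in M. (\<integral>\<^sup>+s. ennreal (th * exp (- (th * s))) * (if 0 \<le> s \<and> H (max 0 s) \<omega> < t then 1 else 0) \<partial>lborel) =
      ennreal (1 - exp (- (th * L t \<omega>)))"
      using AE_passage[of t] AE_space
    proof eventually_elim
      case (elim \<omega>)
      have "(if 0 \<le> s \<and> H (max 0 s) \<omega> < t then 1 else 0 :: ennreal) = indicator {0..<L t \<omega>} s" for s
        using L_less_iff[of \<omega> t s] elim by (auto simp: indicator_def max_def)
      then show ?case using nn_integral_exp_upto[OF first_passage_nonneg th] by simp
    qed
  qed
  also have "\<dots> = ennreal (LINT \<omega>|M. 1 - exp (- (th * L t \<omega>)))"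
    by (rule nn_integral_eq_integral)
       (auto intro!: Bochner_Integration.integrable_diff integrable_exp_L th mult_nonneg_nonneg first_passage_nonneg)
  also have "(LINT \<omega>|M. 1 - exp (- (th * L t \<omega>))) = 1 - G th t"
    unfolding G_def by (subst Bochner_Integration.integral_diff) (auto intro: integrable_exp_L th simp: prob_space)
  finally show ?thesis by simp
qed

text \<open>Tonelli's theorem for the triple integral in \<open>t\<close>, \<open>\<omega>\<close> and \<open>s\<close>. The integral over \<open>t > H s\<close>
  gives \<open>exp (- p * H s) / p\<close>, the expectation of this is \<open>exp (- s * \<Phi> p) / p\<close>, and an
  exponential integral in \<open>s\<close> is left.\<close>

lemma nn_laplace_one_minus_G:
  assumes th: "0 \<le> th" and p: "0 < p"
  shows "(\<integral>\<^sup>+t. ennreal (indicator {0<..} t * (exp (- (p * t)) * (1 - G th t))) \<partial>lborel) = ennreal (th / (p * (th + \<Phi> p)))"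
proof -
  interpret P: pair_sigma_finite lborel M ..
  define Hj where "Hj = (\<lambda>x. H (max 0 (fst x)) (snd x))"
  have HH: "H (max 0 s) \<omega> = Hj (s, \<omega>)" for s \<omega> by (simp add: Hj_def)
  have "Hj \<in> borel_measurable (lborel \<Otimes>\<^sub>M M)" using H_joint by (simp add: Hj_def case_prod_beta')
  then have [measurable]: "Hj \<in> borel_measurable (borel \<Otimes>\<^sub>M M)"
    by (simp add: measurable_def space_pair_measure sets_pair_measure_cong[OF sets_lborel refl])
  define K where "K = (\<lambda>t s \<omega>. ennreal (exp (- (p * t))) * (if 0 < t then 1 else 0) *
      (ennreal (th * exp (- (th * s))) * (if 0 \<le> s \<and> Hj (s, \<omega>) < t then 1 else 0)))"
  have "(\<integral>\<^sup>+t. ennreal (indicator {0<..} t * (exp (- (p * t)) * (1 - G th t))) \<partial>lborel) =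
      (\<integral>\<^sup>+t. ennreal (exp (- (p * t))) * (if 0 < t then 1 else 0) * ennreal (1 - G th t) \<partial>lborel)"
    by (rule nn_integral_cong) (use G_bounds[OF th] in \<open>auto simp: indicator_def ennreal_mult\<close>)
  also have "\<dots> = (\<integral>\<^sup>+t. (\<integral>\<^sup>+\<omega>. (\<integral>\<^sup>+s. K t s \<omega> \<partial>lborel) \<partial>M) \<partial>lborel)"
  proof (rule nn_integral_cong)
    fix t :: real
    let ?c = "ennreal (exp (- (p * t))) * (if 0 < t then 1 else 0)"
    let ?k = "\<lambda>\<omega> s. ennreal (th * exp (- (th * s))) * (if 0 \<le> s \<and> Hj (s, \<omega>) < t then 1 else 0)"
    have m1: "(\<lambda>\<omega>. \<integral>\<^sup>+s. ?k \<omega> s \<partial>lborel) \<in> borel_measurable M" by measurable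
    have m2: "?k \<omega> \<in> borel_measurable lborel" if [measurable]: "\<omega> \<in> space M" for \<omega> by measurable
    have "(\<integral>\<^sup>+\<omega>. (\<integral>\<^sup>+s. K t s \<omega> \<partial>lborel) \<partial>M) = (\<integral>\<^sup>+\<omega>. ?c * (\<integral>\<^sup>+s. ?k \<omega> s \<partial>lborel) \<partial>M)"
      unfolding K_def by (rule nn_integral_cong) (rule nn_integral_cmult[OF m2])
    also have "\<dots> = ?c * (\<integral>\<^sup>+\<omega>. (\<integral>\<^sup>+s. ?k \<omega> s \<partial>lborel) \<partial>M)"
      by (rule nn_integral_cmult[OF m1])
    finally show "?c * ennreal (1 - G th t) = (\<integral>\<^sup>+\<omega>. (\<integral>\<^sup>+s. K t s \<omega> \<partial>lborel) \<partial>M)"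
      unfolding one_minus_G[OF th] HH by simp
  qed
  also have "\<dots> = (\<integral>\<^sup>+\<omega>. (\<integral>\<^sup>+t. (\<integral>\<^sup>+s. K t s \<omega> \<partial>lborel) \<partial>lborel) \<partial>M)"
    by (rule P.Fubini'[symmetric]) (unfold K_def, measurable)
  also have "\<dots> = (\<integral>\<^sup>+\<omega>. (\<integral>\<^sup>+s. (\<integral>\<^sup>+t. K t s \<omega> \<partial>lborel) \<partial>lborel) \<partial>M)"
  proof (rule nn_integral_cong)
    fix \<omega> assume w[measurable]: "\<omega> \<in> space M"
    show "(\<integral>\<^sup>+t. (\<integral>\<^sup>+s. K t s \<omega> \<partial>lborel) \<partial>lborel) = (\<integral>\<^sup>+s. (\<integral>\<^sup>+t. K t s \<omega> \<partial>lborel) \<partial>lborel)"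
      by (rule lborel_pair.Fubini'[symmetric]) (unfold K_def, measurable)
  qed
  also have "\<dots> = (\<integral>\<^sup>+\<omega>. (\<integral>\<^sup>+s. ennreal (th / p * exp (- (th * s)) * indicator {0..} s) * ennreal (exp (- (p * Hj (s, \<omega>)))) \<partial>lborel) \<partial>M)"
  proof (intro nn_integral_cong)
    fix \<omega> and s :: real assume w: "\<omega> \<in> space M"
    let ?h = "Hj (s, \<omega>)"
    have h: "0 \<le> ?h" using H_nonneg[OF w] by (simp add: Hj_def)
    show "(\<integral>\<^sup>+t. K t s \<omega> \<partial>lborel) = ennreal (th / p * exp (- (th * s)) * indicator {0..} s) * ennreal (exp (- (p * ?h)))"
    proof (cases "0 \<le> s")
      case True
      have "(\<integral>\<^sup>+t. K t s \<omega> \<partial>lborel) = (\<integral>\<^sup>+t. ennreal (th * exp (- (th * s))) * (ennreal (exp (- (p * t))) * indicator {?h..} t) \<partial>lborel)"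
        by (rule nn_integral_cong_AE, use AE_lborel_singleton[of ?h] in eventually_elim)
           (use True h in \<open>auto simp: K_def indicator_def mult_ac\<close>)
      also have "\<dots> = ennreal (th * exp (- (th * s))) * ennreal (exp (- (p * ?h)) / p)"
        by (subst nn_integral_cmult) (simp_all add: nn_integral_exp_tail[OF p])
      finally show ?thesis using True th p by (simp add: ennreal_mult[symmetric] field_simps)
    qed (simp add: K_def)
  qed
  also have "\<dots> = (\<integral>\<^sup>+s. (\<integral>\<^sup>+\<omega>. ennreal (th / p * exp (- (th * s)) * indicator {0..} s) * ennreal (exp (- (p * Hj (s, \<omega>)))) \<partial>M) \<partial>lborel)"
    by (rule P.Fubini') measurable
  also have "\<dots> = (\<integral>\<^sup>+s. ennreal (th / p) * (ennreal (exp (- ((th + \<Phi> p) * s))) * indicator {0..} s) \<partial>lborel)"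
  proof (rule nn_integral_cong)
    fix s :: real
    have "(\<integral>\<^sup>+\<omega>. ennreal (exp (- (p * Hj (s, \<omega>)))) \<partial>M) = ennreal (LINT \<omega>|M. exp (- (p * Hj (s, \<omega>))))"
      by (rule nn_integral_eq_integral, rule integrable_const_bound[where B = 1])
         (use p in \<open>auto intro!: AE_I2 mult_nonneg_nonneg simp: H_nonneg HH[symmetric]\<close>)
    also have "\<dots> = ennreal (exp (- (max 0 s * \<Phi> p)))" using H_laplace[of "max 0 s" p] p by (simp add: Hj_def)
    finally have "(\<integral>\<^sup>+\<omega>. ennreal (th / p * exp (- (th * s)) * indicator {0..} s) * ennreal (exp (- (p * Hj (s, \<omega>)))) \<partial>M) =
       ennreal (th / p * exp (- (th * s)) * indicator {0..} s) * ennreal (exp (- (max 0 s * \<Phi> p)))"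
      by (subst nn_integral_cmult) simp_all
    also have "\<dots> = ennreal (th / p) * (ennreal (exp (- ((th + \<Phi> p) * s))) * indicator {0..} s)"
      using th p by (auto simp: indicator_def ennreal_mult[symmetric] exp_add[symmetric] algebra_simps max_def)
    finally show "(\<integral>\<^sup>+\<omega>. ennreal (th / p * exp (- (th * s)) * indicator {0..} s) * ennreal (exp (- (p * Hj (s, \<omega>)))) \<partial>M) =
       ennreal (th / p) * (ennreal (exp (- ((th + \<Phi> p) * s))) * indicator {0..} s)" .
  qed
  also have "\<dots> = ennreal (th / p) * ennreal (exp (- ((th + \<Phi> p) * 0)) / (th + \<Phi> p))"
    using th \<Phi>_pos[OF p] by (subst nn_integral_cmult) (simp_all add: nn_integral_exp_tail)
  also have "\<dots> = ennreal (th / (p * (th + \<Phi> p)))"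
    using th p \<Phi>_pos[OF p] by (simp add: ennreal_mult[symmetric])
  finally show ?thesis .
qed

lemma laplace_G:
  assumes th: "0 \<le> th" and p: "0 < p"
  shows "(LINT t|lborel. indicator {0<..} t * (exp (- (p * t)) * G th t)) = \<Phi> p / (p * (\<Phi> p + th))"
proof -
  have pp: "0 < th + \<Phi> p" using th \<Phi>_pos[OF p] by simp
  have [measurable]: "G th \<in> borel_measurable borel" by (rule G_meas[OF th])
  have A: "has_bochner_integral lborel (\<lambda>t. indicator {0<..} t * (exp (- (p * t)) * (1 - G th t))) (th / (p * (th + \<Phi> p)))"
    by (rule has_bochner_integral_nn_integral[OF _ _ _ nn_laplace_one_minus_G[OF th p]])
       (use G_bounds[OF th] th p pp in auto)
  note B = has_bochner_integral_exp[OF p]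
  have "(LINT t|lborel. indicator {0<..} t * (exp (- (p * t)) * G th t)) =
     (LINT t|lborel. indicator {0<..} t * exp (- (p * t)) - indicator {0<..} t * (exp (- (p * t)) * (1 - G th t)))"
    by (rule Bochner_Integration.integral_cong) (auto simp: algebra_simps)
  also have "\<dots> = 1 / p - th / (p * (th + \<Phi> p))"
    using A B by (subst Bochner_Integration.integral_diff) (auto simp: has_bochner_integral_iff)
  also have "\<dots> = \<Phi> p / (p * (\<Phi> p + th))" proof -
    have e: "1 / p = (th + \<Phi> p) / (p * (th + \<Phi> p))" using pp by simp
    show ?thesis unfolding e
      by (simp only: diff_divide_distrib[symmetric] add.commute[of th]) simp
  qed
  finally show ?thesis .
qed

end

section \<open>The time-changed Brownian motion\<close>

lemma integral_normal_density_iexp: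
  assumes s: "0 < \<sigma>"
  shows "(LINT x|lborel. normal_density m \<sigma> x *\<^sub>R iexp (\<xi> * x)) = iexp (\<xi> * m) * of_real (exp (- (\<sigma>\<^sup>2 * \<xi>\<^sup>2) / 2))"
proof -
  have std: "(LINT x|lborel. std_normal_density x *\<^sub>R iexp (y * x)) = of_real (exp (- (y\<^sup>2) / 2))" for y
  proof -
    have "of_real (exp (- (y\<^sup>2) / 2)) = char std_normal_distribution y" by (simp add: char_std_normal_distribution)
    also have "\<dots> = (LINT x|lborel. std_normal_density x *\<^sub>R iexp (y * x))"
      unfolding char_def by (rule integral_density) auto
    finally show ?thesis by simp
  qed
  have "(LINT x|lborel. normal_density m \<sigma> x *\<^sub>R iexp (\<xi> * x)) =
    \<bar>\<sigma>\<bar> *\<^sub>R (LINT x|lborel. normal_density m \<sigma> (m + \<sigma> * x) *\<^sub>R iexp (\<xi> * (m + \<sigma> * x)))"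
    by (rule lborel_integral_real_affine) (use s in simp)
  also have "(\<lambda>x. normal_density m \<sigma> (m + \<sigma> * x) *\<^sub>R iexp (\<xi> * (m + \<sigma> * x))) =
     (\<lambda>x. (iexp (\<xi> * m) / of_real \<sigma>) * (std_normal_density x *\<^sub>R iexp ((\<xi> * \<sigma>) * x)))"
  proof
    fix x
    have "normal_density m \<sigma> (m + \<sigma> * x) = std_normal_density x / \<sigma>"
      using s by (simp add: normal_density_def real_sqrt_mult power_mult_distrib)
    moreover have "iexp (\<xi> * (m + \<sigma> * x)) = iexp (\<xi> * m) * iexp ((\<xi> * \<sigma>) * x)"
      by (simp add: exp_add[symmetric] algebra_simps)
    ultimately show "normal_density m \<sigma> (m + \<sigma> * x) *\<^sub>R iexp (\<xi> * (m + \<sigma> * x)) =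
       (iexp (\<xi> * m) / of_real \<sigma>) * (std_normal_density x *\<^sub>R iexp ((\<xi> * \<sigma>) * x))"
      by (simp add: scaleR_conv_of_real)
  qed
  also have "\<bar>\<sigma>\<bar> *\<^sub>R (LINT x|lborel. (iexp (\<xi> * m) / of_real \<sigma>) * (std_normal_density x *\<^sub>R iexp ((\<xi> * \<sigma>) * x))) =
     iexp (\<xi> * m) * of_real (exp (- ((\<xi> * \<sigma>)\<^sup>2) / 2))"
    unfolding integral_mult_right_zero std using s by (simp add: scaleR_conv_of_real)
  finally show ?thesis by (simp only: power_mult_distrib mult.commute)
qed

lemma subordinatorD:
  assumes "subordinator M X"
  shows "0 \<le> t \<Longrightarrow> X t \<in> borel_measurable M"
    and "\<omega> \<in> space M \<Longrightarrow> X 0 \<omega> = 0"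
    and "\<omega> \<in> space M \<Longrightarrow> mono_on {0..} (\<lambda>t. X t \<omega>)"
    and "\<omega> \<in> space M \<Longrightarrow> 0 \<le> t \<Longrightarrow> continuous (at_right t) (\<lambda>s. X s \<omega>)"
  using assms unfolding subordinator_def by blast+

lemma subordinator_nonneg:
  assumes "subordinator M X" "\<omega> \<in> space M" "0 \<le> t"
  shows "0 \<le> X t \<omega>"
  using mono_onD[OF subordinatorD(3)[OF assms(1,2)], of 0 t] subordinatorD(2)[OF assms(1,2)] assms(3) by simp

lemma (in prob_space) brownian_motion_char:
  assumes B: "brownian_motion M B" and t: "0 \<le> t"
  shows "(LINT \<omega>|M. iexp (\<xi> * B t \<omega>)) = of_real (exp (- (t * \<xi>\<^sup>2)))"
proof (cases "t = 0")
  case True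
  have "(LINT \<omega>|M. iexp (\<xi> * B t \<omega>)) = (LINT \<omega>|M. 1)"
    by (rule Bochner_Integration.integral_cong) (use B True in \<open>auto simp: brownian_motion_def\<close>)
  then show ?thesis using True by (simp add: prob_space)
next
  case False
  have D: "distributed M lborel (\<lambda>\<omega>. B t \<omega> - B 0 \<omega>) (normal_density 0 (sqrt (2 * (t - 0))))"
    using B t False unfolding brownian_motion_def by (metis less_le order_refl)
  have "(LINT \<omega>|M. iexp (\<xi> * B t \<omega>)) = (LINT \<omega>|M. iexp (\<xi> * (B t \<omega> - B 0 \<omega>)))"
    by (rule Bochner_Integration.integral_cong) (use B in \<open>auto simp: brownian_motion_def\<close>)
  also have "\<dots> = (LINT x|distr M lborel (\<lambda>\<omega>. B t \<omega> - B 0 \<omega>). iexp (\<xi> * x))"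
    by (rule integral_distr[symmetric]) (use distributed_measurable[OF D] in auto)
  also have "\<dots> = (LINT x|density lborel (normal_density 0 (sqrt (2 * (t - 0)))). iexp (\<xi> * x))"
    unfolding distributed_distr_eq_density[OF D] ..
  also have "\<dots> = (LINT x|lborel. normal_density 0 (sqrt (2 * (t - 0))) x *\<^sub>R iexp (\<xi> * x))"
    by (rule integral_density) auto
  also have "\<dots> = of_real (exp (- (t * \<xi>\<^sup>2)))"
    using t False by (subst integral_normal_density_iexp) auto
  finally show ?thesis .
qed

text \<open>Tempering shifts the Laplace variable by \<open>lam\<close> and renormalises by \<open>exp (t * lam powr \<alpha>)\<close>.
  The cases \<open>t = 0\<close> and \<open>lam + y = 0\<close>, about which the transition density says nothing, are
  trivial because \<open>T 0\<close> or \<open>y\<close> is 0.\<close>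

lemma (in prob_space) tempered_stable_laplace:
  assumes T: "tempered_stable_subordinator lam \<alpha> M T" and lam: "0 \<le> lam" and y: "0 \<le> y" and t: "0 \<le> t" and \<alpha>: "0 < \<alpha>"
  shows "(LINT \<omega>|M. exp (- (y * T t \<omega>))) = exp (- (t * ((lam + y) powr \<alpha> - lam powr \<alpha>)))"
proof -
  have sub: "subordinator M T" using T by (simp add: tempered_stable_subordinator_def)
  obtain h where h: "stable_transition_density \<alpha> h"
    "\<And>s t. 0 \<le> s \<Longrightarrow> s < t \<Longrightarrow> distributed M lborel (\<lambda>\<omega>. T t \<omega> - T s \<omega>) (\<lambda>x. ennreal (tempered_density lam \<alpha> h x (t - s)))"
    using T unfolding tempered_stable_subordinator_def by blast
  have T0: "\<omega> \<in> space M \<Longrightarrow> T 0 \<omega> = 0" for \<omega> by (rule subordinatorD(2)[OF sub])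
  show ?thesis
  proof (cases "t = 0 \<or> lam + y = 0")
    case True
    then have "(LINT \<omega>|M. exp (- (y * T t \<omega>))) = (LINT \<omega>|M. 1)"
      by (intro Bochner_Integration.integral_cong) (use T0 lam y in auto)
    then show ?thesis using True lam y by (auto simp: prob_space)
  next
    case False
    then have tp: "0 < t" and ly: "0 < lam + y" using t lam y by auto
    have D: "distributed M lborel (\<lambda>\<omega>. T t \<omega> - T 0 \<omega>) (\<lambda>x. ennreal (tempered_density lam \<alpha> h x (t - 0)))"
      by (rule h(2)) (use tp in auto)
    have pos: "0 \<le> tempered_density lam \<alpha> h x (t - 0)" for x
      using h(1) tp by (auto simp: tempered_density_def stable_transition_density_def)
    have "(LINT \<omega>|M. exp (- (y * T t \<omega>))) = (LINT \<omega>|M. exp (- (y * (T t \<omega> - T 0 \<omega>))))"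
      by (rule Bochner_Integration.integral_cong) (use T0 in auto)
    also have "\<dots> = (LINT x|lborel. tempered_density lam \<alpha> h x (t - 0) * exp (- (y * x)))"
      by (rule distributed_integral[OF D, symmetric]) (use pos in auto)
    also have "\<dots> = (LINT x|lborel. exp (lam powr \<alpha> * t) * (indicator {0<..} x *\<^sub>R (exp (- ((lam + y) * x)) * h x t)))"
      by (rule Bochner_Integration.integral_cong)
         (auto simp: tempered_density_def indicator_def exp_add[symmetric] algebra_simps mult_exp_exp)
    also have "\<dots> = exp (lam powr \<alpha> * t) * (LBINT x:{0<..}. exp (- ((lam + y) * x)) * h x t)"
      by (simp add: set_lebesgue_integral_def)
    also have "(LBINT x:{0<..}. exp (- ((lam + y) * x)) * h x t) = exp (- (t * (lam + y) powr \<alpha>))"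
      using h(1) tp ly by (auto simp: stable_transition_density_def)
    finally show ?thesis by (simp add: exp_add[symmetric] algebra_simps mult_exp_exp)
  qed
qed

locale time_changed_brownian = prob_space M for M :: "'w measure" +
  fixes \<alpha> \<beta> lam k :: real and B T H1 H2 :: "real \<Rightarrow> 'w \<Rightarrow> real"
  assumes params: "0 < \<alpha>" "\<alpha> < 1" "0 < \<beta>" "\<beta> < 1 / 2" "0 \<le> lam" "0 < k"
    and BM: "brownian_motion M B"
    and TS: "tempered_stable_subordinator lam \<alpha> M T"
    and S1: "stable_subordinator (2 * \<beta>) M H1"
    and S2: "stable_subordinator \<beta> M H2"
    and ind: "independent_processes M [B, T, H1, H2]"
begin

text \<open>The random clock is the inverse of the subordinator \<open>H\<close>. Since
  \<open>(p * c) powr \<beta> = 2 * k * p powr \<beta>\<close>, its Laplace exponent is \<open>\<Phi>\<close>.\<close>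

definition "c = (2 * k) powr (1 / \<beta>)"
definition "H = (\<lambda>s \<omega>. H1 s \<omega> + c * H2 s \<omega>)"
definition "\<Phi> = (\<lambda>p. p powr (2 * \<beta>) + 2 * k * p powr \<beta>)"

lemma c_pos: "0 < c" using params by (simp add: c_def)

lemma path_algebra_meas:
  assumes "0 \<le> t"
  shows "0 \<in> A \<Longrightarrow> B t \<in> borel_measurable (path_algebra M [B, T, H1, H2] A)"
    "1 \<in> A \<Longrightarrow> T t \<in> borel_measurable (path_algebra M [B, T, H1, H2] A)"
    "2 \<in> A \<Longrightarrow> H1 t \<in> borel_measurable (path_algebra M [B, T, H1, H2] A)"
    "3 \<in> A \<Longrightarrow> H2 t \<in> borel_measurable (path_algebra M [B, T, H1, H2] A)"
proof -
  note m = measurable_path_algebra[OF _ assms, of _ A "[B, T, H1, H2]" M]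
  show "0 \<in> A \<Longrightarrow> B t \<in> borel_measurable (path_algebra M [B, T, H1, H2] A)" using m[of 0] by simp
  show "1 \<in> A \<Longrightarrow> T t \<in> borel_measurable (path_algebra M [B, T, H1, H2] A)" using m[of 1] by simp
  show "2 \<in> A \<Longrightarrow> H1 t \<in> borel_measurable (path_algebra M [B, T, H1, H2] A)" using m[of 2] by simp
  show "3 \<in> A \<Longrightarrow> H2 t \<in> borel_measurable (path_algebra M [B, T, H1, H2] A)" using m[of 3] by simp
qed

lemma sub1: "subordinator M H1" and sub2: "subordinator M H2" and subT: "subordinator M T"
  using S1 S2 TS by (auto simp: stable_subordinator_def tempered_stable_subordinator_def)

lemma H_path_algebra:
  assumes "0 \<le> s" "2 \<in> A" "3 \<in> A"
  shows "H s \<in> borel_measurable (path_algebra M [B, T, H1, H2] A)"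
  unfolding H_def using path_algebra_meas(3,4)[OF assms(1)] assms by (intro borel_measurable_add borel_measurable_times) auto

lemma H_mono': "\<omega> \<in> space M \<Longrightarrow> mono_on {0..} (\<lambda>s. H s \<omega>)"
  using subordinatorD(3)[OF sub1] subordinatorD(3)[OF sub2] c_pos unfolding H_def mono_on_def
  by (auto intro!: add_mono mult_left_mono)

lemma H_rc': "\<omega> \<in> space M \<Longrightarrow> 0 \<le> s \<Longrightarrow> continuous (at_right s) (\<lambda>s. H s \<omega>)"
  unfolding H_def by (intro continuous_intros subordinatorD(4)[OF sub1] subordinatorD(4)[OF sub2])

sublocale passage: subordinator_passage M H \<Phi>
proof
  show "H s \<in> borel_measurable M" if "0 \<le> s" for s
    unfolding H_def using subordinatorD(1)[OF sub1 that] subordinatorD(1)[OF sub2 that] by measurable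
  show "H 0 \<omega> = 0" if "\<omega> \<in> space M" for \<omega>
    using subordinatorD(2)[OF sub1 that] subordinatorD(2)[OF sub2 that] by (simp add: H_def)
  show "0 < \<Phi> p" if "0 < p" for p using that params by (simp add: \<Phi>_def add_pos_pos)
  fix s p :: real assume s: "0 \<le> s" and p: "0 < p"
  note nn = subordinator_nonneg[OF _ _ s]
  have m: "H1 s \<in> borel_measurable M" "H2 s \<in> borel_measurable M"
    using subordinatorD(1)[OF sub1 s] subordinatorD(1)[OF sub2 s] by auto
  have "indep_var borel (H1 s) borel (H2 s)"
    by (rule indep_var_path_algebra[OF ind, of "{2}" "{3}"]) (use s in \<open>auto intro!: path_algebra_meas\<close>)
  then have iv: "indep_var borel ((\<lambda>x. exp (- (p * x))) \<circ> H1 s) borel ((\<lambda>x. exp (- ((p * c) * x))) \<circ> H2 s)"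
    by (rule indep_var_compose) auto
  have "(LINT \<omega>|M. exp (- (p * H s \<omega>))) = (LINT \<omega>|M. exp (- (p * H1 s \<omega>)) * exp (- ((p * c) * H2 s \<omega>)))"
    by (rule Bochner_Integration.integral_cong) (auto simp: H_def exp_add[symmetric] algebra_simps)
  also have "\<dots> = (LINT \<omega>|M. exp (- (p * H1 s \<omega>))) * (LINT \<omega>|M. exp (- ((p * c) * H2 s \<omega>)))"
  proof (rule indep_var_lebesgue_integral)
    show "integrable M (\<lambda>\<omega>. exp (- (p * H1 s \<omega>)))"
      by (rule integrable_const_bound[where B = 1]) (use m p nn[OF sub1] in auto)
    show "integrable M (\<lambda>\<omega>. exp (- ((p * c) * H2 s \<omega>)))"
      by (rule integrable_const_bound[where B = 1]) (use m p c_pos nn[OF sub2] in auto)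
  qed (use iv in \<open>simp add: o_def\<close>)
  also have "(LINT \<omega>|M. exp (- (p * H1 s \<omega>))) = exp (- (s * p powr (2 * \<beta>)))"
    using S1 s p by (auto simp: stable_subordinator_def)
  also have "(LINT \<omega>|M. exp (- ((p * c) * H2 s \<omega>))) = exp (- (s * (p * c) powr \<beta>))"
    using S2 s p c_pos by (auto simp: stable_subordinator_def)
  also have "(p * c) powr \<beta> = 2 * k * p powr \<beta>"
    using params p by (simp add: c_def powr_mult powr_powr)
  finally show "(LINT \<omega>|M. exp (- (p * H s \<omega>))) = exp (- (s * \<Phi> p))"
    by (simp add: \<Phi>_def exp_add[symmetric] algebra_simps)
qed (use H_mono' H_rc' in auto)

lemma inverse_process_eq: "inverse_process \<beta> k H1 H2 t \<omega> = passage.L t \<omega>"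
  by (simp add: inverse_process_def first_passage_def H_def c_def)

text \<open>Both sides have the Laplace transform \<open>\<Phi> p / (p * (\<Phi> p + th))\<close> for large \<open>p\<close>. The left-hand
  side is monotone in \<open>t\<close> because the inverse process increases, and the right-hand side is
  continuous.\<close>

lemma laplace_inverse_process:
  assumes th: "0 \<le> th" and t: "0 < t"
  shows "passage.G th t = relaxation \<beta> k th t"
proof -
  \<comment> \<open>From \<open>p0\<close> on, the geometric majorant of the generating function has ratio at most 1/2.\<close>
  define p0 where "p0 = (2 * (1 + 2 * k + th)) powr (1 / \<beta>)"
  have R: "0 < 1 + 2 * k + th" using params th by simp
  have p0: "0 < p0" using R by (simp add: p0_def)
  have large: "(1 + 2 * k + th) * p powr (- \<beta>) < 1" if "p0 \<le> p" for p
  proof -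
    have "p powr (- \<beta>) \<le> p0 powr (- \<beta>)" by (rule powr_mono2') (use params p0 that in auto)
    also have "p0 powr (- \<beta>) = (2 * (1 + 2 * k + th)) powr ((1 / \<beta>) * (- \<beta>))"
      unfolding p0_def by (rule powr_powr)
    also have "(1 / \<beta>) * (- \<beta>) = - 1" using params(3) by simp
    also have "(2 * (1 + 2 * k + th)) powr (- 1) = 1 / (2 * (1 + 2 * k + th))"
      using R powr_minus_divide[of "2 * (1 + 2 * k + th)" 1] by simp
    finally have "(1 + 2 * k + th) * p powr (- \<beta>) \<le> (1 + 2 * k + th) * (1 / (2 * (1 + 2 * k + th)))"
      using R by (intro mult_left_mono) auto
    also have "\<dots> = 1 / 2" using R by simp
    finally show ?thesis by simp
  qed
  show ?thesis
  proof (rule laplace_unique_antimono_continuous[OF _ _ _ _ p0 _ _ t])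
    show "isCont (relaxation \<beta> k th) s" if "0 < s" for s
      using has_real_derivative_relaxation[of \<beta> s k th] params that by (auto intro: DERIV_isCont)
    show "integrable lborel (\<lambda>t. indicator {0<..} t * (exp (- (p * t)) * relaxation \<beta> k th t))" if "p0 \<le> p" for p
      by (rule relaxation_laplace) (use params th large[OF that] p0 that in auto)
    show "(LINT t|lborel. indicator {0<..} t * (exp (- (p * t)) * relaxation \<beta> k th t)) =
       (LINT t|lborel. indicator {0<..} t * (exp (- (p * t)) * passage.G th t))" if "p0 \<le> p" for p
      using passage.laplace_G[OF th, of p] relaxation_laplace(2)[of \<beta> k th p] params th large[OF that] p0 that
      by (simp add: \<Phi>_def)
  qed (use passage.G_bounds[OF th] passage.G_antimono[OF th] in auto)
qed

text \<open>The series does not reveal this sign; it comes from the representation of the relaxation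
  function as \<open>E exp(- th L(t))\<close> with \<open>L\<close> increasing in time.\<close>

lemma relaxation_deriv_nonpos:
  assumes th: "0 \<le> th" and t: "0 < t"
  shows "relaxation_deriv \<beta> k th t \<le> 0"
proof (rule ccontr)
  assume "\<not> relaxation_deriv \<beta> k th t \<le> 0"
  then obtain d where d: "0 < d" "\<And>h. 0 < h \<Longrightarrow> h < d \<Longrightarrow> relaxation \<beta> k th t < relaxation \<beta> k th (t + h)"
    using DERIV_pos_inc_right[OF has_real_derivative_relaxation[of \<beta> t k th]] params t by (auto simp: not_le)
  have "relaxation \<beta> k th t < relaxation \<beta> k th (t + d / 2)" using d by simp
  moreover have "passage.G th (t + d / 2) \<le> passage.G th t" by (rule passage.G_antimono) (use th d in auto)
  moreover have "passage.G th t = relaxation \<beta> k th t" "passage.G th (t + d / 2) = relaxation \<beta> k th (t + d / 2)"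
    using laplace_inverse_process[OF th] t d(1) by auto
  ultimately show False by linarith
qed

definition "V t \<omega> = T (passage.L t \<omega>) \<omega>"

lemma L_path_algebra:
  assumes "2 \<in> A" "3 \<in> A"
  shows "passage.L t \<in> borel_measurable (path_algebra M [B, T, H1, H2] A)"
  by (rule measurable_first_passage) (simp_all add: assms H_path_algebra H_mono' H_rc')

lemma V_path_algebra: "V t \<in> borel_measurable (path_algebra M [B, T, H1, H2] {1,2,3})"
  unfolding V_def[abs_def]
proof (rule measurable_random_time[where X = T and S = "passage.L t"])
  show "T s \<in> borel_measurable (path_algebra M [B, T, H1, H2] {1,2,3})" if "0 \<le> s" for s
    by (rule path_algebra_meas(2)[OF that]) simp
  show "passage.L t \<in> borel_measurable (path_algebra M [B, T, H1, H2] {1,2,3})"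
    by (rule L_path_algebra) simp_all
qed (simp_all add: first_passage_nonneg subordinatorD(4)[OF subT])

lemma V_nonneg: "\<omega> \<in> space M \<Longrightarrow> 0 \<le> V t \<omega>"
  unfolding V_def by (rule subordinator_nonneg[OF subT _ first_passage_nonneg])

lemma V_meas[measurable]: "V t \<in> borel_measurable M"
  unfolding V_def[abs_def]
  by (rule measurable_random_time[where X = T and S = "passage.L t"])
     (simp_all add: first_passage_nonneg subordinatorD(1,4)[OF subT] passage.L_meas)

lemma psi_nonneg: "0 \<le> y \<Longrightarrow> 0 \<le> (lam + y) powr \<alpha> - lam powr \<alpha>"
  using powr_mono2[of \<alpha> lam "lam + y"] params by simp

lemma laplace_V_G:
  assumes y: "0 \<le> y"
  shows "(LINT \<omega>|M. exp (- (y * V t \<omega>))) = passage.G ((lam + y) powr \<alpha> - lam powr \<alpha>) t"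
proof -
  let ?\<psi> = "(lam + y) powr \<alpha> - lam powr \<alpha>"
  have psi: "0 \<le> ?\<psi>" by (rule psi_nonneg[OF y])
  have "(LINT \<omega>|M. complex_of_real (exp (- (y * T (passage.L t \<omega>) \<omega>)))) = of_real (LINT \<omega>|M. exp (- (passage.L t \<omega> * ?\<psi>)))"
  proof (rule expectation_at_independent_time[where f = "\<lambda>x. complex_of_real (exp (- (y * x)))"])
    show "indep_var borel (passage.L t) borel (T s)" if "0 \<le> s" for s
      by (rule indep_var_path_algebra[OF ind, of "{2,3}" "{1}"])
         (use that in \<open>auto intro!: path_algebra_meas L_path_algebra\<close>)
    show "(LINT \<omega>|M. complex_of_real (exp (- (y * T s \<omega>)))) = of_real (exp (- (s * ?\<psi>)))" if "0 \<le> s" for s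
      using tempered_stable_laplace[OF TS params(5) y that params(1)] by simp
    show "norm (complex_of_real (exp (- (y * T s \<omega>)))) \<le> 1" if "\<omega> \<in> space M" "0 \<le> s" for \<omega> s
      using subordinator_nonneg[OF subT that] y by simp
    show "continuous_on UNIV (\<lambda>x. complex_of_real (exp (- (y * x))))" by (intro continuous_intros)
    show "0 \<le> ?\<psi>" by (rule psi)
  qed (simp_all add: first_passage_nonneg subordinatorD(4)[OF subT])
  then show ?thesis by (simp add: V_def passage.G_def mult.commute)
qed

lemma laplace_V:
  assumes y: "0 \<le> y" and t: "0 < t"
  shows "(LINT \<omega>|M. exp (- (y * V t \<omega>))) = relaxation \<beta> k ((lam + y) powr \<alpha> - lam powr \<alpha>) t"
  unfolding laplace_V_G[OF y] by (rule laplace_inverse_process[OF psi_nonneg[OF y] t])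

text \<open>The probability of \<open>V t = 0\<close> is at most \<open>E exp(- n V(t))\<close> for every \<open>n\<close>. This is
  \<open>E exp(- \<psi>(n) L(t))\<close> with the Laplace exponent \<open>\<psi>\<close> of \<open>T\<close>, and it tends to 0 because \<open>\<psi>\<close> is
  unbounded and \<open>L(t) > 0\<close> almost surely.\<close>

lemma AE_V_pos:
  assumes t: "0 < t"
  shows "AE \<omega> in M. 0 < V t \<omega>"
proof -
  let ?\<psi> = "\<lambda>n::nat. (lam + real n) powr \<alpha> - lam powr \<alpha>"
  have psi: "0 \<le> ?\<psi> n" for n by (rule psi_nonneg) simp
  define N where "N = {\<omega> \<in> space M. V t \<omega> = 0}"
  have Nm[measurable]: "N \<in> sets M" unfolding N_def by measurable
  have "prob N \<le> passage.G (?\<psi> n) t" for n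
  proof -
    have "prob N = (LINT \<omega>|M. indicator N \<omega>)" by simp
    also have "\<dots> \<le> (LINT \<omega>|M. exp (- (real n * V t \<omega>)))"
    proof (rule integral_mono)
      show "integrable M (\<lambda>\<omega>. exp (- (real n * V t \<omega>)))"
        by (rule integrable_const_bound[where B = 1]) (rule AE_I2, simp add: V_nonneg, measurable)
      show "indicator N \<omega> \<le> exp (- (real n * V t \<omega>))" for \<omega> by (auto simp: N_def indicator_def)
    qed (auto intro: integrable_const_bound[where B = 1])
    also have "\<dots> = passage.G (?\<psi> n) t" by (rule laplace_V_G) simp
    finally show ?thesis .
  qed
  moreover have "(\<lambda>n. passage.G (?\<psi> n) t) \<longlonglongrightarrow> (LINT \<omega>|M. 0)"
    unfolding passage.G_def
  proof (rule integral_dominated_convergence[where w = "\<lambda>_. 1"])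
    show "AE \<omega> in M. (\<lambda>n. exp (- (?\<psi> n * passage.L t \<omega>))) \<longlonglongrightarrow> 0"
      using passage.AE_L_pos[OF t]
    proof eventually_elim
      case (elim \<omega>)
      have "filterlim (\<lambda>n. ?\<psi> n) at_top sequentially" using params(1) by real_asymp
      then have "filterlim (\<lambda>n. ?\<psi> n * passage.L t \<omega>) at_top sequentially"
        by (rule filterlim_at_top_mult_tendsto_pos[OF tendsto_const elim])
      then show ?case by (intro filterlim_compose[OF exp_at_bot] filterlim_uminus_at_bot_at_top[THEN filterlim_compose])
    qed
    show "AE \<omega> in M. norm (exp (- (?\<psi> n * passage.L t \<omega>))) \<le> 1" for n
      using psi[of n] first_passage_nonneg[of H t] by (intro AE_I2) simp
  qed auto
  ultimately have "prob N \<le> 0" using LIMSEQ_le_const[of "\<lambda>n. passage.G (?\<psi> n) t" "0" "prob N"] by auto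
  then have "prob N = 0" using measure_nonneg[of M N] by simp
  then have "N \<in> null_sets M" by (intro null_setsI) (auto simp: emeasure_eq_measure)
  then have "AE \<omega> in M. \<omega> \<notin> N" by (rule AE_not_in)
  then show ?thesis using AE_space
  proof eventually_elim
    case (elim \<omega>)
    then show ?case using V_nonneg[of \<omega> t] by (simp add: N_def less_le)
  qed
qed

definition "W t \<omega> = B (V t \<omega>) \<omega>"

lemma B_rc: "\<omega> \<in> space M \<Longrightarrow> 0 \<le> t \<Longrightarrow> continuous (at_right t) (\<lambda>s. B s \<omega>)"
proof -
  assume w: "\<omega> \<in> space M" and t: "0 \<le> t"
  then have "continuous (at t within {0..}) (\<lambda>s. B s \<omega>)"
    using BM unfolding brownian_motion_def continuous_on_eq_continuous_within by (metis atLeast_iff)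
  then show ?thesis by (rule continuous_within_subset) (use t in auto)
qed

lemma W_meas[measurable]: "W t \<in> borel_measurable M"
  unfolding W_def[abs_def]
proof (rule measurable_random_time[where X = B and S = "V t"])
  show "B s \<in> borel_measurable M" if "0 \<le> s" for s using BM that unfolding brownian_motion_def by blast
qed (simp_all add: V_meas V_nonneg B_rc)

text \<open>Given \<open>V t\<close>, the value of the Brownian motion has the characteristic function
  \<open>exp (- V t * \<xi>\<^sup>2)\<close>, and the exponent of the tempered subordinator at \<open>\<xi>\<^sup>2\<close> is \<open>theta \<alpha> lam \<xi>\<close>.\<close>

lemma char_W:
  assumes t: "0 < t"
  shows "(LINT \<omega>|M. iexp (\<xi> * W t \<omega>)) = of_real (relaxation \<beta> k (theta \<alpha> lam \<xi>) t)"
proof -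
  have "(LINT \<omega>|M. iexp (\<xi> * B (V t \<omega>) \<omega>)) = of_real (LINT \<omega>|M. exp (- (V t \<omega> * \<xi>\<^sup>2)))"
  proof (rule expectation_at_independent_time[where f = "\<lambda>x. iexp (\<xi> * x)"])
    show "indep_var borel (V t) borel (B s)" if "0 \<le> s" for s
      by (rule indep_var_path_algebra[OF ind _ _ _ V_path_algebra path_algebra_meas(1)[OF that, of "{0}"]]) auto
    show "(LINT \<omega>|M. iexp (\<xi> * B s \<omega>)) = of_real (exp (- (s * \<xi>\<^sup>2)))" if "0 \<le> s" for s
      by (rule brownian_motion_char[OF BM that])
    show "continuous_on UNIV (\<lambda>x. iexp (\<xi> * x))" by (intro continuous_intros)
  qed (simp_all add: V_nonneg B_rc)
  then show ?thesis using laplace_V[OF zero_le_power2[of \<xi>] t] by (simp add: W_def theta_def mult.commute)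
qed

end

section \<open>Fourier inversion for Schwartz functions\<close>

lemma integral_normal_density_affine:
  fixes h :: "real \<Rightarrow> complex"
  assumes s: "0 < \<sigma>"
  shows "(LINT x|lborel. normal_density a \<sigma> x *\<^sub>R h x) = (LINT z|lborel. std_normal_density z *\<^sub>R h (a + \<sigma> * z))"
proof -
  have "(LINT x|lborel. normal_density a \<sigma> x *\<^sub>R h x) =
    \<bar>\<sigma>\<bar> *\<^sub>R (LINT z|lborel. normal_density a \<sigma> (a + \<sigma> * z) *\<^sub>R h (a + \<sigma> * z))"
    by (rule lborel_integral_real_affine) (use s in simp)
  also have "\<dots> = (LINT z|lborel. \<bar>\<sigma>\<bar> *\<^sub>R (normal_density a \<sigma> (a + \<sigma> * z) *\<^sub>R h (a + \<sigma> * z)))"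
    by (simp only: integral_scaleR_right)
  also have "(\<lambda>z. \<bar>\<sigma>\<bar> *\<^sub>R (normal_density a \<sigma> (a + \<sigma> * z) *\<^sub>R h (a + \<sigma> * z))) = (\<lambda>z. std_normal_density z *\<^sub>R h (a + \<sigma> * z))"
    using s by (intro ext) (simp add: normal_density_def real_sqrt_mult power_mult_distrib)
  finally show ?thesis .
qed

text \<open>Dominated convergence after standardising the normal density. Quadratic growth of \<open>h\<close> is
  admitted because \<open>h\<close> will also be the symbol of the operator.\<close>

lemma gaussian_approximate_identity:
  fixes h :: "real \<Rightarrow> complex"
  assumes h: "continuous_on UNIV h" and bd: "\<And>x. norm (h x) \<le> C * (1 + x\<^sup>2)"
  shows "(\<lambda>n. LINT x|lborel. normal_density a (1 / real (Suc n)) x *\<^sub>R h x) \<longlonglongrightarrow> h a"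
proof -
  have hm[measurable]: "h \<in> borel_measurable borel" by (rule borel_measurable_continuous_onI[OF h])
  have C: "0 \<le> C" using order_trans[OF norm_ge_zero bd[of 0]] by simp
  have "(\<lambda>n. LINT z|lborel. std_normal_density z *\<^sub>R h (a + 1 / real (Suc n) * z)) \<longlonglongrightarrow> (LINT z|lborel. std_normal_density z *\<^sub>R h a)"
  proof (rule integral_dominated_convergence[where w = "\<lambda>z. (C * (1 + 2 * a\<^sup>2)) * std_normal_density z + (2 * C) * (std_normal_density z * z ^ 2)"])
    show "integrable lborel (\<lambda>z. (C * (1 + 2 * a\<^sup>2)) * std_normal_density z + (2 * C) * (std_normal_density z * z ^ 2))"
      by (intro Bochner_Integration.integrable_add integrable_mult_right integrable_std_normal_moment integrable_normal_density) simp
    show "AE z in lborel. (\<lambda>n. std_normal_density z *\<^sub>R h (a + 1 / real (Suc n) * z)) \<longlonglongrightarrow> std_normal_density z *\<^sub>R h a"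
    proof (rule AE_I2)
      fix z
      have c: "isCont h a" using h by (simp add: continuous_on_eq_continuous_at)
      have "(\<lambda>n. a + 1 / real (Suc n) * z) \<longlonglongrightarrow> a" by real_asymp
      from isCont_tendsto_compose[OF c this]
      show "(\<lambda>n. std_normal_density z *\<^sub>R h (a + 1 / real (Suc n) * z)) \<longlonglongrightarrow> std_normal_density z *\<^sub>R h a"
        by (intro tendsto_intros)
    qed
    show "AE z in lborel. norm (std_normal_density z *\<^sub>R h (a + 1 / real (Suc n) * z)) \<le>
        (C * (1 + 2 * a\<^sup>2)) * std_normal_density z + (2 * C) * (std_normal_density z * z ^ 2)" for n
    proof (rule AE_I2)
      fix z :: real
      define w where "w = 1 / real (Suc n) * z"
      have "\<bar>w\<bar> \<le> \<bar>z\<bar>"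
      proof -
        have "\<bar>w\<bar> = (1 / real (Suc n)) * \<bar>z\<bar>" by (simp add: w_def abs_mult)
        also have "\<dots> \<le> 1 * \<bar>z\<bar>" by (rule mult_right_mono) auto
        finally show ?thesis by simp
      qed
      then have w2: "w\<^sup>2 \<le> z\<^sup>2" by (simp add: abs_le_square_iff)
      have "0 \<le> (a - w)\<^sup>2" by simp
      then have "(a + w)\<^sup>2 \<le> 2 * a\<^sup>2 + 2 * w\<^sup>2" by (simp add: power2_eq_square algebra_simps)
      then have "1 + (a + w)\<^sup>2 \<le> 1 + 2 * a\<^sup>2 + 2 * z\<^sup>2" using w2 by linarith
      then have "norm (h (a + w)) \<le> C * (1 + 2 * a\<^sup>2 + 2 * z\<^sup>2)"
        using order_trans[OF bd[of "a + w"] mult_left_mono[OF _ C]] by blast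
      then have "std_normal_density z * norm (h (a + w)) \<le> std_normal_density z * (C * (1 + 2 * a\<^sup>2 + 2 * z\<^sup>2))"
        by (rule mult_left_mono) simp
      then show "norm (std_normal_density z *\<^sub>R h (a + 1 / real (Suc n) * z)) \<le>
        (C * (1 + 2 * a\<^sup>2)) * std_normal_density z + (2 * C) * (std_normal_density z * z ^ 2)"
        by (simp add: w_def algebra_simps)
    qed
  qed measurable
  moreover have "(LINT z|lborel. std_normal_density z *\<^sub>R h a) = h a"
    by (subst integral_scaleR_left) (auto intro: integrable_normal_density)
  ultimately show ?thesis by (subst integral_normal_density_affine) simp_all
qed

lemma inverse_one_plus_square_integrable: "integrable lborel (\<lambda>x::real. 1 / (1 + x\<^sup>2))"
proof -
  have "(\<integral>\<^sup>+x. ennreal (1 / (1 + x\<^sup>2)) * indicator {0..} x \<partial>lborel) = ennreal (pi / 2 - arctan 0)"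
  proof (rule nn_integral_FTC_atLeast)
    show "(arctan has_real_derivative 1 / (1 + x\<^sup>2)) (at x)" for x
      using DERIV_arctan[of x] by (simp add: divide_inverse)
    show "(arctan \<longlongrightarrow> pi / 2) at_top" by (rule tendsto_arctan_at_top)
  qed (auto simp: add_nonneg_nonneg)
  moreover have "ennreal (1 / (1 + x\<^sup>2)) * indicator {0..} x = ennreal (indicator {0..} x * (1 / (1 + x\<^sup>2)))" for x :: real
    by (auto simp: indicator_def)
  ultimately have "(\<integral>\<^sup>+x. ennreal (indicator {0..} x * (1 / (1 + x\<^sup>2))) \<partial>lborel) = ennreal (pi / 2 - arctan 0)"
    by (simp only:)
  then have I1: "integrable lborel (\<lambda>x::real. indicator {0..} x * (1 / (1 + x\<^sup>2)))"
    by (intro integrableI_nn_integral_finite[of _ _ "pi / 2 - arctan 0"]) (auto simp: add_nonneg_nonneg)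
  have "integrable lborel (\<lambda>x::real. indicator {0..} (0 + (-1) * x) * (1 / (1 + (0 + (-1) * x)\<^sup>2)))"
    by (rule lborel_integrable_real_affine[OF I1]) simp
  from Bochner_Integration.integrable_add[OF I1 this] show ?thesis
    by (rule Bochner_Integration.integrable_bound) (auto simp: indicator_def add_nonneg_nonneg)
qed

lemma integrable_decay:
  fixes f :: "real \<Rightarrow> 'a::{banach, second_countable_topology}"
  assumes [measurable]: "f \<in> borel_measurable borel" and "\<And>x. norm (f x) \<le> C / (1 + x\<^sup>2)"
  shows "integrable lborel f"
proof (rule Bochner_Integration.integrable_bound)
  show "integrable lborel (\<lambda>x. C * (1 / (1 + x\<^sup>2)))"
    by (rule integrable_mult_right[OF inverse_one_plus_square_integrable])
  show "AE x in lborel. norm (f x) \<le> norm (C * (1 / (1 + x\<^sup>2)))"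
  proof (rule AE_I2)
    fix x
    have "C / (1 + x\<^sup>2) \<le> norm (C * (1 / (1 + x\<^sup>2)))" using abs_ge_self[of "C / (1 + x\<^sup>2)"] by simp
    then show "norm (f x) \<le> norm (C * (1 / (1 + x\<^sup>2)))" using assms(2)[of x] by linarith
  qed
qed simp

text \<open>The condition on the sequence of derivatives whose existence makes a function a Schwartz
  function.\<close>

definition schwartz_derivs :: "(nat \<Rightarrow> real \<Rightarrow> complex) \<Rightarrow> bool" where
  "schwartz_derivs D \<longleftrightarrow> (\<forall>n x. (D n has_vector_derivative D (Suc n) x) (at x)) \<and>
     (\<forall>m n. bounded (range (\<lambda>x. x ^ m *\<^sub>R D n x)))"

lemma schwartz_derivs_props:
  assumes D: "schwartz_derivs D"
  shows "continuous_on UNIV (D n)" "D n \<in> borel_measurable borel"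
    and "\<exists>C. \<forall>x. norm (D n x) \<le> C / (1 + x\<^sup>2)"
    and "integrable lborel (D n)"
proof -
  show c: "continuous_on UNIV (D n)"
    using D has_vector_derivative_continuous unfolding schwartz_derivs_def
    by (metis continuous_at_imp_continuous_on)
  show m: "D n \<in> borel_measurable borel" by (rule borel_measurable_continuous_onI[OF c])
  have b: "bounded (range (\<lambda>x. x ^ m *\<^sub>R D n x))" for m
    using D unfolding schwartz_derivs_def by blast
  obtain C0 where C0: "\<And>x. norm (x ^ 0 *\<^sub>R D n x) \<le> C0"
    using b[of 0] unfolding bounded_iff by blast
  obtain C2 where C2: "\<And>x. norm (x ^ 2 *\<^sub>R D n x) \<le> C2"
    using b[of 2] unfolding bounded_iff by blast
  have dec: "norm (D n x) \<le> (C0 + C2) / (1 + x\<^sup>2)" for x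
  proof -
    have "norm (D n x) * (1 + x\<^sup>2) \<le> C0 + C2"
      using C0[of x] C2[of x] by (simp add: algebra_simps)
    then show ?thesis by (subst pos_le_divide_eq) (auto intro: add_pos_nonneg)
  qed
  then show "\<exists>C. \<forall>x. norm (D n x) \<le> C / (1 + x\<^sup>2)" by blast
  show "integrable lborel (D n)" by (rule integrable_decay[OF m dec])
qed

lemma integrable_iexp_mult:
  fixes f :: "real \<Rightarrow> complex"
  assumes "integrable lborel f"
  shows "integrable lborel (\<lambda>x. iexp (\<xi> * x) * f x)"
  by (rule Bochner_Integration.integrable_bound[OF assms]) (use assms in \<open>auto simp: norm_mult\<close>)

lemma norm_fourier_le:
  "norm (fourier f \<xi>) \<le> (LINT x|lborel. norm (f x))"
proof -
  have "norm (fourier f \<xi>) \<le> (LINT x|lborel. norm (iexp (\<xi> * x) * f x))"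
    unfolding fourier_def by (rule integral_norm_bound)
  then show ?thesis by (simp add: norm_mult)
qed

text \<open>Integration by parts, in the form that the integral of the derivative of
  \<open>iexp (\<xi> * x) * D n x\<close> over the line is 0.\<close>

lemma fourier_derivative:
  assumes D: "schwartz_derivs D"
  shows "fourier (D (Suc n)) \<xi> = - \<i> * of_real \<xi> * fourier (D n) \<xi>"
proof -
  let ?F = "\<lambda>x. iexp (\<xi> * x) * D n x"
  let ?f = "\<lambda>x. iexp (\<xi> * x) * D (Suc n) x + (\<i> * of_real \<xi>) * (iexp (\<xi> * x) * D n x)"
  note P = schwartz_derivs_props[OF D]
  have i1: "integrable lborel (\<lambda>x. iexp (\<xi> * x) * D (Suc n) x)" by (rule integrable_iexp_mult[OF P(4)])
  have i2: "integrable lborel (\<lambda>x. (\<i> * of_real \<xi>) * (iexp (\<xi> * x) * D n x))"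
    by (intro integrable_mult_right integrable_iexp_mult[OF P(4)])
  obtain C where C: "\<And>x. norm (D n x) \<le> C / (1 + x\<^sup>2)" using P(3) by blast
  have lim: "(?F \<longlongrightarrow> 0) F" if "((\<lambda>x. C / (1 + x\<^sup>2)) \<longlongrightarrow> 0) F" for F
    by (rule Lim_null_comparison[OF _ that]) (simp add: norm_mult C)
  have "(LBINT x=-\<infinity>..\<infinity>. ?f x) = 0 - 0"
  proof (rule interval_integral_FTC_integrable)
    show "(?F has_vector_derivative ?f x) (at x)" for x
    proof -
      have d: "(D n has_vector_derivative D (Suc n) x) (at x)" using D by (simp add: schwartz_derivs_def)
      have e: "((\<lambda>x. iexp (\<xi> * x)) has_vector_derivative (\<i> * of_real \<xi>) * iexp (\<xi> * x)) (at x)"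
        unfolding has_vector_derivative_complex_iff[where f = "\<lambda>x. iexp (\<xi> * x)"]
        by (auto intro!: derivative_eq_intros simp: Re_exp Im_exp)
      show ?thesis using has_vector_derivative_mult[OF e d] by (simp add: mult.assoc add.commute)
    qed
    show "isCont ?f x" for x
      using P(1)[of n] P(1)[of "Suc n"] by (auto intro!: continuous_intros simp: continuous_on_eq_continuous_at)
    show "set_integrable lborel (einterval (-\<infinity>) \<infinity>) ?f"
      using i1 i2 by (simp add: set_integrable_def)
    show "((?F \<circ> real_of_ereal) \<longlongrightarrow> 0) (at_right (-\<infinity>))"
      unfolding ereal_tendsto_simps by (rule lim) real_asymp
    show "((?F \<circ> real_of_ereal) \<longlongrightarrow> 0) (at_left \<infinity>)"
      unfolding ereal_tendsto_simps by (rule lim) real_asymp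
  qed simp
  then have "(LINT x|lborel. ?f x) = 0"
    by (simp add: interval_lebesgue_integral_def set_lebesgue_integral_def)
  then have "fourier (D (Suc n)) \<xi> + (\<i> * of_real \<xi>) * fourier (D n) \<xi> = 0"
    unfolding fourier_def by (subst (asm) Bochner_Integration.integral_add[OF i1 i2]) simp
  then show ?thesis by (simp add: add_eq_0_iff2)
qed

text \<open>Four derivatives give decay of order 4 for the Fourier transform, which suffices for
  integrability against weights of quadratic growth.\<close>

lemma schwartz_props:
  assumes "schwartz \<phi>"
  shows schwartz_continuous: "continuous_on UNIV \<phi>"
    and schwartz_measurable: "\<phi> \<in> borel_measurable borel"
    and schwartz_bounded: "\<exists>C. \<forall>x. norm (\<phi> x) \<le> C"
    and schwartz_integrable: "integrable lborel \<phi>"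
    and schwartz_fourier_decay: "\<exists>C. \<forall>\<xi>. norm (fourier \<phi> \<xi>) * (1 + \<xi> ^ 4) \<le> C"
proof -
  obtain D where D0: "D 0 = \<phi>" and D: "schwartz_derivs D"
    using assms unfolding schwartz_def schwartz_derivs_def by blast
  note P = schwartz_derivs_props[OF D, of 0, unfolded D0]
  show "continuous_on UNIV \<phi>" "\<phi> \<in> borel_measurable borel" "integrable lborel \<phi>" by (rule P)+
  obtain C where C: "\<And>x. norm (\<phi> x) \<le> C / (1 + x\<^sup>2)" using P(3) by blast
  have C0: "0 \<le> C" using order_trans[OF norm_ge_zero C[of 0]] by simp
  have "C / (1 + x\<^sup>2) \<le> C / 1" for x by (rule divide_left_mono) (use C0 in \<open>auto intro: add_pos_nonneg\<close>)
  then have "norm (\<phi> x) \<le> C" for x using order_trans[OF C[of x]] by simp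
  then show "\<exists>C. \<forall>x. norm (\<phi> x) \<le> C" by blast
  have F4: "fourier (D 4) \<xi> = of_real (\<xi> ^ 4) * fourier \<phi> \<xi>" for \<xi>
  proof -
    have "fourier (D 4) \<xi> = fourier (D (Suc (Suc (Suc (Suc 0))))) \<xi>" by (simp add: numeral_eq_Suc)
    also have "\<dots> = (- \<i> * of_real \<xi>) ^ 4 * fourier (D 0) \<xi>"
      unfolding fourier_derivative[OF D] by (simp add: numeral_eq_Suc)
    also have "(- \<i> * of_real \<xi>) ^ 4 = of_real (\<xi> ^ 4)"
    proof -
      have "(- \<i> * of_real \<xi>)\<^sup>2 = - (complex_of_real \<xi>)\<^sup>2" by (simp add: power_mult_distrib)
      then have "((- \<i> * complex_of_real \<xi>)\<^sup>2)\<^sup>2 = (complex_of_real \<xi>)\<^sup>2 ^ 2" by simp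
      then show ?thesis by (simp flip: power_mult)
    qed
    finally show ?thesis by (simp add: D0)
  qed
  have "norm (fourier \<phi> \<xi>) * (1 + \<xi> ^ 4) \<le> (LINT x|lborel. norm (\<phi> x)) + (LINT x|lborel. norm (D 4 x))" for \<xi>
  proof -
    have "norm (fourier \<phi> \<xi>) * (1 + \<xi> ^ 4) = norm (fourier \<phi> \<xi>) + norm (fourier (D 4) \<xi>)"
      unfolding F4 by (simp add: norm_mult norm_power power_even_abs algebra_simps)
    then show ?thesis using norm_fourier_le[of \<phi> \<xi>] norm_fourier_le[of "D 4" \<xi>] by simp
  qed
  then show "\<exists>C. \<forall>\<xi>. norm (fourier \<phi> \<xi>) * (1 + \<xi> ^ 4) \<le> C" by blast
qed

lemma measurable_fourier[measurable]:
  assumes [measurable]: "f \<in> borel_measurable borel"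
  shows "fourier f \<in> borel_measurable borel"
  unfolding fourier_def[abs_def] by measurable

lemma schwartz_weighted_fourier_integrable:
  fixes w :: "real \<Rightarrow> real"
  assumes \<phi>: "schwartz \<phi>" and [measurable]: "w \<in> borel_measurable borel" and w: "\<And>\<xi>. \<bar>w \<xi>\<bar> \<le> K * (1 + \<xi>\<^sup>2)"
  shows "integrable lborel (\<lambda>\<xi>. of_real (w \<xi>) * fourier \<phi> \<xi>)"
proof -
  note [measurable] = schwartz_measurable[OF \<phi>]
  obtain C where C: "\<And>\<xi>. norm (fourier \<phi> \<xi>) * (1 + \<xi> ^ 4) \<le> C" using schwartz_fourier_decay[OF \<phi>] by blast
  have K: "0 \<le> K" using order_trans[OF abs_ge_zero w[of 0]] by simp
  show ?thesis
  proof (rule integrable_decay[where C = "2 * K * C"])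
    fix \<xi> :: real
    have pos: "0 < 1 + \<xi>\<^sup>2" by (simp add: add_pos_nonneg)
    have "0 \<le> (1 - \<xi>\<^sup>2)\<^sup>2" by simp
    then have "(1 + \<xi>\<^sup>2)\<^sup>2 \<le> 2 * (1 + \<xi> ^ 4)" by (simp add: power2_eq_square power4_eq_xxxx algebra_simps)
    then have "norm (fourier \<phi> \<xi>) * (1 + \<xi>\<^sup>2)\<^sup>2 \<le> norm (fourier \<phi> \<xi>) * (2 * (1 + \<xi> ^ 4))"
      by (rule mult_left_mono) simp
    also have "\<dots> = 2 * (norm (fourier \<phi> \<xi>) * (1 + \<xi> ^ 4))" by (simp only: mult.left_commute)
    also have "\<dots> \<le> 2 * C" by (rule mult_left_mono[OF C]) simp
    finally have a: "norm (fourier \<phi> \<xi>) * (1 + \<xi>\<^sup>2)\<^sup>2 \<le> 2 * C" .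
    have "norm (of_real (w \<xi>) * fourier \<phi> \<xi>) * (1 + \<xi>\<^sup>2) = (\<bar>w \<xi>\<bar> * norm (fourier \<phi> \<xi>)) * (1 + \<xi>\<^sup>2)"
      by (simp add: norm_mult)
    also have "\<dots> \<le> (K * (1 + \<xi>\<^sup>2) * norm (fourier \<phi> \<xi>)) * (1 + \<xi>\<^sup>2)"
      by (intro mult_right_mono w) (use pos in auto)
    also have "\<dots> = K * (norm (fourier \<phi> \<xi>) * (1 + \<xi>\<^sup>2)\<^sup>2)" by (simp add: power2_eq_square)
    also have "\<dots> \<le> K * (2 * C)" by (rule mult_left_mono[OF a K])
    finally show "norm (of_real (w \<xi>) * fourier \<phi> \<xi>) \<le> 2 * K * C / (1 + \<xi>\<^sup>2)"
      using pos by (subst pos_le_divide_eq) (simp_all add: mult_ac)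
  qed measurable
qed

lemma integrable_product_bounded:
  fixes f g :: "real \<Rightarrow> complex"
  assumes f: "integrable lborel f" and g: "integrable lborel g"
    and [measurable]: "case_prod e \<in> borel_measurable (borel \<Otimes>\<^sub>M borel)" and e: "\<And>x y. norm (e x y) \<le> 1"
  shows "integrable (lborel \<Otimes>\<^sub>M lborel) (\<lambda>(x, y). f x * g y * e x y)"
proof -
  have [measurable]: "f \<in> borel_measurable borel" "g \<in> borel_measurable borel"
    using borel_measurable_integrable[OF f] borel_measurable_integrable[OF g] by auto
  have "integrable (lborel \<Otimes>\<^sub>M lborel) (\<lambda>(x, y). f x * g y)"
  proof (rule lborel_pair.Fubini_integrable)
    show "integrable lborel (\<lambda>x. LINT y|lborel. norm (case (x, y) of (x, y) \<Rightarrow> f x * g y))"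
      using f by (simp add: norm_mult)
  qed (use g in auto)
  then show ?thesis
  proof (rule Bochner_Integration.integrable_bound)
    have [measurable]: "case_prod e \<in> borel_measurable (lborel \<Otimes>\<^sub>M lborel)"
      using assms(3) by (simp cong: measurable_cong_sets add: sets_pair_measure_cong[OF sets_lborel sets_lborel])
    show "(\<lambda>(x, y). f x * g y * e x y) \<in> borel_measurable (lborel \<Otimes>\<^sub>M lborel)" by measurable
    show "AE x in lborel \<Otimes>\<^sub>M lborel. norm (case x of (x, y) \<Rightarrow> f x * g y * e x y) \<le> norm (case x of (x, y) \<Rightarrow> f x * g y)"
      by (intro AE_I2) (auto simp: norm_mult e intro!: mult_left_le)
  qed
qed

lemma fourier_swap:
  fixes f \<psi> :: "real \<Rightarrow> complex"
  assumes f: "integrable lborel f" and \<psi>: "integrable lborel \<psi>"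
  shows "(LINT x|lborel. f x * (LINT \<xi>|lborel. iexp (- (\<xi> * x)) * \<psi> \<xi>)) = (LINT \<xi>|lborel. \<psi> \<xi> * fourier f (- \<xi>))"
proof -
  have I: "integrable (lborel \<Otimes>\<^sub>M lborel) (\<lambda>(x, \<xi>). f x * \<psi> \<xi> * iexp (- (\<xi> * x)))"
  proof (rule integrable_product_bounded[OF f \<psi>])
    show "(\<lambda>(x, \<xi>). iexp (- (\<xi> * x))) \<in> borel_measurable (borel \<Otimes>\<^sub>M borel)" by measurable
  qed simp
  have "(LINT x|lborel. f x * (LINT \<xi>|lborel. iexp (- (\<xi> * x)) * \<psi> \<xi>)) = (LINT x|lborel. LINT \<xi>|lborel. f x * \<psi> \<xi> * iexp (- (\<xi> * x)))"
    unfolding integral_mult_right_zero[symmetric] by (simp add: mult_ac)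
  also have "\<dots> = (LINT \<xi>|lborel. LINT x|lborel. f x * \<psi> \<xi> * iexp (- (\<xi> * x)))"
    by (rule lborel_pair.Fubini_integral[OF I, symmetric])
  also have "\<dots> = (LINT \<xi>|lborel. \<psi> \<xi> * fourier f (- \<xi>))"
    unfolding fourier_def integral_mult_right_zero[symmetric] by (simp add: mult_ac)
  finally show ?thesis .
qed

text \<open>Up to the factor \<open>2 * pi\<close>, the Fourier transform of a Gaussian of width \<open>1 / s\<close> is the
  normal density of standard deviation \<open>s\<close>.\<close>

lemma gaussian_reciprocal:
  assumes s: "0 < s"
  shows "sqrt (2 * pi * (1 / s)\<^sup>2) * exp (- ((1 / s)\<^sup>2 * z\<^sup>2) / 2) = 2 * pi * normal_density 0 s z"
proof -
  define S where "S = sqrt (2 * pi)"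
  have S: "0 < S" "2 * pi = S * S" by (simp_all add: S_def)
  have 1: "sqrt (2 * pi * (1 / s)\<^sup>2) = S / s" using s by (simp add: S_def real_sqrt_mult real_sqrt_divide power_divide)
  have 2: "sqrt (2 * pi * s\<^sup>2) = S * s" using s by (simp add: S_def real_sqrt_mult)
  have 3: "- ((1 / s)\<^sup>2 * z\<^sup>2) / 2 = - (z - 0)\<^sup>2 / (2 * s\<^sup>2)" by (simp add: power_divide)
  show ?thesis unfolding normal_density_def 1 2 3 unfolding S(2) using S(1) s by simp
qed

text \<open>With the additional factor \<open>exp (- (s * \<xi>)\<^sup>2 / 2)\<close> under the integral, Fubini's theorem turns
  the right-hand side into the convolution of \<open>\<phi>\<close> with the normal density of standard deviation
  \<open>s\<close>. For \<open>s = 1 / (n + 1)\<close> both expressions converge to the two sides of the inversion formula.\<close>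

lemma fourier_inversion:
  assumes \<phi>: "schwartz \<phi>"
  shows "\<phi> x = 1 / (2 * of_real pi) * (LINT \<xi>|lborel. iexp (- (\<xi> * x)) * fourier \<phi> \<xi>)"
proof -
  note [measurable] = schwartz_measurable[OF \<phi>]
  have I\<phi>: "integrable lborel \<phi>" by (rule schwartz_integrable[OF \<phi>])
  have IF: "integrable lborel (fourier \<phi>)"
    using schwartz_weighted_fourier_integrable[OF \<phi>, of "\<lambda>_. 1" 1] by simp
  let ?s = "\<lambda>n. 1 / real (Suc n)"
  let ?g = "\<lambda>n \<xi>. exp (- ((?s n)\<^sup>2 * \<xi>\<^sup>2) / 2)"
  obtain C where C: "\<And>x. norm (\<phi> x) \<le> C" using schwartz_bounded[OF \<phi>] by blast
  have C0: "0 \<le> C" using order_trans[OF norm_ge_zero C[of 0]] .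
  have L1: "(\<lambda>n. LINT y|lborel. normal_density x (?s n) y *\<^sub>R \<phi> y) \<longlonglongrightarrow> \<phi> x"
  proof (rule gaussian_approximate_identity[OF schwartz_continuous[OF \<phi>], of C])
    fix y
    have "C * 1 \<le> C * (1 + y\<^sup>2)" by (rule mult_left_mono) (use C0 in auto)
    then show "norm (\<phi> y) \<le> C * (1 + y\<^sup>2)" using C[of y] by simp
  qed
  have gI: "integrable lborel (\<lambda>\<xi>. of_real (?g n \<xi>) * iexp (- (\<xi> * x)) :: complex)" for n
  proof -
    have "integrable lborel (normal_density 0 (1 / ?s n))" by (rule integrable_normal_density) simp
    then have "integrable lborel (\<lambda>\<xi>. sqrt (2 * pi * (1 / ?s n)\<^sup>2) * normal_density 0 (1 / ?s n) \<xi>)"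
      by (rule integrable_mult_right)
    also have "(\<lambda>\<xi>. sqrt (2 * pi * (1 / ?s n)\<^sup>2) * normal_density 0 (1 / ?s n) \<xi>) = ?g n"
      by (intro ext) (simp add: normal_density_def power_divide field_simps del: of_nat_Suc)
    finally show ?thesis
      by (rule Bochner_Integration.integrable_bound) (auto simp: norm_mult)
  qed
  have G: "(LINT \<xi>|lborel. of_real (?g n \<xi>) * iexp (\<xi> * z)) = of_real (2 * pi * normal_density 0 (?s n) z)" for n z
  proof -
    let ?t = "1 / ?s n"
    have tp: "0 < ?t" by simp
    have e: "of_real (?g n \<xi>) * iexp (\<xi> * z) = sqrt (2 * pi * ?t\<^sup>2) *\<^sub>R (normal_density 0 ?t \<xi> *\<^sub>R iexp (z * \<xi>))" for \<xi>
      by (simp add: normal_density_def power_divide field_simps scaleR_conv_of_real del: of_nat_Suc)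
    have "(LINT \<xi>|lborel. of_real (?g n \<xi>) * iexp (\<xi> * z)) = sqrt (2 * pi * ?t\<^sup>2) *\<^sub>R (iexp (z * 0) * of_real (exp (- (?t\<^sup>2 * z\<^sup>2) / 2)))"
      unfolding e integral_scaleR_right integral_normal_density_iexp[OF tp] ..
    also have "\<dots> = of_real (2 * pi * normal_density 0 (?s n) z)"
      using gaussian_reciprocal[of "?s n" z] by (simp add: scaleR_conv_of_real del: of_nat_Suc flip: of_real_mult)
    finally show ?thesis .
  qed
  have E: "(LINT y|lborel. normal_density x (?s n) y *\<^sub>R \<phi> y) =
     1 / (2 * of_real pi) * (LINT \<xi>|lborel. (of_real (?g n \<xi>) * iexp (- (\<xi> * x))) * fourier \<phi> \<xi>)" for n
  proof -
    have I: "integrable (lborel \<Otimes>\<^sub>M lborel) (\<lambda>(y, \<xi>). \<phi> y * (of_real (?g n \<xi>) * iexp (- (\<xi> * x))) * iexp (\<xi> * y))"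
    proof (rule integrable_product_bounded[OF I\<phi> gI])
      show "(\<lambda>(y, \<xi>). iexp (\<xi> * y)) \<in> borel_measurable (borel \<Otimes>\<^sub>M borel)" by measurable
    qed simp
    have "(LINT \<xi>|lborel. (of_real (?g n \<xi>) * iexp (- (\<xi> * x))) * fourier \<phi> \<xi>) =
       (LINT \<xi>|lborel. LINT y|lborel. \<phi> y * (of_real (?g n \<xi>) * iexp (- (\<xi> * x))) * iexp (\<xi> * y))"
      unfolding fourier_def integral_mult_right_zero[symmetric] by (simp add: mult_ac)
    also have "\<dots> = (LINT y|lborel. LINT \<xi>|lborel. \<phi> y * (of_real (?g n \<xi>) * iexp (- (\<xi> * x))) * iexp (\<xi> * y))"
      by (rule lborel_pair.Fubini_integral[OF I])
    also have "\<dots> = (LINT y|lborel. (2 * of_real pi) * (normal_density x (?s n) y *\<^sub>R \<phi> y))"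
    proof (rule Bochner_Integration.integral_cong[OF refl])
      fix y
      have e: "\<phi> y * (of_real (?g n \<xi>) * iexp (- (\<xi> * x))) * iexp (\<xi> * y) = \<phi> y * (of_real (?g n \<xi>) * iexp (\<xi> * (y - x)))" for \<xi>
        by (simp add: mult.assoc exp_add[symmetric] algebra_simps)
      have "normal_density 0 (?s n) (y - x) = normal_density x (?s n) y" by (simp add: normal_density_def)
      then show "(LINT \<xi>|lborel. \<phi> y * (of_real (?g n \<xi>) * iexp (- (\<xi> * x))) * iexp (\<xi> * y)) = (2 * of_real pi) * (normal_density x (?s n) y *\<^sub>R \<phi> y)"
        unfolding e integral_mult_right_zero G by (simp add: scaleR_conv_of_real)
    qed
    also have "\<dots> = (2 * of_real pi) * (LINT y|lborel. normal_density x (?s n) y *\<^sub>R \<phi> y)"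
      by (rule integral_mult_right_zero)
    finally show ?thesis by simp
  qed
  have L2: "(\<lambda>n. LINT \<xi>|lborel. (of_real (?g n \<xi>) * iexp (- (\<xi> * x))) * fourier \<phi> \<xi>) \<longlonglongrightarrow> (LINT \<xi>|lborel. iexp (- (\<xi> * x)) * fourier \<phi> \<xi>)"
  proof (rule integral_dominated_convergence[where w = "\<lambda>\<xi>. norm (fourier \<phi> \<xi>)"])
    show "AE \<xi> in lborel. (\<lambda>n. (of_real (?g n \<xi>) * iexp (- (\<xi> * x))) * fourier \<phi> \<xi>) \<longlonglongrightarrow> iexp (- (\<xi> * x)) * fourier \<phi> \<xi>"
    proof (rule AE_I2)
      fix \<xi> :: real
      have "(\<lambda>n. ?g n \<xi>) \<longlonglongrightarrow> 1" by real_asymp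
      then have "(\<lambda>n. (of_real (?g n \<xi>) * iexp (- (\<xi> * x))) * fourier \<phi> \<xi>) \<longlonglongrightarrow> (of_real 1 * iexp (- (\<xi> * x))) * fourier \<phi> \<xi>"
        by (intro tendsto_intros)
      then show "(\<lambda>n. (of_real (?g n \<xi>) * iexp (- (\<xi> * x))) * fourier \<phi> \<xi>) \<longlonglongrightarrow> iexp (- (\<xi> * x)) * fourier \<phi> \<xi>" by simp
    qed
    show "AE \<xi> in lborel. norm ((of_real (?g n \<xi>) * iexp (- (\<xi> * x))) * fourier \<phi> \<xi>) \<le> norm (fourier \<phi> \<xi>)" for n
    proof (rule AE_I2)
      fix \<xi> :: real
      have "?g n \<xi> * norm (fourier \<phi> \<xi>) \<le> 1 * norm (fourier \<phi> \<xi>)" by (rule mult_right_mono) auto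
      then show "norm ((of_real (?g n \<xi>) * iexp (- (\<xi> * x))) * fourier \<phi> \<xi>) \<le> norm (fourier \<phi> \<xi>)"
        by (simp add: norm_mult)
    qed
  qed (use IF in auto)
  have "(\<lambda>n. 1 / (2 * of_real pi) * (LINT \<xi>|lborel. (of_real (?g n \<xi>) * iexp (- (\<xi> * x))) * fourier \<phi> \<xi>)) \<longlonglongrightarrow>
     1 / (2 * of_real pi) * (LINT \<xi>|lborel. iexp (- (\<xi> * x)) * fourier \<phi> \<xi>)"
    by (intro tendsto_mult tendsto_const L2)
  then show ?thesis using L1 unfolding E by (rule LIMSEQ_unique[rotated])
qed

text \<open>Parseval's formula: the inversion formula for \<open>\<phi>\<close> together with Fubini's theorem.\<close>

lemma pairing_fourier:
  assumes \<phi>: "schwartz \<phi>" and u: "integrable lborel (\<lambda>x. u x t)"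
  shows "pairing u \<phi> t = 1 / (2 * of_real pi) * (LINT \<xi>|lborel. fourier \<phi> \<xi> * fourier (\<lambda>x. of_real (u x t)) (- \<xi>))"
proof -
  have IF: "integrable lborel (fourier \<phi>)"
    using schwartz_weighted_fourier_integrable[OF \<phi>, of "\<lambda>_. 1" 1] by simp
  have "pairing u \<phi> t = (LINT x|lborel. (1 / (2 * of_real pi)) * (of_real (u x t) * (LINT \<xi>|lborel. iexp (- (\<xi> * x)) * fourier \<phi> \<xi>)))"
    unfolding pairing_def by (subst fourier_inversion[OF \<phi>]) (simp only: mult.left_commute)
  also have "\<dots> = 1 / (2 * of_real pi) * (LINT \<xi>|lborel. fourier \<phi> \<xi> * fourier (\<lambda>x. of_real (u x t)) (- \<xi>))"
    unfolding integral_mult_right_zero by (subst fourier_swap) (use u IF in auto)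
  finally show ?thesis .
qed

section \<open>Gaussian wave packets\<close>

text \<open>A plane wave with a Gaussian envelope of width \<open>1 / s\<close>. As \<open>s\<close> tends to 0 it approaches the
  plane wave, while its Fourier transform concentrates at \<open>- \<xi>0\<close>.\<close>

definition gaussian_wave :: "real \<Rightarrow> real \<Rightarrow> real \<Rightarrow> complex" where
  "gaussian_wave \<xi>0 s x = iexp (\<xi>0 * x) * of_real (exp (- (s\<^sup>2 * x\<^sup>2) / 2))"

lemma gaussian_wave_norm_le: "norm (gaussian_wave \<xi>0 s x) \<le> 1"
  by (simp add: gaussian_wave_def norm_mult)

lemma gaussian_wave_has_derivative:
  "(gaussian_wave \<xi>0 s has_vector_derivative (\<i> * of_real \<xi>0 - of_real (s\<^sup>2 * x)) * gaussian_wave \<xi>0 s x) (at x)"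
proof -
  have e: "((\<lambda>x. iexp (\<xi>0 * x)) has_vector_derivative (\<i> * of_real \<xi>0) * iexp (\<xi>0 * x)) (at x)"
    unfolding has_vector_derivative_complex_iff[where f = "\<lambda>x. iexp (\<xi>0 * x)"]
    by (auto intro!: derivative_eq_intros simp: Re_exp Im_exp)
  have r: "((\<lambda>x. exp (- (s\<^sup>2 * x\<^sup>2) / 2)) has_real_derivative (- (s\<^sup>2 * x) * exp (- (s\<^sup>2 * x\<^sup>2) / 2))) (at x)"
    by (auto intro!: derivative_eq_intros simp: power2_eq_square)
  have g: "((\<lambda>x. complex_of_real (exp (- (s\<^sup>2 * x\<^sup>2) / 2))) has_vector_derivative of_real (- (s\<^sup>2 * x) * exp (- (s\<^sup>2 * x\<^sup>2) / 2))) (at x)"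
    by (rule has_vector_derivative_of_real) (use r in \<open>simp add: has_real_derivative_iff_has_vector_derivative\<close>)
  show ?thesis
    unfolding gaussian_wave_def[abs_def]
    using has_vector_derivative_mult[OF e g] by (simp add: algebra_simps)
qed

text \<open>A single term of the exponential series is enough: \<open>y ^ m / fact m \<le> exp y\<close> for \<open>y \<ge> 0\<close>.\<close>

lemma bounded_power_gaussian:
  fixes s :: real
  assumes s: "0 < s"
  shows "bounded (range (\<lambda>x. x ^ m *\<^sub>R gaussian_wave \<xi>0 s x))"
proof -
  define c where "c = s\<^sup>2 / 2"
  have c: "0 < c" using s by (simp add: c_def)
  have "norm (x ^ m *\<^sub>R gaussian_wave \<xi>0 s x) \<le> 1 + fact m / c ^ m" for x
  proof -
    have n: "norm (x ^ m *\<^sub>R gaussian_wave \<xi>0 s x) = \<bar>x\<bar> ^ m * exp (- (c * x\<^sup>2))"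
      by (simp add: gaussian_wave_def norm_mult c_def power_abs)
    have "(c * x\<^sup>2) ^ m / fact m \<le> exp (c * x\<^sup>2)"
    proof -
      have y: "0 \<le> c * x\<^sup>2" using c by simp
      have "(\<lambda>n. (c * x\<^sup>2) ^ n /\<^sub>R fact n) sums exp (c * x\<^sup>2)" by (rule exp_converges)
      then have "sum (\<lambda>n. (c * x\<^sup>2) ^ n /\<^sub>R fact n) {m} \<le> exp (c * x\<^sup>2)"
        using y by (intro sum_le_suminf[of _ "{m}", THEN order_trans]) (auto simp: sums_iff)
      then show ?thesis by (simp add: divide_inverse mult.commute)
    qed
    then have "(c * x\<^sup>2) ^ m \<le> fact m * exp (c * x\<^sup>2)" by (simp add: field_simps)
    then have "c ^ m * (x\<^sup>2) ^ m \<le> fact m * exp (c * x\<^sup>2)" by (simp add: power_mult_distrib)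
    then have A: "(x\<^sup>2) ^ m \<le> fact m / c ^ m * exp (c * x\<^sup>2)" using c by (simp add: field_simps)
    have B: "\<bar>x\<bar> ^ m \<le> 1 + (x\<^sup>2) ^ m"
    proof (cases "\<bar>x\<bar> \<le> 1")
      case True
      then have "\<bar>x\<bar> ^ m \<le> 1" by (simp add: power_le_one)
      moreover have "0 \<le> (x\<^sup>2) ^ m" by simp
      ultimately show ?thesis by linarith
    next
      case False
      have "\<bar>x\<bar> ^ 1 \<le> \<bar>x\<bar> ^ 2" by (rule power_increasing) (use False in auto)
      then have "\<bar>x\<bar> ^ m \<le> (\<bar>x\<bar>\<^sup>2) ^ m" by (intro power_mono) auto
      then show ?thesis by simp
    qed
    have "\<bar>x\<bar> ^ m * exp (- (c * x\<^sup>2)) \<le> (1 + fact m / c ^ m * exp (c * x\<^sup>2)) * exp (- (c * x\<^sup>2))"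
      by (rule mult_right_mono) (use A B in auto)
    also have "\<dots> = exp (- (c * x\<^sup>2)) + fact m / c ^ m" by (simp add: algebra_simps exp_minus)
    also have "\<dots> \<le> 1 + fact m / c ^ m" using c by simp
    finally show ?thesis unfolding n .
  qed
  then show ?thesis unfolding bounded_iff by blast
qed

text \<open>All derivatives are polynomial multiples of the wave packet itself; \<open>P n\<close> is the polynomial
  that belongs to the derivative of order \<open>n\<close>.\<close>

lemma schwartz_gaussian_wave:
  assumes s: "0 < s"
  shows "schwartz (gaussian_wave \<xi>0 s)"
proof -
  define P where "P = (\<lambda>n. ((\<lambda>p. pderiv p + [:\<i> * of_real \<xi>0, - of_real (s\<^sup>2):] * p) ^^ n) 1)"
  define D where "D = (\<lambda>n x. poly (P n) (of_real x) * gaussian_wave \<xi>0 s x)"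
  have "D 0 = gaussian_wave \<xi>0 s" by (simp add: D_def P_def fun_eq_iff)
  moreover have "(D n has_vector_derivative D (Suc n) x) (at x)" for n x
  proof -
    have "((\<lambda>x. poly (P n) (of_real x)) has_vector_derivative poly (pderiv (P n)) (of_real x)) (at x)"
      by (rule has_vector_derivative_real_field) (rule poly_DERIV)
    from has_vector_derivative_mult[OF this gaussian_wave_has_derivative]
    show ?thesis by (simp add: D_def P_def algebra_simps)
  qed
  moreover have "bounded (range (\<lambda>x. x ^ m *\<^sub>R (poly p (of_real x) * gaussian_wave \<xi>0 s x)))" for m and p :: "complex poly"
  proof (induction p arbitrary: m)
    case 0
    then show ?case by simp
  next
    case (pCons a p)
    have e: "x ^ m *\<^sub>R (poly (pCons a p) (of_real x) * gaussian_wave \<xi>0 s x) =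
       a * (x ^ m *\<^sub>R gaussian_wave \<xi>0 s x) + x ^ Suc m *\<^sub>R (poly p (of_real x) * gaussian_wave \<xi>0 s x)" for x
      by (simp add: algebra_simps scaleR_conv_of_real)
    obtain C1 where C1: "\<And>x. norm (x ^ m *\<^sub>R gaussian_wave \<xi>0 s x) \<le> C1"
      using bounded_power_gaussian[OF s, of m \<xi>0] unfolding bounded_iff by blast
    obtain C2 where C2: "\<And>x. norm (x ^ Suc m *\<^sub>R (poly p (of_real x) * gaussian_wave \<xi>0 s x)) \<le> C2"
      using pCons.IH[of "Suc m"] unfolding bounded_iff by blast
    have "norm (x ^ m *\<^sub>R (poly (pCons a p) (of_real x) * gaussian_wave \<xi>0 s x)) \<le> norm a * C1 + C2" for x
      unfolding e by (rule order_trans[OF norm_triangle_ineq])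
        (intro add_mono C2, simp only: norm_mult, rule mult_left_mono[OF C1 norm_ge_zero])
    then show ?case unfolding bounded_iff by blast
  qed
  ultimately show ?thesis unfolding schwartz_def by (intro exI[of _ D]) (auto simp: D_def)
qed

lemma fourier_gaussian_wave:
  assumes s: "0 < s"
  shows "fourier (gaussian_wave \<xi>0 s) \<xi> = of_real (2 * pi * normal_density (- \<xi>0) s \<xi>)"
proof -
  let ?t = "1 / s"
  have tp: "0 < ?t" using s by simp
  have e: "iexp (\<xi> * x) * gaussian_wave \<xi>0 s x = sqrt (2 * pi * ?t\<^sup>2) *\<^sub>R (normal_density 0 ?t x *\<^sub>R iexp ((\<xi> + \<xi>0) * x))" for x
  proof -
    have n: "exp (- (s\<^sup>2 * x\<^sup>2) / 2) = sqrt (2 * pi * ?t\<^sup>2) * normal_density 0 ?t x"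
      using s by (simp add: normal_density_def power_divide)
    have m: "iexp (\<xi> * x) * iexp (\<xi>0 * x) = iexp ((\<xi> + \<xi>0) * x)"
      by (simp add: exp_add[symmetric] algebra_simps)
    show ?thesis
      unfolding gaussian_wave_def n mult.assoc[symmetric] m
      by (simp add: scaleR_conv_of_real)
  qed
  have "fourier (gaussian_wave \<xi>0 s) \<xi> = sqrt (2 * pi * ?t\<^sup>2) *\<^sub>R (iexp ((\<xi> + \<xi>0) * 0) * of_real (exp (- (?t\<^sup>2 * (\<xi> + \<xi>0)\<^sup>2) / 2)))"
    unfolding fourier_def e integral_scaleR_right integral_normal_density_iexp[OF tp] ..
  also have "\<dots> = of_real (2 * pi * normal_density 0 s (\<xi> + \<xi>0))"
    using gaussian_reciprocal[OF s, of "\<xi> + \<xi>0"] by (simp add: scaleR_conv_of_real flip: of_real_mult)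
  also have "normal_density 0 s (\<xi> + \<xi>0) = normal_density (- \<xi>0) s \<xi>" by (simp add: normal_density_def)
  finally show ?thesis .
qed

section \<open>The spatial operator on the Fourier side\<close>

lemma powr_symbol_bound:
  fixes lam \<alpha> \<xi> :: real
  assumes "0 < \<alpha>" "\<alpha> < 1" "0 \<le> lam"
  shows "(lam + \<xi>\<^sup>2) powr \<alpha> \<le> (1 + lam) * (1 + \<xi>\<^sup>2)"
proof -
  have x: "0 \<le> lam + \<xi>\<^sup>2" using assms by simp
  have "(lam + \<xi>\<^sup>2) powr \<alpha> \<le> 1 + (lam + \<xi>\<^sup>2)"
  proof (cases "lam + \<xi>\<^sup>2 \<le> 1")
    case True
    have "(lam + \<xi>\<^sup>2) powr \<alpha> \<le> 1 powr \<alpha>" by (rule powr_mono2) (use assms True x in auto)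
    then show ?thesis using x by simp
  next
    case False
    have "(lam + \<xi>\<^sup>2) powr \<alpha> \<le> (lam + \<xi>\<^sup>2) powr 1" by (rule powr_mono) (use assms False in auto)
    then show ?thesis using x by simp
  qed
  also have "\<dots> \<le> (1 + lam) * (1 + \<xi>\<^sup>2)" using assms by (simp add: algebra_simps)
  finally show ?thesis .
qed

lemma continuous_powr_symbol:
  fixes lam \<alpha> :: real
  assumes "0 < \<alpha>" "0 \<le> lam"
  shows "continuous_on UNIV (\<lambda>\<xi>. (lam + \<xi>\<^sup>2) powr \<alpha>)"
  by (rule continuous_on_powr') (use assms in \<open>auto intro!: continuous_intros\<close>)

lemma theta_nonneg: "0 < \<alpha> \<Longrightarrow> 0 \<le> lam \<Longrightarrow> 0 \<le> theta \<alpha> lam \<xi>"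
  unfolding theta_def using powr_mono2[of \<alpha> lam "lam + \<xi>\<^sup>2"] by simp

lemma theta_bound:
  assumes "0 < \<alpha>" "\<alpha> < 1" "0 \<le> lam"
  shows "\<bar>theta \<alpha> lam \<xi>\<bar> \<le> (1 + lam) * (1 + \<xi>\<^sup>2)"
  using theta_nonneg[of \<alpha> lam \<xi>] powr_symbol_bound[of \<alpha> lam \<xi>] assms powr_ge_zero[of lam \<alpha>]
  unfolding theta_def by linarith

lemma theta_minus: "theta \<alpha> lam (- \<xi>) = theta \<alpha> lam \<xi>"
  by (simp add: theta_def)

lemma measurable_theta[measurable]: "theta \<alpha> lam \<in> borel_measurable borel"
  unfolding theta_def[abs_def] by measurable

text \<open>On the Fourier side the spatial operator of the equation is multiplication with
  \<open>- theta \<alpha> lam \<xi>\<close>.\<close>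

lemma pairing_operator_fourier:
  assumes par: "0 < \<alpha>" "\<alpha> < 1" "0 \<le> lam" and \<phi>: "schwartz \<phi>" and u: "integrable lborel (\<lambda>x. u x t)"
  shows "pairing u (\<lambda>x. of_real (lam powr \<alpha>) * \<phi> x - frac_power_op lam \<alpha> \<phi> x) t =
    1 / (2 * of_real pi) * (LINT \<xi>|lborel. of_real (- theta \<alpha> lam \<xi>) * fourier \<phi> \<xi> * fourier (\<lambda>x. of_real (u x t)) (- \<xi>))"
proof -
  note [measurable] = schwartz_measurable[OF \<phi>]
  let ?m = "\<lambda>\<xi>. (lam + \<xi>\<^sup>2) powr \<alpha>"
  have IF: "integrable lborel (fourier \<phi>)"
    using schwartz_weighted_fourier_integrable[OF \<phi>, of "\<lambda>_. 1" 1] by simp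
  have Im: "integrable lborel (\<lambda>\<xi>. of_real (?m \<xi>) * fourier \<phi> \<xi>)"
    by (rule schwartz_weighted_fourier_integrable[OF \<phi>, where K = "1 + lam"]) (use powr_symbol_bound[OF par] in auto)
  have It: "integrable lborel (\<lambda>\<xi>. of_real (- theta \<alpha> lam \<xi>) * fourier \<phi> \<xi>)"
    by (rule schwartz_weighted_fourier_integrable[OF \<phi>, where K = "1 + lam"]) (use theta_bound[OF par] in auto)
  have inv: "of_real (lam powr \<alpha>) * \<phi> x - frac_power_op lam \<alpha> \<phi> x =
     1 / (2 * of_real pi) * (LINT \<xi>|lborel. iexp (- (\<xi> * x)) * (of_real (- theta \<alpha> lam \<xi>) * fourier \<phi> \<xi>))" for x
  proof -
    have a: "integrable lborel (\<lambda>\<xi>. of_real (lam powr \<alpha>) * (iexp (- (\<xi> * x)) * fourier \<phi> \<xi>))"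
      using integrable_iexp_mult[OF IF, of "- x"] by (intro integrable_mult_right) (simp add: mult.commute)
    have b: "integrable lborel (\<lambda>\<xi>. iexp (- (\<xi> * x)) * (of_real (?m \<xi>) * fourier \<phi> \<xi>))"
      using integrable_iexp_mult[OF Im, of "- x"] by (simp add: mult.commute)
    have "(LINT \<xi>|lborel. iexp (- (\<xi> * x)) * (of_real (- theta \<alpha> lam \<xi>) * fourier \<phi> \<xi>)) =
      (LINT \<xi>|lborel. of_real (lam powr \<alpha>) * (iexp (- (\<xi> * x)) * fourier \<phi> \<xi>) - iexp (- (\<xi> * x)) * (of_real (?m \<xi>) * fourier \<phi> \<xi>))"
      by (rule Bochner_Integration.integral_cong) (auto simp: theta_def algebra_simps)
    also have "\<dots> = of_real (lam powr \<alpha>) * (LINT \<xi>|lborel. iexp (- (\<xi> * x)) * fourier \<phi> \<xi>) -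
        (LINT \<xi>|lborel. iexp (- (\<xi> * x)) * (of_real (?m \<xi>) * fourier \<phi> \<xi>))"
      unfolding Bochner_Integration.integral_diff[OF a b] integral_mult_right_zero ..
    finally show ?thesis
      unfolding frac_power_op_def by (subst fourier_inversion[OF \<phi>, of x]) (simp add: algebra_simps diff_divide_distrib)
  qed
  have "pairing u (\<lambda>x. of_real (lam powr \<alpha>) * \<phi> x - frac_power_op lam \<alpha> \<phi> x) t =
    (LINT x|lborel. (1 / (2 * of_real pi)) * (of_real (u x t) * (LINT \<xi>|lborel. iexp (- (\<xi> * x)) * (of_real (- theta \<alpha> lam \<xi>) * fourier \<phi> \<xi>))))"
    unfolding pairing_def inv by (simp only: mult.left_commute)
  also have "\<dots> = 1 / (2 * of_real pi) * (LINT \<xi>|lborel. of_real (- theta \<alpha> lam \<xi>) * fourier \<phi> \<xi> * fourier (\<lambda>x. of_real (u x t)) (- \<xi>))"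
    unfolding integral_mult_right_zero by (subst fourier_swap) (use u It in auto)
  finally show ?thesis .
qed

section \<open>Injectivity of the Fourier transform\<close>

text \<open>Normalised to total mass 1, both functions are probability densities whose characteristic
  functions agree, so Levy's uniqueness theorem applies. The common mass \<open>c\<close> is the value of the
  transforms at frequency 0.\<close>

lemma fourier_injective_nonneg:
  fixes f g :: "real \<Rightarrow> real"
  assumes f: "integrable lborel f" "\<And>x. 0 \<le> f x" and g: "integrable lborel g" "\<And>x. 0 \<le> g x"
    and eq: "\<And>\<xi>. fourier (\<lambda>x. of_real (f x)) \<xi> = fourier (\<lambda>x. of_real (g x)) \<xi>"
  shows "AE x in lborel. f x = g x"
proof -
  have [measurable]: "f \<in> borel_measurable borel" "g \<in> borel_measurable borel"
    using borel_measurable_integrable[OF f(1)] borel_measurable_integrable[OF g(1)] by auto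
  define c where "c = (LINT x|lborel. f x)"
  have cg: "c = (LINT x|lborel. g x)"
    using eq[of 0] unfolding fourier_def c_def by simp
  have c0: "0 \<le> c" unfolding c_def by (rule Bochner_Integration.integral_nonneg) (use f in auto)
  show ?thesis
  proof (cases "c = 0")
    case True
    have "AE x in lborel. f x = 0" "AE x in lborel. g x = 0"
      using integral_nonneg_eq_0_iff_AE[OF f(1)] integral_nonneg_eq_0_iff_AE[OF g(1)] f g True cg c_def by auto
    then show ?thesis by eventually_elim simp
  next
    case False
    then have c: "0 < c" using c0 by simp
    define N where "N = (\<lambda>h :: real \<Rightarrow> real. density lborel (\<lambda>x :: real. ennreal (h x / c)))"
    have R: "real_distribution (N h)" if "integrable lborel h" "\<And>x. 0 \<le> h x" "(LINT x|lborel. h x) = c" for h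
    proof -
      have [measurable]: "h \<in> borel_measurable borel" using borel_measurable_integrable[OF that(1)] by simp
      have "(\<integral>\<^sup>+x. ennreal (h x / c) \<partial>lborel) = ennreal (LINT x|lborel. h x / c)"
        by (rule nn_integral_eq_integral) (use that c in auto)
      also have "\<dots> = 1" using that c by simp
      finally have "prob_space (N h)" unfolding N_def
        by (intro prob_spaceI) (simp add: emeasure_density)
      then show ?thesis
        unfolding real_distribution_def real_distribution_axioms_def by (simp add: N_def)
    qed
    have C: "char (N h) \<xi> = fourier (\<lambda>x. of_real (h x)) \<xi> / c" if "integrable lborel h" "\<And>x. 0 \<le> h x" for h \<xi>
    proof -
      have [measurable]: "h \<in> borel_measurable borel" using borel_measurable_integrable[OF that(1)] by simp
      have "char (N h) \<xi> = (LINT x|lborel. (h x / c) *\<^sub>R iexp (\<xi> * x))"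
        unfolding char_def N_def by (rule integral_density) (use that c in auto)
      also have "\<dots> = (LINT x|lborel. (1 / of_real c) * (iexp (\<xi> * x) * of_real (h x)))"
        by (rule Bochner_Integration.integral_cong) (auto simp: scaleR_conv_of_real)
      finally show ?thesis unfolding fourier_def integral_mult_right_zero by simp
    qed
    have "N f = N g"
      by (rule Levy_uniqueness) (use f g c_def cg R C eq in \<open>auto simp: fun_eq_iff\<close>)
    then have "AE x in lborel. ennreal (f x / c) = ennreal (g x / c)"
      unfolding N_def by (subst (asm) sigma_finite_measure.density_unique_iff[OF sigma_finite_lborel]) auto
    then show ?thesis
    proof eventually_elim
      case (elim x)
      then have "f x / c = g x / c" using f(2)[of x] g(2)[of x] c by simp
      then show ?case using c by simp
    qed
  qed
qed

text \<open>Adding the negative part of \<open>f\<close> on both sides reduces this to nonnegative functions.\<close>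

lemma fourier_injective:
  fixes f g :: "real \<Rightarrow> real"
  assumes f: "integrable lborel f" and g: "integrable lborel g" "\<And>x. 0 \<le> g x"
    and eq: "\<And>\<xi>. fourier (\<lambda>x. of_real (f x)) \<xi> = fourier (\<lambda>x. of_real (g x)) \<xi>"
  shows "AE x in lborel. f x = g x"
proof -
  let ?p = "\<lambda>x. max 0 (f x)" and ?m = "\<lambda>x. max 0 (- f x)"
  have I: "integrable lborel ?p" "integrable lborel ?m" using f by auto
  have "AE x in lborel. ?p x = ?m x + g x"
  proof (rule fourier_injective_nonneg)
    fix \<xi>
    have J: "integrable lborel (\<lambda>x. iexp (\<xi> * x) * complex_of_real (h x))" if "integrable lborel h" for h
      by (rule integrable_iexp_mult) (use that in auto)
    have "fourier (\<lambda>x. of_real (?p x)) \<xi> = fourier (\<lambda>x. of_real (f x)) \<xi> + fourier (\<lambda>x. of_real (?m x)) \<xi>"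
      unfolding fourier_def by (subst Bochner_Integration.integral_add[symmetric, OF J[OF f] J[OF I(2)]])
        (auto intro!: Bochner_Integration.integral_cong simp: max_def algebra_simps)
    moreover have "fourier (\<lambda>x. of_real (?m x + g x)) \<xi> = fourier (\<lambda>x. of_real (?m x)) \<xi> + fourier (\<lambda>x. of_real (g x)) \<xi>"
      unfolding fourier_def by (subst Bochner_Integration.integral_add[symmetric, OF J[OF I(2)] J[OF g(1)]])
        (auto intro!: Bochner_Integration.integral_cong simp: algebra_simps)
    ultimately show "fourier (\<lambda>x. of_real (?p x)) \<xi> = fourier (\<lambda>x. of_real (?m x + g x)) \<xi>" using eq by simp
  qed (use I g in auto)
  then show ?thesis
  proof eventually_elim
    case (elim x)
    then show ?case using g(2)[of x] by (cases "0 \<le> f x") auto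
  qed
qed

section \<open>Existence of a solution\<close>

text \<open>Differentiation under the integral sign: by the mean value theorem \<open>N\<close> bounds the difference
  quotients, and dominated convergence applies. The bound is local in time, since derivatives that
  are singular at time 0 have to be covered.\<close>

lemma has_vector_derivative_weighted_integral:
  fixes w :: "real \<Rightarrow> complex" and F F' :: "real \<Rightarrow> real \<Rightarrow> real"
  assumes t0: "a < t0"
    and D: "\<And>\<xi> t. a < t \<Longrightarrow> (F \<xi> has_real_derivative F' \<xi> t) (at t)"
    and B: "\<And>\<xi> t. a < t \<Longrightarrow> \<bar>F' \<xi> t\<bar> \<le> N \<xi>"
    and IF: "\<And>t. a < t \<Longrightarrow> integrable lborel (\<lambda>\<xi>. w \<xi> * of_real (F \<xi> t))"
    and IN: "integrable lborel (\<lambda>\<xi>. w \<xi> * of_real (N \<xi>))"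
    and m: "(\<lambda>\<xi>. F' \<xi> t0) \<in> borel_measurable borel" "w \<in> borel_measurable borel"
  shows "((\<lambda>t. LINT \<xi>|lborel. w \<xi> * of_real (F \<xi> t)) has_vector_derivative (LINT \<xi>|lborel. w \<xi> * of_real (F' \<xi> t0))) (at t0)"
proof -
  let ?P = "\<lambda>t. LINT \<xi>|lborel. w \<xi> * of_real (F \<xi> t)" and ?D = "LINT \<xi>|lborel. w \<xi> * of_real (F' \<xi> t0)"
  have N0: "0 \<le> N \<xi>" for \<xi> using order_trans[OF abs_ge_zero B[OF t0, of \<xi>]] .
  have ID: "integrable lborel (\<lambda>\<xi>. w \<xi> * of_real (F' \<xi> t0))"
    by (rule Bochner_Integration.integrable_bound[OF IN])
       (use m B[OF t0] N0 in \<open>auto simp: norm_mult intro!: mult_left_mono\<close>)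
  have lip: "\<bar>F \<xi> y - F \<xi> t0\<bar> \<le> N \<xi> * \<bar>y - t0\<bar>" if "a < y" for \<xi> y
    using field_differentiable_bound[of "{a<..}" "F \<xi>" "F' \<xi>" "N \<xi>" y t0] that t0
    by (auto intro!: D[THEN has_field_derivative_at_within] B)
  have "((\<lambda>y. ((?P y - ?P t0) - (y - t0) *\<^sub>R ?D) /\<^sub>R norm (y - t0)) \<longlongrightarrow> 0) (at t0 within {a<..})"
    unfolding tendsto_at_iff_sequentially
  proof (intro allI impI)
    fix X assume X: "\<forall>i. X i \<in> {a<..} - {t0}" and lim: "X \<longlonglongrightarrow> t0"
    have Xa: "a < X i" "X i \<noteq> t0" for i using X by auto
    define r where "r = (\<lambda>i \<xi>. ((F \<xi> (X i) - F \<xi> t0) - (X i - t0) * F' \<xi> t0) / \<bar>X i - t0\<bar>)"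
    have e: "((?P (X i) - ?P t0) - (X i - t0) *\<^sub>R ?D) /\<^sub>R norm (X i - t0) = (LINT \<xi>|lborel. w \<xi> * of_real (r i \<xi>))" for i
    proof -
      have "(LINT \<xi>|lborel. w \<xi> * of_real (r i \<xi>)) =
        (LINT \<xi>|lborel. inverse (norm (X i - t0)) *\<^sub>R ((w \<xi> * of_real (F \<xi> (X i)) - w \<xi> * of_real (F \<xi> t0)) - (X i - t0) *\<^sub>R (w \<xi> * of_real (F' \<xi> t0))))"
        by (rule Bochner_Integration.integral_cong)
           (auto simp: r_def scaleR_conv_of_real divide_inverse algebra_simps)
      also have "\<dots> = inverse (norm (X i - t0)) *\<^sub>R ((?P (X i) - ?P t0) - (X i - t0) *\<^sub>R ?D)"
        using IF[OF Xa(1)[of i]] IF[OF t0] ID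
        by (subst integral_scaleR_right, subst Bochner_Integration.integral_diff)
           (auto simp: Bochner_Integration.integral_diff)
      finally show ?thesis by simp
    qed
    have "(\<lambda>i. LINT \<xi>|lborel. w \<xi> * of_real (r i \<xi>)) \<longlonglongrightarrow> integral\<^sup>L lborel (\<lambda>\<xi>::real. 0)"
    proof (rule integral_dominated_convergence[where w = "\<lambda>\<xi>. 2 * norm (w \<xi> * of_real (N \<xi>))"])
      show "integrable lborel (\<lambda>\<xi>. 2 * norm (w \<xi> * of_real (N \<xi>)))"
        by (intro integrable_mult_right integrable_norm IN)
      show "(\<lambda>\<xi>. w \<xi> * complex_of_real (r i \<xi>)) \<in> borel_measurable lborel" for i
      proof -
        have e: "w \<xi> * complex_of_real (r i \<xi>) = ((w \<xi> * of_real (F \<xi> (X i)) - w \<xi> * of_real (F \<xi> t0)) - (X i - t0) *\<^sub>R (w \<xi> * of_real (F' \<xi> t0))) / of_real \<bar>X i - t0\<bar>" for \<xi>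
          by (simp add: r_def scaleR_conv_of_real algebra_simps diff_divide_distrib)
        show ?thesis unfolding e
          using borel_measurable_integrable[OF IF[OF Xa(1)[of i]]] borel_measurable_integrable[OF IF[OF t0]] borel_measurable_integrable[OF ID]
          by (intro borel_measurable_divide borel_measurable_diff borel_measurable_scaleR borel_measurable_const)
      qed
      show "AE \<xi> in lborel. (\<lambda>i. w \<xi> * complex_of_real (r i \<xi>)) \<longlonglongrightarrow> 0"
      proof (rule AE_I2)
        fix \<xi> :: real
        have "(F \<xi> has_derivative (\<lambda>h. h * F' \<xi> t0)) (at t0 within {a<..})"
          using has_field_derivative_at_within[OF D[OF t0]] by (simp add: has_field_derivative_def mult_commute_abs)
        then have "((\<lambda>y. ((F \<xi> y - F \<xi> t0) - (y - t0) * F' \<xi> t0) /\<^sub>R norm (y - t0)) \<longlongrightarrow> 0) (at t0 within {a<..})"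
          by (simp add: has_derivative_at_within)
        then have "((\<lambda>y. ((F \<xi> y - F \<xi> t0) - (y - t0) * F' \<xi> t0) /\<^sub>R norm (y - t0)) \<circ> X) \<longlonglongrightarrow> 0"
          using X lim unfolding tendsto_at_iff_sequentially by blast
        then have "(\<lambda>i. r i \<xi>) \<longlonglongrightarrow> 0" by (simp add: o_def r_def divide_inverse mult.commute)
        then have "(\<lambda>i. w \<xi> * complex_of_real (r i \<xi>)) \<longlonglongrightarrow> w \<xi> * of_real 0" by (intro tendsto_intros)
        then show "(\<lambda>i. w \<xi> * complex_of_real (r i \<xi>)) \<longlonglongrightarrow> 0" by simp
      qed
      show "AE \<xi> in lborel. norm (w \<xi> * complex_of_real (r i \<xi>)) \<le> 2 * norm (w \<xi> * of_real (N \<xi>))" for i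
      proof (rule AE_I2)
        fix \<xi> :: real
        have p: "0 < \<bar>X i - t0\<bar>" using Xa[of i] by simp
        have "\<bar>(F \<xi> (X i) - F \<xi> t0) - (X i - t0) * F' \<xi> t0\<bar> \<le> \<bar>F \<xi> (X i) - F \<xi> t0\<bar> + \<bar>X i - t0\<bar> * \<bar>F' \<xi> t0\<bar>"
          using abs_triangle_ineq4[of "F \<xi> (X i) - F \<xi> t0" "(X i - t0) * F' \<xi> t0"] by (simp add: abs_mult)
        also have "\<dots> \<le> N \<xi> * \<bar>X i - t0\<bar> + \<bar>X i - t0\<bar> * N \<xi>"
          by (intro add_mono lip Xa mult_left_mono B t0) simp
        finally have "\<bar>r i \<xi>\<bar> \<le> 2 * N \<xi>" using p by (simp add: r_def field_simps)
        then have "norm (w \<xi>) * \<bar>r i \<xi>\<bar> \<le> norm (w \<xi>) * (2 * N \<xi>)" by (rule mult_left_mono) simp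
        then show "norm (w \<xi> * complex_of_real (r i \<xi>)) \<le> 2 * norm (w \<xi> * of_real (N \<xi>))"
          using N0[of \<xi>] by (simp add: norm_mult)
      qed
    qed auto
    then show "((\<lambda>y. ((?P y - ?P t0) - (y - t0) *\<^sub>R ?D) /\<^sub>R norm (y - t0)) \<circ> X) \<longlonglongrightarrow> 0"
      unfolding o_def e by simp
  qed
  then have "(?P has_derivative (\<lambda>h. h *\<^sub>R ?D)) (at t0 within {a<..})"
    by (simp add: has_derivative_at_within bounded_linear_scaleR_left)
  then show ?thesis using t0 by (simp add: has_vector_derivative_def at_within_open[of t0 "{a<..}"])
qed

text \<open>Fubini's theorem; the majorant is the product of \<open>N\<close> with a Beta integrand in \<open>s\<close>.\<close>

lemma frac_integral_weighted_integral:
  fixes w :: "real \<Rightarrow> complex" and F' :: "real \<Rightarrow> real \<Rightarrow> real"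
  assumes a: "0 < a" and b: "0 < b" and t: "0 < t"
    and B: "\<And>\<xi> s. 0 < s \<Longrightarrow> \<bar>F' \<xi> s\<bar> \<le> N \<xi> * s powr (b - 1)"
    and IN: "integrable lborel (\<lambda>\<xi>. w \<xi> * of_real (N \<xi>))"
    and m: "(\<lambda>(\<xi>, s). F' \<xi> s) \<in> borel_measurable (borel \<Otimes>\<^sub>M borel)" "w \<in> borel_measurable borel"
  shows "set_integrable lborel {0<..<t} (\<lambda>s. (t - s) powr (a - 1) *\<^sub>R (LINT \<xi>|lborel. w \<xi> * of_real (F' \<xi> s)))"
    and "frac_integral a (\<lambda>s. LINT \<xi>|lborel. w \<xi> * of_real (F' \<xi> s)) t = (LINT \<xi>|lborel. w \<xi> * frac_integral a (\<lambda>s. of_real (F' \<xi> s)) t)"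
    and "integrable lborel (\<lambda>\<xi>. w \<xi> * frac_integral a (\<lambda>s. of_real (F' \<xi> s)) t)"
proof -
  note [measurable] = m
  let ?K = "\<lambda>s. indicator {0<..<t} s *\<^sub>R ((t - s) powr (a - 1) * s powr (b - 1))"
  have IK: "integrable lborel (\<lambda>s. complex_of_real (?K s))"
    using frac_integral_power(1)[OF a b t] unfolding set_integrable_def by (rule integrable_of_real)
  have I0: "integrable (lborel \<Otimes>\<^sub>M lborel) (\<lambda>(\<xi>, s). (w \<xi> * of_real (N \<xi>)) * of_real (?K s) * 1)"
    by (rule integrable_product_bounded[OF IN IK]) auto
  define f where "f = (\<lambda>\<xi> s. w \<xi> * of_real (indicator {0<..<t} s * ((t - s) powr (a - 1) * F' \<xi> s)))"
  have F'm: "case_prod F' \<in> borel_measurable (lborel \<Otimes>\<^sub>M lborel)"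
    using m(1) by (simp cong: measurable_cong_sets add: sets_pair_measure_cong[OF sets_lborel sets_lborel])
  have If: "integrable (lborel \<Otimes>\<^sub>M lborel) (case_prod f)"
  proof (rule Bochner_Integration.integrable_bound[OF I0])
    note [measurable] = F'm
    show "case_prod f \<in> borel_measurable (lborel \<Otimes>\<^sub>M lborel)" unfolding f_def by measurable
    show "AE x in lborel \<Otimes>\<^sub>M lborel. norm (case_prod f x) \<le> norm (case x of (\<xi>, s) \<Rightarrow> (w \<xi> * of_real (N \<xi>)) * of_real (?K s) * 1)"
    proof (rule AE_I2, clarify)
      fix \<xi> s :: real
      show "norm (f \<xi> s) \<le> norm ((w \<xi> * of_real (N \<xi>)) * of_real (?K s) * 1)"
      proof (cases "0 < s \<and> s < t")
        case True
        have N0: "\<bar>F' \<xi> s\<bar> \<le> \<bar>N \<xi>\<bar> * s powr (b - 1)"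
          by (rule order_trans[OF B mult_right_mono]) (use True in auto)
        have "(norm (w \<xi>) * (t - s) powr (a - 1)) * \<bar>F' \<xi> s\<bar> \<le> (norm (w \<xi>) * (t - s) powr (a - 1)) * (\<bar>N \<xi>\<bar> * s powr (b - 1))"
          by (rule mult_left_mono[OF N0]) simp
        then show ?thesis using True by (simp add: f_def norm_mult mult_ac)
      qed (auto simp: f_def)
    qed
  qed
  have e1: "(LINT \<xi>|lborel. f \<xi> s) = indicator {0<..<t} s *\<^sub>R ((t - s) powr (a - 1) *\<^sub>R (LINT \<xi>|lborel. w \<xi> * of_real (F' \<xi> s)))" for s
    unfolding integral_scaleR_right[symmetric]
    by (rule Bochner_Integration.integral_cong) (auto simp: f_def scaleR_conv_of_real)
  have e2: "(LINT s|lborel. f \<xi> s) = w \<xi> * (LBINT s:{0<..<t}. (t - s) powr (a - 1) *\<^sub>R of_real (F' \<xi> s))" for \<xi>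
    unfolding set_lebesgue_integral_def integral_mult_right_zero[symmetric]
    by (rule Bochner_Integration.integral_cong) (auto simp: f_def scaleR_conv_of_real)
  show "set_integrable lborel {0<..<t} (\<lambda>s. (t - s) powr (a - 1) *\<^sub>R (LINT \<xi>|lborel. w \<xi> * of_real (F' \<xi> s)))"
    using lborel_pair.integrable_snd[OF If] unfolding e1 set_integrable_def .
  have "(LBINT s:{0<..<t}. (t - s) powr (a - 1) *\<^sub>R (LINT \<xi>|lborel. w \<xi> * of_real (F' \<xi> s))) =
      (LINT \<xi>|lborel. w \<xi> * (LBINT s:{0<..<t}. (t - s) powr (a - 1) *\<^sub>R of_real (F' \<xi> s)))"
    using lborel_pair.Fubini_integral[OF If] unfolding e1 e2 set_lebesgue_integral_def[symmetric] .
  then show "frac_integral a (\<lambda>s. LINT \<xi>|lborel. w \<xi> * of_real (F' \<xi> s)) t = (LINT \<xi>|lborel. w \<xi> * frac_integral a (\<lambda>s. of_real (F' \<xi> s)) t)"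
    unfolding frac_integral_def mult_scaleR_right integral_scaleR_right by simp
  have "integrable lborel (\<lambda>\<xi>. (1 / Gamma a) *\<^sub>R (LINT s|lborel. f \<xi> s))"
    using lborel_pair.integrable_fst'[OF If] by (intro integrable_scaleR_right) simp
  then show "integrable lborel (\<lambda>\<xi>. w \<xi> * frac_integral a (\<lambda>s. of_real (F' \<xi> s)) t)"
    unfolding e2 frac_integral_def mult_scaleR_right .
qed

lemma relaxation_caputo:
  assumes b: "0 < b" "b < 1 / 2" and t: "0 < t"
  shows "caputo_differentiable (2 * b) (\<lambda>s. of_real (relaxation b k th s)) t"
    and "caputo (2 * b) (\<lambda>s. of_real (relaxation b k th s)) t + 2 * of_real k * caputo b (\<lambda>s. of_real (relaxation b k th s)) t
       = - of_real th * of_real (relaxation b k th t)"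
proof -
  let ?p = "\<lambda>s. complex_of_real (relaxation b k th s)"
  have d: "(?p has_vector_derivative of_real (relaxation_deriv b k th s)) (at s)" if "0 < s" for s
    by (rule has_vector_derivative_of_real)
       (use has_real_derivative_relaxation[OF b(1) that, of k th] in \<open>simp add: has_real_derivative_iff_has_vector_derivative\<close>)
  have vd: "vector_derivative ?p (at s) = of_real (relaxation_deriv b k th s)" if "0 < s" for s
    by (rule vector_derivative_at[OF d[OF that]])
  have "set_integrable lborel {0<..<t} (\<lambda>s. (t - s) powr (1 - 2 * b - 1) * relaxation_deriv b k th s)"
    unfolding relaxation_deriv_def
    by (rule frac_integral_series_integrable) (use b t geom_bounded_relax_coeff in auto)
  then have "integrable lborel (\<lambda>s. complex_of_real (indicator {0<..<t} s *\<^sub>R ((t - s) powr (1 - 2 * b - 1) * relaxation_deriv b k th s)))"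
    unfolding set_integrable_def by (rule integrable_of_real)
  also have "(\<lambda>s. complex_of_real (indicator {0<..<t} s *\<^sub>R ((t - s) powr (1 - 2 * b - 1) * relaxation_deriv b k th s))) =
     (\<lambda>s. indicator {0<..<t} s *\<^sub>R ((t - s) powr (- (2 * b)) *\<^sub>R vector_derivative ?p (at s)))"
    using vd by (auto simp: indicator_def scaleR_conv_of_real fun_eq_iff)
  finally show "caputo_differentiable (2 * b) ?p t"
    unfolding caputo_differentiable_def set_integrable_def
    by (auto intro: differentiableI_vector[OF d])
  have c: "caputo g ?p t = frac_integral (1 - g) (\<lambda>s. of_real (relaxation_deriv b k th s)) t" for g
    unfolding caputo_eq_frac_integral by (rule frac_integral_cong) (rule vd)
  show "caputo (2 * b) ?p t + 2 * of_real k * caputo b ?p t = - of_real th * of_real (relaxation b k th t)"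
    unfolding c by (rule relaxation_deriv_caputo[OF b t])
qed

context time_changed_brownian
begin

lemma relaxation_bounds: "0 \<le> th \<Longrightarrow> 0 < t \<Longrightarrow> \<bar>relaxation \<beta> k th t\<bar> \<le> 1"
  using laplace_inverse_process[of th t] passage.G_bounds[of th t] by simp

lemma theta_nn: "0 \<le> theta \<alpha> lam \<xi>"
  by (rule theta_nonneg) (use params in auto)

text \<open>The density of the Brownian motion at the independent time \<open>V t\<close>, a mixture of normal
  densities of variance \<open>2 * V t\<close>. The value at the point 0 is the prescribed boundary value.\<close>

definition U :: "real \<Rightarrow> real \<Rightarrow> real" where
  "U x t = (if x = 0 then 0 else LINT \<omega>|M. normal_density 0 (sqrt (2 * V t \<omega>)) x)"

lemma U_nonneg: "0 \<le> U x t"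
  unfolding U_def by (auto intro!: Bochner_Integration.integral_nonneg)

text \<open>Fubini's theorem on the product of the probability space and the line. The normal densities
  are genuine because \<open>V t\<close> is almost surely positive.\<close>

lemma U_integral:
  fixes e :: "real \<Rightarrow> complex"
  assumes t: "0 < t" and em[measurable]: "e \<in> borel_measurable borel" and e: "\<And>x. norm (e x) \<le> 1"
  shows "integrable lborel (\<lambda>x. of_real (U x t) * e x)"
    and "(LINT x|lborel. of_real (U x t) * e x) =
      (LINT \<omega>|M. LINT x|lborel. normal_density 0 (sqrt (2 * V t \<omega>)) x *\<^sub>R e x)"
proof -
  interpret P: pair_sigma_finite M lborel ..
  define f where "f = (\<lambda>\<omega> x. normal_density 0 (sqrt (2 * V t \<omega>)) x *\<^sub>R e x)"
  have fm[measurable]: "case_prod f \<in> borel_measurable (M \<Otimes>\<^sub>M lborel)"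
    unfolding f_def normal_density_def by measurable
  have If: "integrable (M \<Otimes>\<^sub>M lborel) (case_prod f)"
  proof (rule P.Fubini_integrable)
    have ix: "integrable lborel (\<lambda>x. f \<omega> x)" if "0 < V t \<omega>" for \<omega>
    proof (rule Bochner_Integration.integrable_bound)
      show "integrable lborel (normal_density 0 (sqrt (2 * V t \<omega>)))" by (rule integrable_normal_density) (use that in simp)
      show "(\<lambda>x. f \<omega> x) \<in> borel_measurable lborel" unfolding f_def by measurable
    qed (auto simp: f_def intro!: mult_left_le e)
    show "AE \<omega> in M. integrable lborel (\<lambda>x. case_prod f (\<omega>, x))"
      using AE_V_pos[OF t] by eventually_elim (simp add: ix)
    show "integrable M (\<lambda>\<omega>. LINT x|lborel. norm (case_prod f (\<omega>, x)))"
    proof (rule integrable_const_bound[where B = 1])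
      show "AE \<omega> in M. norm (LINT x|lborel. norm (case_prod f (\<omega>, x))) \<le> 1"
        using AE_V_pos[OF t]
      proof eventually_elim
        case (elim \<omega>)
        have "(LINT x|lborel. norm (f \<omega> x)) \<le> (LINT x|lborel. normal_density 0 (sqrt (2 * V t \<omega>)) x)"
          by (rule integral_mono[OF integrable_norm[OF ix[OF elim]]])
             (use elim in \<open>auto simp: f_def intro!: mult_left_le e\<close>)
        also have "\<dots> = 1" by (rule integral_normal_density) (use elim in simp)
        finally show ?case by simp
      qed
    qed measurable
  qed measurable
  have ae: "AE x in lborel. (LINT \<omega>|M. f \<omega> x) = of_real (U x t) * e x"
    using AE_lborel_singleton[of 0]
  proof eventually_elim
    case (elim x)
    have "(LINT \<omega>|M. f \<omega> x) = (LINT \<omega>|M. of_real (normal_density 0 (sqrt (2 * V t \<omega>)) x) * e x)"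
      by (simp add: f_def scaleR_conv_of_real)
    also have "\<dots> = of_real (LINT \<omega>|M. normal_density 0 (sqrt (2 * V t \<omega>)) x) * e x"
      by simp
    finally show ?case using elim t by (simp add: U_def)
  qed
  have Um: "(\<lambda>x. of_real (U x t) * e x) \<in> borel_measurable lborel"
    unfolding U_def normal_density_def by measurable
  have I1: "integrable lborel (\<lambda>x. LINT \<omega>|M. f \<omega> x)" by (rule P.integrable_snd[OF If])
  show "integrable lborel (\<lambda>x. of_real (U x t) * e x)"
    by (rule integrable_cong_AE_imp[OF I1 Um]) (use ae in eventually_elim, simp)
  have "(LINT x|lborel. of_real (U x t) * e x) = (LINT x|lborel. LINT \<omega>|M. f \<omega> x)"
    by (rule integral_cong_AE) (use Um borel_measurable_integrable[OF I1] ae in auto)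
  also have "\<dots> = (LINT \<omega>|M. LINT x|lborel. f \<omega> x)"
    by (rule P.Fubini_integral[OF If])
  finally show "(LINT x|lborel. of_real (U x t) * e x) =
      (LINT \<omega>|M. LINT x|lborel. normal_density 0 (sqrt (2 * V t \<omega>)) x *\<^sub>R e x)" by (simp add: f_def)
qed

lemma U_integrable: "0 < t \<Longrightarrow> integrable lborel (\<lambda>x. U x t)"
  using integrable_Re[OF U_integral(1)[of t "\<lambda>_. 1"]] by simp

lemma fourier_U:
  assumes t: "0 < t"
  shows "fourier (\<lambda>x. of_real (U x t)) \<xi> = of_real (relaxation \<beta> k (theta \<alpha> lam \<xi>) t)"
proof -
  have "fourier (\<lambda>x. of_real (U x t)) \<xi> = (LINT x|lborel. of_real (U x t) * iexp (\<xi> * x))"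
    unfolding fourier_def by (simp add: mult.commute)
  also have "\<dots> = (LINT \<omega>|M. LINT x|lborel. normal_density 0 (sqrt (2 * V t \<omega>)) x *\<^sub>R iexp (\<xi> * x))"
    by (rule U_integral(2)[OF t]) auto
  also have "\<dots> = (LINT \<omega>|M. complex_of_real (exp (- (\<xi>\<^sup>2 * V t \<omega>))))"
  proof (rule integral_cong_AE)
    show "AE \<omega> in M. (LINT x|lborel. normal_density 0 (sqrt (2 * V t \<omega>)) x *\<^sub>R iexp (\<xi> * x)) = complex_of_real (exp (- (\<xi>\<^sup>2 * V t \<omega>)))"
      using AE_V_pos[OF t]
    proof eventually_elim
      case (elim \<omega>)
      then show ?case by (subst integral_normal_density_iexp) (auto simp: mult.commute)
    qed
    show "(\<lambda>\<omega>. LINT x|lborel. normal_density 0 (sqrt (2 * V t \<omega>)) x *\<^sub>R iexp (\<xi> * x)) \<in> borel_measurable M"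
      unfolding normal_density_def by measurable
  qed measurable
  also have "\<dots> = of_real (relaxation \<beta> k (theta \<alpha> lam \<xi>) t)"
    using laplace_V[OF zero_le_power2[of \<xi>] t] by (simp add: theta_def)
  finally show ?thesis .
qed

lemma pairing_U:
  assumes \<phi>: "schwartz \<phi>" and t: "0 < t"
  shows "pairing U \<phi> t = 1 / (2 * of_real pi) * (LINT \<xi>|lborel. fourier \<phi> \<xi> * of_real (relaxation \<beta> k (theta \<alpha> lam \<xi>) t))"
  using pairing_fourier[of \<phi> U t, OF \<phi> U_integrable[OF t]] by (simp add: fourier_U[OF t] theta_minus)

text \<open>By \<open>pairing_U\<close>, both sides of the tested equation are integrals of \<open>fourier \<phi> \<xi>\<close> against the
  two sides of the relaxation equation at \<open>theta \<alpha> lam \<xi>\<close>. The time derivatives may be taken under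
  the integral because \<open>relaxation_deriv_bound\<close> grows at most quadratically in \<open>\<xi>\<close>, which the
  decay of \<open>fourier \<phi>\<close> compensates.\<close>

lemma solution_U: "tempered_solution \<alpha> \<beta> lam k U"
  unfolding tempered_solution_def
proof (intro conjI allI impI)
  have par: "0 < \<alpha>" "\<alpha> < 1" "0 \<le> lam" and b: "0 < \<beta>" "\<beta> < 1 / 2" and k: "0 < k" using params by auto
  show "integrable lborel (\<lambda>x. U x t)" if "0 < t" for t by (rule U_integrable[OF that])
  show "U 0 t = 0" for t by (simp add: U_def)
  show "\<exists>C. \<forall>t\<in>{0<..b}. (LBINT x. \<bar>U x t\<bar>) \<le> C" for b
  proof (intro exI ballI)
    fix t assume "t \<in> {0<..b}"
    then have t: "0 < t" by simp
    have "complex_of_real (LBINT x. \<bar>U x t\<bar>) = fourier (\<lambda>x. of_real (U x t)) 0"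
      by (simp add: fourier_def U_nonneg)
    also have "\<dots> = of_real (relaxation \<beta> k (theta \<alpha> lam 0) t)" by (rule fourier_U[OF t])
    finally have "(LBINT x. \<bar>U x t\<bar>) = relaxation \<beta> k (theta \<alpha> lam 0) t" by (simp only: of_real_eq_iff)
    then show "(LBINT x. \<bar>U x t\<bar>) \<le> 1" using relaxation_bounds[OF theta_nn t, of 0] by linarith
  qed
  fix \<phi> :: "real \<Rightarrow> complex"
  let ?th = "theta \<alpha> lam"
  let ?c = "1 / (2 * complex_of_real pi)"
  have wm[measurable]: "fourier \<phi> \<in> borel_measurable borel" if "schwartz \<phi>"
    using schwartz_measurable[OF that] by measurable
  have IFb: "integrable lborel (\<lambda>\<xi>. fourier \<phi> \<xi> * of_real (g \<xi>))"
    if \<phi>: "schwartz \<phi>" and [measurable]: "g \<in> borel_measurable borel" and "\<And>\<xi>. \<bar>g \<xi>\<bar> \<le> K * (1 + \<xi>\<^sup>2)" for g K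
    using schwartz_weighted_fourier_integrable[OF \<phi> _ that(3)] by (simp add: mult.commute)
  have relm[measurable]: "(\<lambda>\<xi>. relaxation \<beta> k (?th \<xi>) t) \<in> borel_measurable borel" for t
  proof -
    note [measurable] = measurable_relax_coeff
    have "(\<lambda>th. relaxation \<beta> k th t) \<in> borel_measurable borel"
      unfolding relaxation_def frac_series_def by measurable
    then show ?thesis by measurable
  qed
  have relI: "integrable lborel (\<lambda>\<xi>. fourier \<phi> \<xi> * of_real (relaxation \<beta> k (?th \<xi>) t))" if "schwartz \<phi>" "0 < t" for t
  proof (rule IFb[of "\<lambda>\<xi>. relaxation \<beta> k (?th \<xi>) t" 1, OF that(1) relm])
    fix \<xi> :: real
    show "\<bar>relaxation \<beta> k (?th \<xi>) t\<bar> \<le> 1 * (1 + \<xi>\<^sup>2)"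
      by (rule order_trans[OF relaxation_bounds[OF theta_nn that(2)]]) simp
  qed
  show "(pairing U \<phi> \<longlongrightarrow> \<phi> 0) (at_right 0)" if \<phi>: "schwartz \<phi>"
    unfolding tendsto_at_iff_sequentially
  proof (intro allI impI)
    fix X assume X: "\<forall>i. X i \<in> {0<..} - {0::real}" and lim: "X \<longlonglongrightarrow> 0"
    then have Xp: "0 < X i" for i by auto
    have "(\<lambda>i. LINT \<xi>|lborel. fourier \<phi> \<xi> * of_real (relaxation \<beta> k (?th \<xi>) (X i))) \<longlonglongrightarrow> (LINT \<xi>|lborel. fourier \<phi> \<xi>)"
    proof (rule integral_dominated_convergence[where w = "\<lambda>\<xi>. norm (fourier \<phi> \<xi>)"])
      show "integrable lborel (\<lambda>\<xi>. norm (fourier \<phi> \<xi>))"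
        using IFb[OF \<phi>, of "\<lambda>_. 1" 1] by (intro integrable_norm) simp
      show "AE \<xi> in lborel. (\<lambda>i. fourier \<phi> \<xi> * of_real (relaxation \<beta> k (?th \<xi>) (X i))) \<longlonglongrightarrow> fourier \<phi> \<xi>"
      proof (rule AE_I2)
        fix \<xi> :: real
        have "(relaxation \<beta> k (?th \<xi>) \<circ> X) \<longlonglongrightarrow> 1"
          using relaxation_tendsto_1[OF b(1), of k "?th \<xi>"] X lim unfolding tendsto_at_iff_sequentially by blast
        then have "(\<lambda>i. fourier \<phi> \<xi> * of_real (relaxation \<beta> k (?th \<xi>) (X i))) \<longlonglongrightarrow> fourier \<phi> \<xi> * of_real 1"
          unfolding o_def by (intro tendsto_intros)
        then show "(\<lambda>i. fourier \<phi> \<xi> * of_real (relaxation \<beta> k (?th \<xi>) (X i))) \<longlonglongrightarrow> fourier \<phi> \<xi>" by simp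
      qed
      show "AE \<xi> in lborel. norm (fourier \<phi> \<xi> * of_real (relaxation \<beta> k (?th \<xi>) (X i))) \<le> norm (fourier \<phi> \<xi>)" for i
        using relaxation_bounds[OF theta_nn Xp] by (intro AE_I2) (auto simp: norm_mult intro!: mult_left_le)
    qed (use wm[OF \<phi>] relI[OF \<phi> Xp] in auto)
    then have "(\<lambda>i. ?c * (LINT \<xi>|lborel. fourier \<phi> \<xi> * of_real (relaxation \<beta> k (?th \<xi>) (X i)))) \<longlonglongrightarrow> ?c * (LINT \<xi>|lborel. fourier \<phi> \<xi>)"
      by (intro tendsto_mult tendsto_const)
    moreover have "\<phi> 0 = ?c * (LINT \<xi>|lborel. fourier \<phi> \<xi>)"
      using fourier_inversion[OF \<phi>, of 0] by simp
    ultimately show "(pairing U \<phi> \<circ> X) \<longlonglongrightarrow> \<phi> 0"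
      unfolding o_def by (simp add: pairing_U[OF \<phi> Xp])
  qed
  fix t :: real
  assume A: "schwartz \<phi> \<and> 0 < t"
  then have \<phi>: "schwartz \<phi>" and t: "0 < t" by auto
  note [measurable] = wm[OF \<phi>]
  let ?R = "\<lambda>\<xi> s. relaxation_deriv \<beta> k (?th \<xi>) s"
  let ?N = "\<lambda>\<xi>. ?th \<xi> / Gamma (2 * \<beta>)"
  have G2: "0 < Gamma (2 * \<beta>)" using b by (intro Gamma_real_pos) simp
  have Rb: "\<bar>?R \<xi> s\<bar> \<le> ?N \<xi> * s powr (2 * \<beta> - 1)" if "0 < s" for \<xi> s
    using relaxation_deriv_bound[OF b(1) that _ theta_nn relaxation_deriv_nonpos[OF theta_nn], of \<xi>] k by simp
  have Rm: "(\<lambda>(\<xi>, s). ?R \<xi> s) \<in> borel_measurable (borel \<Otimes>\<^sub>M borel)"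
  proof -
    have "(\<lambda>x. (\<lambda>(th, t). relaxation_deriv \<beta> k th t) (?th (fst x), snd x)) \<in> borel_measurable (borel \<Otimes>\<^sub>M borel)"
      by (rule measurable_compose[OF _ measurable_relaxation_deriv]) measurable
    then show ?thesis by (simp add: case_prod_beta')
  qed
  have IN: "integrable lborel (\<lambda>\<xi>. fourier \<phi> \<xi> * of_real (?N \<xi> * c))" for c
  proof (rule IFb[of "\<lambda>\<xi>. ?N \<xi> * c" "(1 + lam) / Gamma (2 * \<beta>) * \<bar>c\<bar>", OF \<phi>])
    fix \<xi> :: real
    have "\<bar>?th \<xi>\<bar> * (\<bar>c\<bar> / Gamma (2 * \<beta>)) \<le> ((1 + lam) * (1 + \<xi>\<^sup>2)) * (\<bar>c\<bar> / Gamma (2 * \<beta>))"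
      by (rule mult_right_mono[OF theta_bound[OF par]]) (use G2 in auto)
    then show "\<bar>?N \<xi> * c\<bar> \<le> (1 + lam) / Gamma (2 * \<beta>) * \<bar>c\<bar> * (1 + \<xi>\<^sup>2)"
      using G2 by (simp add: abs_mult mult_ac)
  qed measurable
  define Q where "Q = (\<lambda>s. LINT \<xi>|lborel. fourier \<phi> \<xi> * of_real (?R \<xi> s))"
  have der: "(pairing U \<phi> has_vector_derivative ?c * Q s) (at s)" if s: "0 < s" for s
  proof -
    have "((\<lambda>t. LINT \<xi>|lborel. fourier \<phi> \<xi> * of_real (relaxation \<beta> k (?th \<xi>) t)) has_vector_derivative Q s) (at s)"
      unfolding Q_def
    \<comment> \<open>The derivative of the relaxation function is unbounded near time 0, so times below \<open>s / 2\<close> are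
      excluded.\<close>
    proof (rule has_vector_derivative_weighted_integral[where a = "s / 2" and N = "\<lambda>\<xi>. ?N \<xi> * (s / 2) powr (2 * \<beta> - 1)"])
      show "(relaxation \<beta> k (?th \<xi>) has_real_derivative ?R \<xi> t) (at t)" if "s / 2 < t" for \<xi> t
        by (rule has_real_derivative_relaxation) (use b s that in auto)
      show "\<bar>?R \<xi> t\<bar> \<le> ?N \<xi> * (s / 2) powr (2 * \<beta> - 1)" if "s / 2 < t" for \<xi> t
      proof -
        have "t powr (2 * \<beta> - 1) \<le> (s / 2) powr (2 * \<beta> - 1)" by (rule powr_mono2') (use b s that in auto)
        moreover have "0 \<le> ?N \<xi>" using theta_nn[of \<xi>] G2 by simp
        moreover have "0 < t" using s that by linarith
        ultimately show ?thesis using order_trans[OF Rb mult_left_mono] by blast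
      qed
      show "(\<lambda>\<xi>. ?R \<xi> s) \<in> borel_measurable borel"
        using measurable_compose[OF _ Rm, of "\<lambda>\<xi>. (\<xi>, s)" borel] by simp
    qed (use s relI[OF \<phi>] IN in auto)
    then have "((\<lambda>t. ?c * (LINT \<xi>|lborel. fourier \<phi> \<xi> * of_real (relaxation \<beta> k (?th \<xi>) t))) has_vector_derivative ?c * Q s) (at s)"
      by (rule has_vector_derivative_mult_right)
    then show ?thesis
      by (rule has_vector_derivative_transform_within_open[where S = "{0<..}"])
         (use s in \<open>auto simp: pairing_U[OF \<phi>]\<close>)
  qed
  have vd: "vector_derivative (pairing U \<phi>) (at s) = ?c * Q s" if "0 < s" for s
    by (rule vector_derivative_at[OF der[OF that]])
  have b2: "0 < 2 * \<beta>" using b by simp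
  have Iw: "integrable lborel (\<lambda>\<xi>. fourier \<phi> \<xi> * of_real (?N \<xi>))" using IN[of 1] by simp
  have FI: "set_integrable lborel {0<..<t} (\<lambda>s. (t - s) powr (a - 1) *\<^sub>R Q s)"
    "frac_integral a Q t = (LINT \<xi>|lborel. fourier \<phi> \<xi> * frac_integral a (\<lambda>s. of_real (?R \<xi> s)) t)" if "0 < a" for a
    unfolding Q_def
    using frac_integral_weighted_integral[OF that b2 t Rb Iw Rm] by auto
  have CD: "caputo_differentiable g (pairing U \<phi>) t" if "g < 1" for g
    unfolding caputo_differentiable_def
  proof (intro conjI ballI)
    show "pairing U \<phi> differentiable at \<tau>" if "\<tau> \<in> {0<..<t}" for \<tau>
      using der[of \<tau>] that by (auto intro: differentiableI_vector)
    have "set_integrable lborel {0<..<t} (\<lambda>s. ?c * ((t - s) powr (1 - g - 1) *\<^sub>R Q s))"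
      by (rule set_integrable_mult_right) (rule FI, use that in simp)
    also have "?this \<longleftrightarrow> set_integrable lborel {0<..<t} (\<lambda>s. (t - s) powr (- g) *\<^sub>R vector_derivative (pairing U \<phi>) (at s))"
      by (rule set_integrable_cong) (auto simp: vd)
    finally show "set_integrable lborel {0<..<t} (\<lambda>s. (t - s) powr (- g) *\<^sub>R vector_derivative (pairing U \<phi>) (at s))" .
  qed
  show "caputo_differentiable (2 * \<beta>) (pairing U \<phi>) t" "caputo_differentiable \<beta> (pairing U \<phi>) t"
    by (rule CD, use b in simp)+
  have C: "caputo g (pairing U \<phi>) t = ?c * (LINT \<xi>|lborel. fourier \<phi> \<xi> * frac_integral (1 - g) (\<lambda>s. of_real (?R \<xi> s)) t)" if "g < 1" for g
  proof -
    have "caputo g (pairing U \<phi>) t = frac_integral (1 - g) (\<lambda>s. ?c * Q s) t"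
      unfolding caputo_eq_frac_integral by (rule frac_integral_cong) (rule vd)
    also have "\<dots> = ?c * frac_integral (1 - g) Q t" by (rule frac_integral_cmult)
    finally show ?thesis using FI(2)[of "1 - g"] that by simp
  qed
  have Ifr: "integrable lborel (\<lambda>\<xi>. fourier \<phi> \<xi> * frac_integral a (\<lambda>s. of_real (?R \<xi> s)) t)" if a: "0 < a" for a
    by (rule frac_integral_weighted_integral(3)[OF a b2 t Rb Iw Rm wm[OF \<phi>]])
  have i1: "integrable lborel (\<lambda>\<xi>. fourier \<phi> \<xi> * frac_integral (1 - 2 * \<beta>) (\<lambda>s. of_real (?R \<xi> s)) t)" by (rule Ifr) (use b in simp)
  have i2: "integrable lborel (\<lambda>\<xi>. (2 * of_real k) * (fourier \<phi> \<xi> * frac_integral (1 - \<beta>) (\<lambda>s. of_real (?R \<xi> s)) t))"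
    by (rule integrable_mult_right) (rule Ifr, use b in simp)
  have "caputo (2 * \<beta>) (pairing U \<phi>) t + 2 * of_real k * caputo \<beta> (pairing U \<phi>) t =
    ?c * ((LINT \<xi>|lborel. fourier \<phi> \<xi> * frac_integral (1 - 2 * \<beta>) (\<lambda>s. of_real (?R \<xi> s)) t) +
      (LINT \<xi>|lborel. (2 * of_real k) * (fourier \<phi> \<xi> * frac_integral (1 - \<beta>) (\<lambda>s. of_real (?R \<xi> s)) t)))"
    unfolding integral_mult_right_zero using C[of "2 * \<beta>"] C[of \<beta>] b by (simp add: algebra_simps)
  also have "\<dots> = ?c * (LINT \<xi>|lborel. of_real (- ?th \<xi>) * fourier \<phi> \<xi> * fourier (\<lambda>x. of_real (U x t)) (- \<xi>))"
  proof -
    have "fourier \<phi> \<xi> * frac_integral (1 - 2 * \<beta>) (\<lambda>s. of_real (?R \<xi> s)) t +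
       (2 * of_real k) * (fourier \<phi> \<xi> * frac_integral (1 - \<beta>) (\<lambda>s. of_real (?R \<xi> s)) t) =
       of_real (- ?th \<xi>) * fourier \<phi> \<xi> * fourier (\<lambda>x. of_real (U x t)) (- \<xi>)" for \<xi>
    proof -
      have "fourier \<phi> \<xi> * (frac_integral (1 - 2 * \<beta>) (\<lambda>s. of_real (?R \<xi> s)) t +
       2 * of_real k * frac_integral (1 - \<beta>) (\<lambda>s. of_real (?R \<xi> s)) t) = fourier \<phi> \<xi> * (- of_real (?th \<xi>) * of_real (relaxation \<beta> k (?th \<xi>) t))"
        unfolding relaxation_deriv_caputo[OF b t] ..
      then show ?thesis by (simp add: fourier_U[OF t] theta_minus algebra_simps)
    qed
    then show ?thesis unfolding Bochner_Integration.integral_add[OF i1 i2, symmetric] by simp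
  qed
  also have "\<dots> = pairing U (\<lambda>x. of_real (lam powr \<alpha>) * \<phi> x - frac_power_op lam \<alpha> \<phi> x) t"
    by (rule pairing_operator_fourier[of \<alpha> lam \<phi> U t, OF par \<phi> U_integrable[OF t], symmetric])
  finally show "caputo (2 * \<beta>) (pairing U \<phi>) t + 2 * of_real k * caputo \<beta> (pairing U \<phi>) t =
    pairing U (\<lambda>x. of_real (lam powr \<alpha>) * \<phi> x - frac_power_op lam \<alpha> \<phi> x) t" .
qed

end

section \<open>Uniqueness of the solution\<close>

lemma pairing_bound:
  assumes u: "integrable lborel (\<lambda>x. u x t)" and g: "g \<in> borel_measurable borel" "\<And>x. norm (g x) \<le> K"
  shows "norm (pairing u g t) \<le> K * (LINT x|lborel. \<bar>u x t\<bar>)"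
proof -
  have "norm (pairing u g t) \<le> (LINT x|lborel. K * \<bar>u x t\<bar>)"
    unfolding pairing_def
  proof (rule order_trans[OF integral_norm_bound integral_mono])
    have b: "norm (complex_of_real (u x t) * g x) \<le> K * \<bar>u x t\<bar>" for x
      using mult_left_mono[OF g(2)[of x], of "\<bar>u x t\<bar>"] by (simp add: norm_mult mult.commute)
    show "norm (complex_of_real (u x t) * g x) \<le> K * \<bar>u x t\<bar>" for x by (rule b)
    show I: "integrable lborel (\<lambda>x. K * \<bar>u x t\<bar>)" using u by (intro integrable_mult_right integrable_abs)
    have [measurable]: "(\<lambda>x. u x t) \<in> borel_measurable borel" using borel_measurable_integrable[OF u] by simp
    note [measurable] = g(1)
    have "integrable lborel (\<lambda>x. complex_of_real (u x t) * g x)"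
      by (rule Bochner_Integration.integrable_bound[OF I]) (use order_trans[OF b abs_ge_self] in auto)
    then show "integrable lborel (\<lambda>x. norm (complex_of_real (u x t) * g x))" by (rule integrable_norm)
  qed
  then show ?thesis by simp
qed

lemma pairing_tendsto:
  assumes u: "integrable lborel (\<lambda>x. u x t)" and g: "\<And>n. g n \<in> borel_measurable borel" "\<And>n x. norm (g n x) \<le> K"
    and lim: "\<And>x. (\<lambda>n. g n x) \<longlonglongrightarrow> h x"
  shows "(\<lambda>n. pairing u (g n) t) \<longlonglongrightarrow> pairing u h t"
  unfolding pairing_def
proof (rule integral_dominated_convergence[where w = "\<lambda>x. K * \<bar>u x t\<bar>"])
  have [measurable]: "(\<lambda>x. u x t) \<in> borel_measurable borel" using borel_measurable_integrable[OF u] by simp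
  note [measurable] = g(1)
  have [measurable]: "h \<in> borel_measurable borel" by (rule borel_measurable_LIMSEQ_metric[OF g(1) lim])
  show "(\<lambda>x. complex_of_real (u x t) * h x) \<in> borel_measurable lborel" by measurable
  show "(\<lambda>x. complex_of_real (u x t) * g n x) \<in> borel_measurable lborel" for n by measurable
  show "integrable lborel (\<lambda>x. K * \<bar>u x t\<bar>)" using u by (intro integrable_mult_right integrable_abs)
  show "AE x in lborel. (\<lambda>n. complex_of_real (u x t) * g n x) \<longlonglongrightarrow> complex_of_real (u x t) * h x"
    by (intro AE_I2 tendsto_intros lim)
  show "AE x in lborel. norm (complex_of_real (u x t) * g n x) \<le> K * \<bar>u x t\<bar>" for n
  proof (rule AE_I2)
    fix x
    show "norm (complex_of_real (u x t) * g n x) \<le> K * \<bar>u x t\<bar>"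
      using mult_left_mono[OF g(2)[of n x], of "\<bar>u x t\<bar>"] by (simp add: norm_mult mult.commute)
  qed
qed

lemma frac_power_op_gaussian_wave:
  assumes s: "0 < s"
  shows "frac_power_op lam \<alpha> (gaussian_wave \<xi>0 s) x =
    (LINT \<xi>|lborel. normal_density (- \<xi>0) s \<xi> *\<^sub>R (iexp (- (\<xi> * x)) * of_real ((lam + \<xi>\<^sup>2) powr \<alpha>)))"
proof -
  have "(LINT \<xi>|lborel. iexp (- (\<xi> * x)) * (of_real ((lam + \<xi>\<^sup>2) powr \<alpha>) * fourier (gaussian_wave \<xi>0 s) \<xi>)) =
    (LINT \<xi>|lborel. (2 * of_real pi) * (normal_density (- \<xi>0) s \<xi> *\<^sub>R (iexp (- (\<xi> * x)) * of_real ((lam + \<xi>\<^sup>2) powr \<alpha>))))"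
    by (rule Bochner_Integration.integral_cong) (auto simp: fourier_gaussian_wave[OF s] scaleR_conv_of_real)
  then show ?thesis unfolding frac_power_op_def integral_mult_right_zero by simp
qed

text \<open>The operator integrates its symbol against the Fourier transform of the packet, a normal
  density that shrinks to the point \<open>- \<xi>0\<close>; the symbol is even. The modulus of the integrand does
  not depend on \<open>x\<close>, so the convergent sequence of its integrals provides the uniform bound.\<close>

lemma frac_power_op_gaussian_wave_tendsto:
  assumes par: "0 < \<alpha>" "\<alpha> < 1" "0 \<le> lam"
  shows "(\<lambda>n. frac_power_op lam \<alpha> (gaussian_wave \<xi>0 (1 / real (Suc n))) x) \<longlonglongrightarrow>
      iexp (\<xi>0 * x) * of_real ((lam + \<xi>0\<^sup>2) powr \<alpha>)"
    and "\<exists>K. \<forall>n x. norm (frac_power_op lam \<alpha> (gaussian_wave \<xi>0 (1 / real (Suc n))) x) \<le> K"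
    and "frac_power_op lam \<alpha> (gaussian_wave \<xi>0 (1 / real (Suc n))) \<in> borel_measurable borel"
proof -
  let ?m = "\<lambda>\<xi>. (lam + \<xi>\<^sup>2) powr \<alpha>"
  let ?s = "\<lambda>n. 1 / real (Suc n)"
  note mc = continuous_powr_symbol[OF par(1,3)]
  note mb = powr_symbol_bound[OF par]
  have "(\<lambda>n. LINT \<xi>|lborel. normal_density (- \<xi>0) (?s n) \<xi> *\<^sub>R (iexp (- (\<xi> * x)) * of_real (?m \<xi>))) \<longlonglongrightarrow>
    iexp (- ((- \<xi>0) * x)) * of_real (?m (- \<xi>0))"
    by (rule gaussian_approximate_identity[where C = "1 + lam"])
       (use mb mc in \<open>auto intro!: continuous_intros simp: norm_mult\<close>)
  then show "(\<lambda>n. frac_power_op lam \<alpha> (gaussian_wave \<xi>0 (?s n)) x) \<longlonglongrightarrow> iexp (\<xi>0 * x) * of_real (?m \<xi>0)"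
    by (subst frac_power_op_gaussian_wave) simp_all
  have "(\<lambda>n. LINT \<xi>|lborel. normal_density (- \<xi>0) (?s n) \<xi> *\<^sub>R complex_of_real (?m \<xi>)) \<longlonglongrightarrow> of_real (?m (- \<xi>0))"
    by (rule gaussian_approximate_identity[where C = "1 + lam"])
       (use mb mc in \<open>auto intro!: continuous_intros\<close>)
  then have "Bseq (\<lambda>n. LINT \<xi>|lborel. normal_density (- \<xi>0) (?s n) \<xi> *\<^sub>R complex_of_real (?m \<xi>))"
    by (intro convergent_imp_Bseq convergentI)
  then obtain K where K: "\<And>n. norm (LINT \<xi>|lborel. normal_density (- \<xi>0) (?s n) \<xi> *\<^sub>R complex_of_real (?m \<xi>)) \<le> K"
    by (auto elim!: BseqE)
  have "norm (frac_power_op lam \<alpha> (gaussian_wave \<xi>0 (?s n)) x) \<le> K" for n x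
  proof -
    have "norm (frac_power_op lam \<alpha> (gaussian_wave \<xi>0 (?s n)) x) \<le>
      (LINT \<xi>|lborel. norm (normal_density (- \<xi>0) (?s n) \<xi> *\<^sub>R (iexp (- (\<xi> * x)) * complex_of_real (?m \<xi>))))"
      by (subst frac_power_op_gaussian_wave) (simp, rule integral_norm_bound)
    also have "\<dots> = (LINT \<xi>|lborel. normal_density (- \<xi>0) (?s n) \<xi> * ?m \<xi>)"
      by (simp add: norm_mult)
    also have "\<dots> \<le> norm (complex_of_real (LINT \<xi>|lborel. normal_density (- \<xi>0) (?s n) \<xi> * ?m \<xi>))"
      by (simp only: norm_of_real abs_ge_self)
    also have "complex_of_real (LINT \<xi>|lborel. normal_density (- \<xi>0) (?s n) \<xi> * ?m \<xi>) =
       (LINT \<xi>|lborel. normal_density (- \<xi>0) (?s n) \<xi> *\<^sub>R complex_of_real (?m \<xi>))"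
      by (subst integral_complex_of_real[symmetric]) (simp add: scaleR_conv_of_real)
    finally show ?thesis using K[of n] by linarith
  qed
  then show "\<exists>K. \<forall>n x. norm (frac_power_op lam \<alpha> (gaussian_wave \<xi>0 (?s n)) x) \<le> K" by blast
  have "(\<lambda>x. LINT \<xi>|lborel. normal_density (- \<xi>0) (?s n) \<xi> *\<^sub>R (iexp (- (\<xi> * x)) * complex_of_real (?m \<xi>))) \<in> borel_measurable borel"
    unfolding normal_density_def by measurable
  then show "frac_power_op lam \<alpha> (gaussian_wave \<xi>0 (?s n)) \<in> borel_measurable borel"
    by (subst measurable_cong[OF frac_power_op_gaussian_wave]) simp_all
qed

context time_changed_brownian
begin

text \<open>Along the wave packets the tested equation, integrated to a Volterra equation, converges to
  a Volterra equation for the Fourier transform of \<open>u\<close> at the single frequency \<open>\<xi>0\<close>. The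
  relaxation function satisfies the same equation. The difference is bounded on \<open>{0<..t}\<close> since
  the \<open>L\<^sup>1\<close>-norms of a solution are, and hence vanishes.\<close>

lemma fourier_solution:
  assumes sol: "tempered_solution \<alpha> \<beta> lam k u" and t: "0 < t"
  shows "fourier (\<lambda>x. of_real (u x t)) \<xi>0 = of_real (relaxation \<beta> k (theta \<alpha> lam \<xi>0) t)"
proof -
  have par: "0 < \<alpha>" "\<alpha> < 1" "0 \<le> lam" and b: "0 < \<beta>" "\<beta> < 1 / 2" and k: "0 < k" using params by auto
  have b2: "0 < 2 * \<beta>" using b by simp
  let ?th = "theta \<alpha> lam \<xi>0"
  let ?m0 = "(lam + \<xi>0\<^sup>2) powr \<alpha>"
  define \<phi> where "\<phi> = (\<lambda>n. gaussian_wave \<xi>0 (1 / real (Suc n)))"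
  define A where "A = (\<lambda>n x. of_real (lam powr \<alpha>) * \<phi> n x - frac_power_op lam \<alpha> (\<phi> n) x)"
  define v where "v = (\<lambda>s. fourier (\<lambda>x. of_real (u x s)) \<xi>0)"
  define G where "G = (\<lambda>s. complex_of_real (relaxation \<beta> k ?th s))"
  have S: "schwartz (\<phi> n)" for n unfolding \<phi>_def by (rule schwartz_gaussian_wave) simp
  have ui: "integrable lborel (\<lambda>x. u x s)" if "0 < s" for s
    using sol that unfolding tempered_solution_def by blast
  obtain C where C: "\<And>s. 0 < s \<Longrightarrow> s \<le> t \<Longrightarrow> (LINT x|lborel. \<bar>u x s\<bar>) \<le> C"
    using sol t unfolding tempered_solution_def by (metis greaterThanAtMost_iff)
  have C0: "0 \<le> C"
    by (rule order_trans[OF Bochner_Integration.integral_nonneg C[OF t order_refl]]) simp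
  have CD: "caputo_differentiable (2 * \<beta>) (pairing u (\<phi> n)) s"
    "caputo (2 * \<beta>) (pairing u (\<phi> n)) s + 2 * of_real k * caputo \<beta> (pairing u (\<phi> n)) s = pairing u (A n) s" if "0 < s" for n s
    using sol S[of n] that unfolding tempered_solution_def A_def by blast+
  have init: "(pairing u (\<phi> n) \<longlongrightarrow> 1) (at_right 0)" for n
  proof -
    have "(pairing u (\<phi> n) \<longlongrightarrow> \<phi> n 0) (at_right 0)" using sol S unfolding tempered_solution_def by blast
    then show ?thesis by (simp add: \<phi>_def gaussian_wave_def)
  qed
  have \<phi>m: "\<phi> n \<in> borel_measurable borel" for n by (rule schwartz_measurable[OF S])
  have \<phi>1: "norm (\<phi> n x) \<le> 1" for n x unfolding \<phi>_def by (rule gaussian_wave_norm_le)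
  have \<phi>lim: "(\<lambda>n. \<phi> n x) \<longlonglongrightarrow> iexp (\<xi>0 * x)" for x
  proof -
    have "(\<lambda>n. exp (- ((1 / real (Suc n))\<^sup>2 * x\<^sup>2) / 2)) \<longlonglongrightarrow> 1" by real_asymp
    then have "(\<lambda>n. \<phi> n x) \<longlonglongrightarrow> iexp (\<xi>0 * x) * of_real 1"
      unfolding \<phi>_def gaussian_wave_def by (intro tendsto_intros)
    then show ?thesis by simp
  qed
  obtain K where K: "\<And>n x. norm (frac_power_op lam \<alpha> (\<phi> n) x) \<le> K"
    using frac_power_op_gaussian_wave_tendsto(2)[OF par, of \<xi>0] unfolding \<phi>_def by blast
  have K0: "0 \<le> K" using order_trans[OF norm_ge_zero K[of 0 0]] .
  have Am: "A n \<in> borel_measurable borel" for n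
  proof -
    note [measurable] = \<phi>m[of n]
    have [measurable]: "frac_power_op lam \<alpha> (\<phi> n) \<in> borel_measurable borel"
      unfolding \<phi>_def by (rule frac_power_op_gaussian_wave_tendsto(3)[OF par])
    show ?thesis unfolding A_def by measurable
  qed
  have Ab: "norm (A n x) \<le> lam powr \<alpha> + K" for n x
  proof -
    have "norm (A n x) \<le> norm (of_real (lam powr \<alpha>) * \<phi> n x) + norm (frac_power_op lam \<alpha> (\<phi> n) x)"
      unfolding A_def by (rule norm_triangle_ineq4)
    also have "\<dots> \<le> lam powr \<alpha> + K"
      using K[of n x] mult_left_mono[OF \<phi>1[of n x], of "lam powr \<alpha>"] by (simp add: norm_mult)
    finally show ?thesis .
  qed
  have Alim: "(\<lambda>n. A n x) \<longlonglongrightarrow> - of_real ?th * iexp (\<xi>0 * x)" for x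
  proof -
    have "(\<lambda>n. A n x) \<longlonglongrightarrow> of_real (lam powr \<alpha>) * iexp (\<xi>0 * x) - iexp (\<xi>0 * x) * of_real ?m0"
      unfolding A_def using frac_power_op_gaussian_wave_tendsto(1)[OF par, of \<xi>0 x]
      by (intro tendsto_diff tendsto_mult tendsto_const \<phi>lim) (simp add: \<phi>_def)
    then show ?thesis by (simp add: theta_def algebra_simps)
  qed
  have plim: "(\<lambda>n. pairing u (\<phi> n) s) \<longlonglongrightarrow> v s" if "0 < s" for s
  proof -
    have "(\<lambda>n. pairing u (\<phi> n) s) \<longlonglongrightarrow> pairing u (\<lambda>x. iexp (\<xi>0 * x)) s"
      by (rule pairing_tendsto[of u s \<phi>, OF ui[OF that] \<phi>m \<phi>1 \<phi>lim])
    then show ?thesis by (simp add: v_def fourier_def pairing_def mult.commute)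
  qed
  have qlim: "(\<lambda>n. pairing u (A n) s) \<longlonglongrightarrow> - of_real ?th * v s" if "0 < s" for s
  proof -
    have "(\<lambda>n. pairing u (A n) s) \<longlonglongrightarrow> pairing u (\<lambda>x. - of_real ?th * iexp (\<xi>0 * x)) s"
      by (rule pairing_tendsto[of u s A, OF ui[OF that] Am Ab Alim])
    also have "pairing u (\<lambda>x. - of_real ?th * iexp (\<xi>0 * x)) s = (LINT x|lborel. (- of_real ?th) * (iexp (\<xi>0 * x) * of_real (u x s)))"
      unfolding pairing_def by (rule Bochner_Integration.integral_cong) (auto simp: mult_ac)
    also have "\<dots> = - of_real ?th * v s" unfolding integral_mult_right_zero by (simp add: v_def fourier_def)
    finally show ?thesis .
  qed
  have pb: "norm (pairing u (\<phi> n) s) \<le> C" if "0 < s" "s \<le> t" for n s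
    using pairing_bound[of u s, OF ui[OF that(1)] \<phi>m[of n] \<phi>1] C[OF that] by simp
  have qb: "norm (pairing u (A n) s) \<le> (lam powr \<alpha> + K) * C" if "0 < s" "s \<le> t" for n s
    by (rule order_trans[OF pairing_bound[of u s, OF ui[OF that(1)] Am[of n] Ab] mult_left_mono[OF C[OF that]]])
       (use K0 in simp)
  have vb: "norm (v s) \<le> C" if "0 < s" "s \<le> t" for s
    by (rule LIMSEQ_le_const2[OF tendsto_norm[OF plim[OF that(1)]]]) (use pb[OF that] in auto)
  have contm: "(\<lambda>x. indicator {0<..<s} x *\<^sub>R ((s - x) powr (a - 1) *\<^sub>R f x)) \<in> borel_measurable lborel"
    if "\<And>x. 0 < x \<Longrightarrow> isCont f x" for s a and f :: "real \<Rightarrow> complex"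
  proof -
    have "(\<lambda>x. indicator {0<..<s} x *\<^sub>R f x) \<in> borel_measurable borel"
      by (rule borel_measurable_continuous_on_indicator) (use that in \<open>auto intro: continuous_at_imp_continuous_on\<close>)
    then have "(\<lambda>x. (s - x) powr (a - 1) *\<^sub>R (indicator {0<..<s} x *\<^sub>R f x)) \<in> borel_measurable borel"
      by (rule borel_measurable_scaleR[rotated]) simp
    then show ?thesis by (simp add: mult.commute)
  qed
  have pcont: "isCont (\<lambda>s. pairing u (\<phi> n) s - 1) x" if "0 < x" for n x
  proof -
    have "pairing u (\<phi> n) differentiable (at x)"
      using CD(1)[of "x + 1" n] that by (simp add: caputo_differentiable_def)
    then have "isCont (pairing u (\<phi> n)) x" by (rule differentiable_imp_continuous_within)
    then show ?thesis by (intro continuous_intros)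
  qed
  have p1: "norm (pairing u (\<phi> n) s - 1) \<le> C + 1" if "0 < s" "s \<le> t" for n s
    using norm_triangle_ineq4[of "pairing u (\<phi> n) s" 1] pb[OF that, of n] by simp
  have Gc: "isCont G s" if "0 < s" for s
    unfolding G_def using DERIV_isCont[OF has_real_derivative_relaxation[OF b(1) that, of k ?th]] by (rule isCont_of_real)
  have Gb: "norm (G s) \<le> 1" if "0 < s" for s
    unfolding G_def using relaxation_bounds[OF theta_nn that] by simp
  have Glim: "(G \<longlongrightarrow> 1) (at_right 0)"
    unfolding G_def using tendsto_of_real[OF relaxation_tendsto_1[OF b(1), of k ?th]] by simp
  have G1: "norm (G s - 1) \<le> 2" if "0 < s" for s
    using norm_triangle_ineq4[of "G s" 1] Gb[OF that] by simp
  \<comment> \<open>Difference of the Volterra equations for \<open>v\<close>, obtained in the limit, and for \<open>G\<close>.\<close>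
  have zero: "v s - G s + 2 * of_real k * frac_integral \<beta> (\<lambda>x. v x - G x) s + of_real ?th * frac_integral (2 * \<beta>) (\<lambda>x. v x - G x) s = 0"
    if s: "0 < s" "s \<le> t" for s
  proof -
    have T1: "(\<lambda>n. frac_integral \<beta> (\<lambda>x. pairing u (\<phi> n) x - 1) s) \<longlonglongrightarrow> frac_integral \<beta> (\<lambda>x. v x - 1) s"
      "set_integrable lborel {0<..<s} (\<lambda>x. (s - x) powr (\<beta> - 1) *\<^sub>R (v x - 1))"
    proof -
      have l: "(\<lambda>n. pairing u (\<phi> n) x - 1) \<longlonglongrightarrow> v x - 1" if "0 < x" "x < s" for x
        by (intro tendsto_intros plim that)
      have bb: "norm (pairing u (\<phi> n) x - 1) \<le> C + 1" if "0 < x" "x < s" for n x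
        by (rule p1) (use that s in auto)
      show "(\<lambda>n. frac_integral \<beta> (\<lambda>x. pairing u (\<phi> n) x - 1) s) \<longlonglongrightarrow> frac_integral \<beta> (\<lambda>x. v x - 1) s"
        by (rule frac_integral_tendsto(1)[OF b(1) s(1) l bb contm[OF pcont]])
      show "set_integrable lborel {0<..<s} (\<lambda>x. (s - x) powr (\<beta> - 1) *\<^sub>R (v x - 1))"
        by (rule frac_integral_tendsto(2)[OF b(1) s(1) l bb contm[OF pcont]])
    qed
    have T2: "(\<lambda>n. frac_integral (2 * \<beta>) (pairing u (A n)) s) \<longlonglongrightarrow> frac_integral (2 * \<beta>) (\<lambda>x. - of_real ?th * v x) s"
      "set_integrable lborel {0<..<s} (\<lambda>x. (s - x) powr (2 * \<beta> - 1) *\<^sub>R (- of_real ?th * v x))"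
    proof -
      have bb: "norm (pairing u (A n) x) \<le> (lam powr \<alpha> + K) * C" if "0 < x" "x < s" for n x
        by (rule qb) (use that s in auto)
      have mm: "(\<lambda>x. indicator {0<..<s} x *\<^sub>R ((s - x) powr (2 * \<beta> - 1) *\<^sub>R pairing u (A n) x)) \<in> borel_measurable lborel" for n
        using caputo_equation_imp_volterra(1)[OF b CD[of _ n] init[of n] s(1)]
        unfolding set_integrable_def by (rule borel_measurable_integrable)
      show "(\<lambda>n. frac_integral (2 * \<beta>) (pairing u (A n)) s) \<longlonglongrightarrow> frac_integral (2 * \<beta>) (\<lambda>x. - of_real ?th * v x) s"
        by (rule frac_integral_tendsto(1)[OF b2 s(1) qlim bb mm])
      show "set_integrable lborel {0<..<s} (\<lambda>x. (s - x) powr (2 * \<beta> - 1) *\<^sub>R (- of_real ?th * v x))"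
        by (rule frac_integral_tendsto(2)[OF b2 s(1) qlim bb mm])
    qed
    have "(\<lambda>n. pairing u (\<phi> n) s - 1 + 2 * of_real k * frac_integral \<beta> (\<lambda>x. pairing u (\<phi> n) x - 1) s) \<longlonglongrightarrow>
        v s - 1 + 2 * of_real k * frac_integral \<beta> (\<lambda>x. v x - 1) s"
      by (intro tendsto_intros plim s T1)
    moreover have "pairing u (\<phi> n) s - 1 + 2 * of_real k * frac_integral \<beta> (\<lambda>x. pairing u (\<phi> n) x - 1) s =
        frac_integral (2 * \<beta>) (pairing u (A n)) s" for n
      by (rule caputo_equation_imp_volterra(2)[OF b CD[of _ n] init[of n] s(1)])
    ultimately have "(\<lambda>n. frac_integral (2 * \<beta>) (pairing u (A n)) s) \<longlonglongrightarrow> v s - 1 + 2 * of_real k * frac_integral \<beta> (\<lambda>x. v x - 1) s"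
      by simp
    then have Ev: "v s - 1 + 2 * of_real k * frac_integral \<beta> (\<lambda>x. v x - 1) s = frac_integral (2 * \<beta>) (\<lambda>x. - of_real ?th * v x) s"
      using T2(1) by (rule LIMSEQ_unique)
    have EG: "G s - 1 + 2 * of_real k * frac_integral \<beta> (\<lambda>x. G x - 1) s = frac_integral (2 * \<beta>) (\<lambda>x. - of_real ?th * G x) s"
      unfolding G_def
      by (rule caputo_equation_imp_volterra(2)[OF b relaxation_caputo[OF b] Glim[unfolded G_def] s(1)])
    have J1: "set_integrable lborel {0<..<s} (\<lambda>x. (s - x) powr (\<beta> - 1) *\<^sub>R (G x - 1))"
    proof (rule frac_integral_tendsto(2)[OF b(1) s(1), where fn = "\<lambda>n x. G x - 1" and C = 2])
      show "(\<lambda>x. indicator {0<..<s} x *\<^sub>R ((s - x) powr (\<beta> - 1) *\<^sub>R (G x - 1))) \<in> borel_measurable lborel"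
        by (rule contm) (intro continuous_intros Gc)
    qed (use G1 in auto)
    have J2: "set_integrable lborel {0<..<s} (\<lambda>x. (s - x) powr (2 * \<beta> - 1) *\<^sub>R (- of_real ?th * G x))"
    proof (rule frac_integral_tendsto(2)[OF b2 s(1), where fn = "\<lambda>n x. - of_real ?th * G x" and C = "?th"])
      show "(\<lambda>x. indicator {0<..<s} x *\<^sub>R ((s - x) powr (2 * \<beta> - 1) *\<^sub>R (- of_real ?th * G x))) \<in> borel_measurable lborel"
        by (rule contm) (intro continuous_intros Gc)
    qed (use Gb theta_nn[of \<xi>0] in \<open>auto intro: mult_left_le simp: norm_mult\<close>)
    have D1: "frac_integral \<beta> (\<lambda>x. v x - G x) s = frac_integral \<beta> (\<lambda>x. v x - 1) s - frac_integral \<beta> (\<lambda>x. G x - 1) s"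
      using frac_integral_diff[OF T1(2) J1] by simp
    have "frac_integral (2 * \<beta>) (\<lambda>x. - of_real ?th * (v x - G x)) s =
      frac_integral (2 * \<beta>) (\<lambda>x. - of_real ?th * v x) s - frac_integral (2 * \<beta>) (\<lambda>x. - of_real ?th * G x) s"
      using frac_integral_diff[OF T2(2) J2] by (simp only: right_diff_distrib)
    then have D2: "- of_real ?th * frac_integral (2 * \<beta>) (\<lambda>x. v x - G x) s =
      frac_integral (2 * \<beta>) (\<lambda>x. - of_real ?th * v x) s - frac_integral (2 * \<beta>) (\<lambda>x. - of_real ?th * G x) s"
      unfolding frac_integral_cmult .
    have "v s - G s + 2 * of_real k * frac_integral \<beta> (\<lambda>x. v x - G x) s = - of_real ?th * frac_integral (2 * \<beta>) (\<lambda>x. v x - G x) s"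
      unfolding D1 D2 Ev[symmetric] EG[symmetric] by (simp add: algebra_simps)
    then show ?thesis by simp
  qed
  have "v t - G t = 0"
  proof (rule volterra_unique_zero[where d = "\<lambda>x. v x - G x" and T = t and C = "C + 1" and k = k and th = ?th, OF b(1)])
    show "norm (v s - G s) \<le> C + 1" if "0 < s" "s \<le> t" for s
      using norm_triangle_ineq4[of "v s" "G s"] vb[OF that] Gb[OF that(1)] by linarith
  qed (use zero t in auto)
  then show ?thesis by (simp add: v_def G_def)
qed

lemma solution_AE_eq_U:
  assumes sol: "tempered_solution \<alpha> \<beta> lam k u" and t: "0 < t"
  shows "AE x in lborel. u x t = U x t"
proof (rule fourier_injective)
  show "integrable lborel (\<lambda>x. u x t)" using sol t unfolding tempered_solution_def by blast
qed (use t in \<open>simp_all add: U_integrable U_nonneg fourier_solution[OF sol t] fourier_U\<close>)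

section \<open>The law of the time-changed process\<close>

lemma char_distr_W:
  assumes t: "0 < t"
  shows "char (distr M borel (W t)) \<xi> = of_real (relaxation \<beta> k (theta \<alpha> lam \<xi>) t)"
proof -
  have "char (distr M borel (W t)) \<xi> = (LINT \<omega>|M. iexp (\<xi> * W t \<omega>))"
    unfolding char_def by (rule integral_distr) simp_all
  then show ?thesis unfolding char_W[OF t] .
qed

text \<open>The density \<open>U\<close> and the law of \<open>W t\<close> both have the relaxation function as characteristic
  function, so Levy's uniqueness theorem identifies them.\<close>

lemma distributed_W:
  assumes t: "0 < t"
  shows "distributed M lborel (W t) (\<lambda>x. ennreal (U x t))"
proof -
  have [measurable]: "(\<lambda>x. U x t) \<in> borel_measurable borel" using borel_measurable_integrable[OF U_integrable[OF t]] by simp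
  have one: "(LINT x|lborel. U x t) = 1"
  proof -
    have "complex_of_real (LINT x|lborel. U x t) = fourier (\<lambda>x. of_real (U x t)) 0" by (simp add: fourier_def)
    also have "\<dots> = char (distr M borel (W t)) 0" unfolding fourier_U[OF t] char_distr_W[OF t] ..
    also have "\<dots> = 1" by (rule real_distribution.char_zero) (rule real_distribution_distr, simp)
    finally show ?thesis by (simp only: of_real_eq_1_iff)
  qed
  let ?N = "density lborel (\<lambda>x. ennreal (U x t))"
  have "(\<integral>\<^sup>+x. ennreal (U x t) \<partial>lborel) = 1"
    using nn_integral_eq_integral[OF U_integrable[OF t]] U_nonneg by (simp add: one)
  then have "prob_space ?N" by (intro prob_spaceI) (simp add: emeasure_density)
  then have R: "real_distribution ?N"
    unfolding real_distribution_def real_distribution_axioms_def by simp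
  have "distr M borel (W t) = ?N"
  proof (rule Levy_uniqueness[OF _ R])
    show "real_distribution (distr M borel (W t))" by (rule real_distribution_distr) simp
    show "char (distr M borel (W t)) = char ?N"
    proof
      fix \<xi>
      have "char ?N \<xi> = (LINT x|lborel. U x t *\<^sub>R iexp (\<xi> * x))"
        unfolding char_def by (rule integral_density) (use U_nonneg in auto)
      also have "\<dots> = fourier (\<lambda>x. of_real (U x t)) \<xi>" by (simp add: fourier_def scaleR_conv_of_real mult.commute)
      finally show "char (distr M borel (W t)) \<xi> = char ?N \<xi>" by (simp add: fourier_U[OF t] char_distr_W[OF t])
    qed
  qed
  moreover have "distr M lborel (W t) = distr M borel (W t)" by (rule distr_cong) auto
  ultimately show ?thesis unfolding distributed_def by simp
qed

end

text \<open>Consequently a value of \<open>theta\<close> is attained at no more than two opposite frequencies. The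
  frequencies with a double root are therefore isolated.\<close>

lemma theta_eq_iff:
  assumes \<alpha>: "0 < \<alpha>" and lam: "0 \<le> lam"
  shows "theta \<alpha> lam \<eta> = theta \<alpha> lam \<xi> \<longleftrightarrow> \<bar>\<eta>\<bar> = \<bar>\<xi>\<bar>"
proof
  assume e: "theta \<alpha> lam \<eta> = theta \<alpha> lam \<xi>"
  have "lam + \<eta>\<^sup>2 = lam + \<xi>\<^sup>2"
  proof (rule ccontr)
    assume "lam + \<eta>\<^sup>2 \<noteq> lam + \<xi>\<^sup>2"
    then consider "lam + \<eta>\<^sup>2 < lam + \<xi>\<^sup>2" | "lam + \<xi>\<^sup>2 < lam + \<eta>\<^sup>2" by linarith
    then show False
      using powr_less_mono2[of \<alpha> "lam + \<eta>\<^sup>2" "lam + \<xi>\<^sup>2"] powr_less_mono2[of \<alpha> "lam + \<xi>\<^sup>2" "lam + \<eta>\<^sup>2"] \<alpha> lam e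
      by cases (auto simp: theta_def)
  qed
  then show "\<bar>\<eta>\<bar> = \<bar>\<xi>\<bar>" by (simp add: power2_eq_iff abs_eq_iff)
next
  assume "\<bar>\<eta>\<bar> = \<bar>\<xi>\<bar>"
  then have "\<eta>\<^sup>2 = \<xi>\<^sup>2" by (metis power2_abs)
  then show "theta \<alpha> lam \<eta> = theta \<alpha> lam \<xi>" by (simp add: theta_def)
qed

theorem theorem3p1:
  fixes \<alpha> \<beta> lam k :: real
    and M :: "'w measure"
    and B T H1 H2 L W :: "real \<Rightarrow> 'w \<Rightarrow> real"
  assumes "0 < \<alpha>" "\<alpha> < 1" "0 < \<beta>" "\<beta> < 1 / 2" "0 \<le> lam" "0 < k"
    and "prob_space M"
    and "brownian_motion M B"
    and "tempered_stable_subordinator lam \<alpha> M T"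
    and "stable_subordinator (2 * \<beta>) M H1"
    and "stable_subordinator \<beta> M H2"
    and "independent_processes M [B, T, H1, H2]"
    and L: "\<And>t \<omega>. L t \<omega> = inverse_process \<beta> k H1 H2 t \<omega>"
    and W: "\<And>t \<omega>. W t \<omega> = B (T (L t \<omega>) \<omega>) \<omega>"
  shows "(\<exists>u. tempered_solution \<alpha> \<beta> lam k u) \<and>
    (\<forall>u. tempered_solution \<alpha> \<beta> lam k u \<longrightarrow>
      (\<forall>t>0.
        (AE x in lborel. 0 \<le> u x t) \<and>
        distributed M lborel (W t) (\<lambda>x. ennreal (u x t)) \<and>
        (\<forall>\<xi>.
          (theta \<alpha> lam \<xi> \<noteq> k\<^sup>2 \<longrightarrow>
             fourier (\<lambda>x. of_real (u x t)) \<xi> = fund_sol_fourier \<alpha> \<beta> lam k \<xi> t) \<and>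
          (theta \<alpha> lam \<xi> = k\<^sup>2 \<longrightarrow>
             ((\<lambda>\<eta>. fund_sol_fourier \<alpha> \<beta> lam k \<eta> t) \<longlongrightarrow> fourier (\<lambda>x. of_real (u x t)) \<xi>) (at \<xi>)))))"
proof -
  interpret X: time_changed_brownian M \<alpha> \<beta> lam k B T H1 H2
    using assms(1-12) by (intro time_changed_brownian.intro time_changed_brownian_axioms.intro)
  have WX: "W t = X.W t" for t
    by (rule ext) (simp add: W L X.W_def X.V_def X.inverse_process_eq)
  show ?thesis
  proof (intro conjI allI impI)
    show "\<exists>u. tempered_solution \<alpha> \<beta> lam k u" using X.solution_U by blast
    fix u t assume sol: "tempered_solution \<alpha> \<beta> lam k u" and t: "0 < (t :: real)"
    have ae: "AE x in lborel. u x t = X.U x t" by (rule X.solution_AE_eq_U[OF sol t])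
    then show "AE x in lborel. 0 \<le> u x t" by eventually_elim (simp add: X.U_nonneg)
    have ui: "integrable lborel (\<lambda>x. u x t)" using sol t unfolding tempered_solution_def by blast
    have [measurable]: "(\<lambda>x. u x t) \<in> borel_measurable borel" "(\<lambda>x. X.U x t) \<in> borel_measurable borel"
      using borel_measurable_integrable[OF ui] borel_measurable_integrable[OF X.U_integrable[OF t]] by auto
    show "distributed M lborel (W t) (\<lambda>x. ennreal (u x t))"
      unfolding WX
    proof (subst distributed_cong_density)
      show "AE x in lborel. ennreal (u x t) = ennreal (X.U x t)" using ae by eventually_elim simp
      show "distributed M lborel (X.W t) (\<lambda>x. ennreal (X.U x t))" by (rule X.distributed_W[OF t])
    qed measurable
    fix \<xi>
    have fs: "fund_sol_fourier \<alpha> \<beta> lam k \<eta> t = fourier (\<lambda>x. of_real (u x t)) \<eta>" if "theta \<alpha> lam \<eta> \<noteq> k\<^sup>2" for \<eta>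
      using fund_sol_fourier_eq_relaxation[OF assms(3) t that] X.fourier_solution[OF sol t] by simp
    then show "fourier (\<lambda>x. of_real (u x t)) \<xi> = fund_sol_fourier \<alpha> \<beta> lam k \<xi> t" if "theta \<alpha> lam \<xi> \<noteq> k\<^sup>2"
      using that by simp
    assume th: "theta \<alpha> lam \<xi> = k\<^sup>2"
    have xi: "\<xi> \<noteq> 0" using th assms(6) by (auto simp: theta_def)
    have fc: "fourier (\<lambda>x. of_real (u x t)) \<eta> = char (distr M borel (X.W t)) \<eta>" for \<eta>
      unfolding X.fourier_solution[OF sol t] X.char_distr_W[OF t] ..
    \<comment> \<open>Within distance \<open>\<bar>\<xi>\<bar>\<close> of the double root \<open>\<xi>\<close> there is no other one, and there the closed
      formula is the continuous characteristic function of \<open>W t\<close>.\<close>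
    have "isCont (char (distr M borel (X.W t))) \<xi>"
      by (rule real_distribution.isCont_char) (rule X.real_distribution_distr, rule X.W_meas)
    then have "(char (distr M borel (X.W t)) \<longlongrightarrow> fourier (\<lambda>x. of_real (u x t)) \<xi>) (at \<xi>)"
      unfolding fc by (simp add: isCont_def)
    moreover have "eventually (\<lambda>\<eta>. char (distr M borel (X.W t)) \<eta> = fund_sol_fourier \<alpha> \<beta> lam k \<eta> t) (at \<xi>)"
      unfolding eventually_at
    proof (intro exI[of _ "\<bar>\<xi>\<bar>"] conjI ballI impI)
      show "0 < \<bar>\<xi>\<bar>" using xi by simp
      fix \<eta> assume "\<eta> \<noteq> \<xi> \<and> dist \<eta> \<xi> < \<bar>\<xi>\<bar>"
      then have "\<bar>\<eta>\<bar> \<noteq> \<bar>\<xi>\<bar>" by (auto simp: dist_real_def abs_if split: if_splits)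
      then have "theta \<alpha> lam \<eta> \<noteq> k\<^sup>2" using theta_eq_iff[OF assms(1,5), of \<eta> \<xi>] th by simp
      then show "char (distr M borel (X.W t)) \<eta> = fund_sol_fourier \<alpha> \<beta> lam k \<eta> t" by (simp add: fs fc)
    qed
    ultimately show "((\<lambda>\<eta>. fund_sol_fourier \<alpha> \<beta> lam k \<eta> t) \<longlongrightarrow> fourier (\<lambda>x. of_real (u x t)) \<xi>) (at \<xi>)"
      by (rule Lim_transform_eventually)
  qed
qed

end
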